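(* Let $n\ge2$ and let $\lambda$ be a strict partition with at most $n$ parts. Then the operators $e'_i,f'_i$ ($i\in[n-1]$) and $e'_{\overline1},f'_{\overline1}$ defined below are well-defined maps $\mathsf{SetDecTab}_n(\lambda)\to\mathsf{SetDecTab}_n(\lambda)\sqcup\{0\}$, and together with the weight map $\operatorname{wt}$ they make $\mathsf{SetDecTab}_n(\lambda)$ into a $\sqrt{\mathfrak{q}_n}$-crystal.
   Context: Tableaux. A strict partition is $\lambda=(\lambda_1>\dots>\lambda_\ell>0)$; $\mathsf{SD}_\lambda=\{(r,r+j-1): r\in[\ell], j\in[\lambda_r]\}$, box $(r,c)$ in row $r$, column $c$. A hook word is a finite sequence $w_1\cdots w_k$ of positive integers with $w_1\ge\dots\ge w_m<w_{m+1}<\dots<w_k$ for some $m\in[k]$. A decomposition tableau of shape $\lambda$ is a map $T:\mathsf{SD}_\lambda\to\mathbb{Z}_{>0}$ such that, with $\rho_r$ row $r$ read in increasing column order, each $\rho_r$ is a hook word and for $r\in[\ell-1]$, $\rho_r$ is a hook subword of maximal length in $\rho_{r+1}\rho_r$. A set-valued decomposition tableau assigns to each box a finite nonempty subset $T_{rc}\subseteq\mathbb{Z}_{>0}$ such that every distribution (choice of one element per box) is a decomposition tableau; $\mathsf{SetDecTab}_n(\lambda)$: those with entries in $[n]$. $\operatorname{wt}(T)\in\mathbb{N}^n$ has $k$-th entry the number of boxes containing $k$. Reverse row reading order: row $1$ right to left, then row $2$ right to left, etc. Linked $i$-word: read the boxes in reverse row reading order; for a box containing $i$ but not $i+1$ write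 ")", for one containing $i+1$ but not $i$ write "(", for one containing both write the three characters ")$-$(", and nothing for other boxes. Ignoring "$-$", match parentheses in the usual way. Define the equivalence relation on characters generated by: a matched "(" and ")" and everything between them are equivalent; the three characters of each ")$-$(" are equivalent. Classes are contiguous subwords. A class is a null form if it contains no unmatched parenthesis; a left form if it has no unmatched ")" and ends with an unmatched "("; a right form if it has no unmatched "(" and starts with an unmatched ")"; a combined form if it starts with an unmatched ")" and ends with an unmatched "(". $e'_i(T)$: if the linked $i$-word has a combined form, remove $i+1$ from the box corresponding to the ")$-$(" at the end of that combined form; otherwise, if there is no left form, $e'_i(T)=0$; otherwise add $i$ to the box corresponding to the "(" at the start of the first left form. $f'_i(T)$: if there is a combined form, remove $i$ from the box corresponding to the ")$-$(" at the beginning of that combined form; otherwise, if there is no right form, $f'_i(T)=0$; otherwise add $i+1$ to the box corresponding to the ")" at the end of the last right form. $e'_{\overline1},f'_{\overline1}$: if no box contains $1$ or $2$, both give $0$. Otherwise let $(r,c)$ be the first box in reverse row reading order containing $1$ or $2$. $e'_{\overline1}$: if $1\notin T_{rc}\ni2$, add $1$ to $T_{rc}$; if $\{1,2\}\subseteq T_{rc}$, remove $2$; if $1\in T_{rc}\not\ni2$, give $0$. $f'_{\overline1}$: if $1\in T_{rc}\not\ni2$, add $2$; if $\{1,2\}\subseteq T_{rc}$, remove $1$; if $1\notin T_{rc}\ni2$, give $0$. Square-root crystals. A $\sqrt{\mathfrak{gl}_n}$-crystal is a set $\mathcal{B}$ with $\operatorname{wt}:\mathcal{B}\to\mathbb{N}^n$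 and $e'_i,f'_i:\mathcal{B}\to\mathcal{B}\sqcup\{0\}$ ($i\in[n-1]$, $0\notin\mathcal{B}$); set $\varepsilon'_i(b)=\sup\{k\ge0:(e'_i)^k(b)\ne0\}$, $\varphi'_i(b)=\sup\{k\ge0:(f'_i)^k(b)\ne0\}$. Require: (a) $\varepsilon'_i(b)+\varphi'_i(b)\in2\mathbb{N}$ and $\frac{\varphi'_i(b)-\varepsilon'_i(b)}2=\operatorname{wt}(b)_i-\operatorname{wt}(b)_{i+1}$; (b) $e'_i(b)=c$ iff $b=f'_i(c)$, in which case $\operatorname{wt}(c)-\operatorname{wt}(b)$ is $\mathbf{e}_i$ if $\varepsilon'_i(b)$ is even and $-\mathbf{e}_{i+1}$ if odd. A $\sqrt{\mathfrak{q}_n}$-crystal is a $\sqrt{\mathfrak{gl}_n}$-crystal with extra $e'_{\overline1},f'_{\overline1}$ (and $\varepsilon'_{\overline1},\varphi'_{\overline1}$ defined analogously) commuting with $e'_i,f'_i$ and preserving $\varepsilon'_i,\varphi'_i$ for $3\le i\le n-1$, such that (a) $\varepsilon'_{\overline1}(b)+\varphi'_{\overline1}(b)$ is $0$ if $\operatorname{wt}(b)_1=\operatorname{wt}(b)_2=0$ and $2$ otherwise; (b) $e'_{\overline1}(b)=c$ iff $b=f'_{\overline1}(c)$, in which case $\operatorname{wt}(c)-\operatorname{wt}(b)$ is $\mathbf{e}_1$ if $\varepsilon'_{\overline1}(b)=2$ and $-\mathbf{e}_2$ if $\varepsilon'_{\overline1}(b)=1$. *)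

theory Defs
  imports Complex_Main "HOL-Library.Sublist" "HOL-Library.Extended_Nat"
begin

section \<open>Square-root crystals\<close>

text \<open>
  The set \<open>B \<squnion> {0}\<close> is rendered by the type \<open>'b option\<close>, with \<open>None\<close> for \<open>0\<close>; operators are
  composed with \<open>0 \<mapsto> 0\<close>.
\<close>

definition iter_op :: "('b \<Rightarrow> 'b option) \<Rightarrow> nat \<Rightarrow> 'b \<Rightarrow> 'b option" where
  "iter_op g k b = ((\<lambda>x. Option.bind x g) ^^ k) (Some b)"

text \<open>
  This is \<open>\<epsilon>'\<close> for \<open>g = e'\<close> and \<open>\<phi>'\<close> for \<open>g = f'\<close>; the supremum is infinite if \<open>g\<close> can be
  iterated indefinitely on \<open>b\<close>.
\<close>

definition string_length :: "('b \<Rightarrow> 'b option) \<Rightarrow> 'b \<Rightarrow> enat" where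
  "string_length g b = (SUP k\<in>{k. iter_op g k b \<noteq> None}. enat k)"

definition commute_on :: "'b set \<Rightarrow> ('b \<Rightarrow> 'b option) \<Rightarrow> ('b \<Rightarrow> 'b option) \<Rightarrow> bool" where
  "commute_on B g h \<longleftrightarrow> (\<forall>b\<in>B. Option.bind (g b) h = Option.bind (h b) g)"

text \<open>
  An element of \<open>\<nat>^n\<close> is a function on \<open>nat\<close> that vanishes outside \<open>{1..n}\<close>.
\<close>

definition nat_vectors :: "nat \<Rightarrow> (nat \<Rightarrow> nat) set" where
  "nat_vectors n = {v. \<forall>k. k \<notin> {1..n} \<longrightarrow> v k = 0}"

definition unit_vec :: "nat \<Rightarrow> nat \<Rightarrow> int" where
  "unit_vec i k = (if k = i then 1 else 0)"

definition vec_diff :: "(nat \<Rightarrow> nat) \<Rightarrow> (nat \<Rightarrow> nat) \<Rightarrow> nat \<Rightarrow> int" where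
  "vec_diff v w k = int (v k) - int (w k)"

locale sqrt_gl_crystal =
  fixes n :: nat
    and B :: "'b set"
    and wt :: "'b \<Rightarrow> nat \<Rightarrow> nat"
    and e f :: "nat \<Rightarrow> 'b \<Rightarrow> 'b option"
  assumes wt_closed: "b \<in> B \<Longrightarrow> wt b \<in> nat_vectors n"
    and e_closed: "i \<in> {1..n-1} \<Longrightarrow> b \<in> B \<Longrightarrow> e i b = Some c \<Longrightarrow> c \<in> B"
    and f_closed: "i \<in> {1..n-1} \<Longrightarrow> b \<in> B \<Longrightarrow> f i b = Some c \<Longrightarrow> c \<in> B"
    and strings: "i \<in> {1..n-1} \<Longrightarrow> b \<in> B \<Longrightarrow>
      \<exists>p q. string_length (e i) b = enat p \<and> string_length (f i) b = enat q \<and>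
        even (p + q) \<and>
        (real q - real p) / 2 = real (wt b i) - real (wt b (i+1))"
    and e_f_inverse: "i \<in> {1..n-1} \<Longrightarrow> b \<in> B \<Longrightarrow> c \<in> B \<Longrightarrow>
      e i b = Some c \<longleftrightarrow> f i c = Some b"
    and e_wt: "i \<in> {1..n-1} \<Longrightarrow> b \<in> B \<Longrightarrow> c \<in> B \<Longrightarrow> e i b = Some c \<Longrightarrow>
      string_length (e i) b = enat p \<Longrightarrow>
      vec_diff (wt c) (wt b) = (if even p then unit_vec i else - unit_vec (i+1))"

locale sqrt_q_crystal = sqrt_gl_crystal n B wt e f
  for n :: nat
    and B :: "'b set"
    and wt :: "'b \<Rightarrow> nat \<Rightarrow> nat"
    and e f :: "nat \<Rightarrow> 'b \<Rightarrow> 'b option" +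
  fixes ebar fbar :: "'b \<Rightarrow> 'b option"
  assumes ebar_closed: "b \<in> B \<Longrightarrow> ebar b = Some c \<Longrightarrow> c \<in> B"
    and fbar_closed: "b \<in> B \<Longrightarrow> fbar b = Some c \<Longrightarrow> c \<in> B"
    and bar_commute: "i \<in> {3..n-1} \<Longrightarrow> g \<in> {ebar, fbar} \<Longrightarrow> h \<in> {e i, f i} \<Longrightarrow>
      commute_on B g h"
    and bar_preserves: "i \<in> {3..n-1} \<Longrightarrow> g \<in> {ebar, fbar} \<Longrightarrow> b \<in> B \<Longrightarrow> g b = Some c \<Longrightarrow>
      string_length (e i) c = string_length (e i) b \<and>
      string_length (f i) c = string_length (f i) b"
    and bar_strings: "b \<in> B \<Longrightarrow>
      string_length ebar b + string_length fbar b = (if wt b 1 = 0 \<and> wt b 2 = 0 then 0 else 2)"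
    and ebar_fbar_inverse: "b \<in> B \<Longrightarrow> c \<in> B \<Longrightarrow> ebar b = Some c \<longleftrightarrow> fbar c = Some b"
    and ebar_wt_2: "b \<in> B \<Longrightarrow> c \<in> B \<Longrightarrow> ebar b = Some c \<Longrightarrow> string_length ebar b = 2 \<Longrightarrow>
      vec_diff (wt c) (wt b) = unit_vec 1"
    and ebar_wt_1: "b \<in> B \<Longrightarrow> c \<in> B \<Longrightarrow> ebar b = Some c \<Longrightarrow> string_length ebar b = 1 \<Longrightarrow>
      vec_diff (wt c) (wt b) = - unit_vec 2"


section \<open>Set-valued decomposition tableaux\<close>

type_synonym box = "nat \<times> nat"

definition strict_partition :: "nat list \<Rightarrow> bool" where
  "strict_partition la \<longleftrightarrow> sorted_wrt (>) la \<and> 0 \<notin> set la"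

text \<open>Parts are indexed from \<open>1\<close>, as are rows and columns.\<close>

definition part :: "nat list \<Rightarrow> nat \<Rightarrow> nat" where
  "part la r = la ! (r - 1)"

definition SD :: "nat list \<Rightarrow> box set" where
  "SD la = {(r, r + j - 1) | r j. r \<in> {1..length la} \<and> j \<in> {1..part la r}}"

definition hook_word :: "nat list \<Rightarrow> bool" where
  "hook_word w \<longleftrightarrow> (\<forall>x\<in>set w. 0 < x) \<and>
     (\<exists>m\<in>{1..length w}. sorted_wrt (\<ge>) (take m w) \<and> sorted_wrt (<) (drop (m - 1) w))"

definition maximal_hook_subword :: "nat list \<Rightarrow> nat list \<Rightarrow> bool" where
  "maximal_hook_subword u w \<longleftrightarrow> hook_word u \<and> subseq u w \<and>
     (\<forall>v. hook_word v \<and> subseq v w \<longrightarrow> length v \<le> length u)"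

definition row_word :: "nat list \<Rightarrow> (box \<Rightarrow> nat) \<Rightarrow> nat \<Rightarrow> nat list" where
  "row_word la T r = map (\<lambda>j. T (r, r + j - 1)) [1..<part la r + 1]"

text \<open>Only the values of the filling on \<open>SD la\<close> matter here.\<close>

definition decomposition_tableau :: "nat list \<Rightarrow> (box \<Rightarrow> nat) \<Rightarrow> bool" where
  "decomposition_tableau la T \<longleftrightarrow>
     (\<forall>b\<in>SD la. 0 < T b) \<and>
     (\<forall>r\<in>{1..length la}. hook_word (row_word la T r)) \<and>
     (\<forall>r\<in>{1..length la - 1}.
        maximal_hook_subword (row_word la T r) (row_word la T (r+1) @ row_word la T r))"

text \<open>
  A set-valued filling of \<open>SD la\<close> is extended by the empty set to all pairs of numbers, so that
  equality of functions is equality of fillings.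
\<close>

definition set_valued_decomposition_tableau :: "nat list \<Rightarrow> (box \<Rightarrow> nat set) \<Rightarrow> bool" where
  "set_valued_decomposition_tableau la T \<longleftrightarrow>
     (\<forall>b\<in>SD la. finite (T b) \<and> T b \<noteq> {} \<and> (\<forall>x\<in>T b. 0 < x)) \<and>
     (\<forall>b. b \<notin> SD la \<longrightarrow> T b = {}) \<and>
     (\<forall>D. (\<forall>b\<in>SD la. D b \<in> T b) \<longrightarrow> decomposition_tableau la D)"

definition SetDecTab :: "nat \<Rightarrow> nat list \<Rightarrow> (box \<Rightarrow> nat set) set" where
  "SetDecTab n la =
     {T. set_valued_decomposition_tableau la T \<and> (\<forall>b\<in>SD la. T b \<subseteq> {1..n})}"

definition tab_wt :: "nat list \<Rightarrow> (box \<Rightarrow> nat set) \<Rightarrow> nat \<Rightarrow> nat" where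
  "tab_wt la T k = card {b \<in> SD la. k \<in> T b}"

definition reverse_row_reading :: "nat list \<Rightarrow> box list" where
  "reverse_row_reading la =
     concat (map (\<lambda>r. map (\<lambda>j. (r, r + j - 1)) (rev [1..<part la r + 1])) [1..<length la + 1])"


section \<open>Linked words and their forms\<close>

text \<open>The characters "(", ")" and the link symbol.\<close>

datatype symb = Open | Close | Dash

text \<open>Every character is recorded together with the box it comes from.\<close>

definition box_symbs :: "nat \<Rightarrow> (box \<Rightarrow> nat set) \<Rightarrow> box \<Rightarrow> (symb \<times> box) list" where
  "box_symbs i T b =
     (if i \<in> T b \<and> i+1 \<in> T b then [(Close, b), (Dash, b), (Open, b)]
      else if i \<in> T b then [(Close, b)]
      else if i+1 \<in> T b then [(Open, b)]
      else [])"

definition linked_word :: "nat list \<Rightarrow> nat \<Rightarrow> (box \<Rightarrow> nat set) \<Rightarrow> (symb \<times> box) list" where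
  "linked_word la i T = concat (map (box_symbs i T) (reverse_row_reading la))"

text \<open>
  Positions of a word are counted from \<open>0\<close>. An opening and a later closing parenthesis are matched
  as soon as all parentheses strictly between them have been matched among themselves.
\<close>

inductive matched :: "symb list \<Rightarrow> nat \<Rightarrow> nat \<Rightarrow> bool" for w :: "symb list" where
  "p < q \<Longrightarrow> q < length w \<Longrightarrow> w ! p = Open \<Longrightarrow> w ! q = Close \<Longrightarrow>
   (\<And>k. p < k \<Longrightarrow> k < q \<Longrightarrow>
      w ! k = Dash \<or> (\<exists>l. p < l \<and> l < q \<and> (matched w k l \<or> matched w l k))) \<Longrightarrow>
   matched w p q"

definition unmatched :: "symb list \<Rightarrow> nat \<Rightarrow> bool" where
  "unmatched w p \<longleftrightarrow> p < length w \<and> w ! p \<noteq> Dash \<and> (\<forall>q. \<not> matched w p q \<and> \<not> matched w q p)"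

text \<open>
  The generating relation: two positions weakly between two matched parentheses, or two of the
  three positions of a link, the link symbol being the middle one.
\<close>

definition directly_linked :: "symb list \<Rightarrow> nat \<Rightarrow> nat \<Rightarrow> bool" where
  "directly_linked w a b \<longleftrightarrow>
     (\<exists>p q. matched w p q \<and> a \<in> {p..q} \<and> b \<in> {p..q}) \<or>
     (\<exists>k. k + 2 < length w \<and> w ! (k + 1) = Dash \<and> a \<in> {k..k + 2} \<and> b \<in> {k..k + 2})"

definition forms :: "symb list \<Rightarrow> nat set set" where
  "forms w = {..<length w} // {(a, b). equivclp (directly_linked w) a b}"

text \<open>
  Classes are contiguous, hence start at their minimal and end at their maximal position.
\<close>

definition left_form :: "symb list \<Rightarrow> nat set \<Rightarrow> bool" where
  "left_form w C \<longleftrightarrow> C \<in> forms w \<and>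
     \<not> (\<exists>p\<in>C. unmatched w p \<and> w ! p = Close) \<and>
     unmatched w (Max C) \<and> w ! Max C = Open"

definition right_form :: "symb list \<Rightarrow> nat set \<Rightarrow> bool" where
  "right_form w C \<longleftrightarrow> C \<in> forms w \<and>
     \<not> (\<exists>p\<in>C. unmatched w p \<and> w ! p = Open) \<and>
     unmatched w (Min C) \<and> w ! Min C = Close"

definition combined_form :: "symb list \<Rightarrow> nat set \<Rightarrow> bool" where
  "combined_form w C \<longleftrightarrow> C \<in> forms w \<and>
     unmatched w (Min C) \<and> w ! Min C = Close \<and>
     unmatched w (Max C) \<and> w ! Max C = Open"

definition first_left_start :: "symb list \<Rightarrow> nat" where
  "first_left_start w = Min (Min ` {C. left_form w C})"

definition last_right_end :: "symb list \<Rightarrow> nat" where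
  "last_right_end w = Max (Max ` {C. right_form w C})"

text \<open>
  The combined form is unique if it exists, its first three and its last three characters are each
  the link of a single box, every left form starts with "(" and every right form ends with ")":
  all the phrases used in defining the operators below have a referent.
\<close>

definition linked_word_unambiguous :: "(symb \<times> box) list \<Rightarrow> bool" where
  "linked_word_unambiguous W \<longleftrightarrow> (let w = map fst W in
     (\<forall>C C'. combined_form w C \<and> combined_form w C' \<longrightarrow> C = C') \<and>
     (\<forall>C. combined_form w C \<longrightarrow>
        (\<exists>b. take 3 (drop (Min C) W) = [(Close, b), (Dash, b), (Open, b)]) \<and>
        2 \<le> Max C \<and> (\<exists>b. take 3 (drop (Max C - 2) W) = [(Close, b), (Dash, b), (Open, b)])) \<and>
     (\<forall>C. left_form w C \<longrightarrow> w ! Min C = Open) \<and>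
     (\<forall>C. right_form w C \<longrightarrow> w ! Max C = Close))"


section \<open>The operators\<close>

definition tab_e :: "nat list \<Rightarrow> nat \<Rightarrow> (box \<Rightarrow> nat set) \<Rightarrow> (box \<Rightarrow> nat set) option" where
  "tab_e la i T =
     (let W = linked_word la i T; w = map fst W in
      if \<exists>C. combined_form w C then
        let b = snd (W ! Max (THE C. combined_form w C)) in Some (T(b := T b - {i+1}))
      else if \<not> (\<exists>C. left_form w C) then None
      else let b = snd (W ! first_left_start w) in Some (T(b := T b \<union> {i})))"

definition tab_f :: "nat list \<Rightarrow> nat \<Rightarrow> (box \<Rightarrow> nat set) \<Rightarrow> (box \<Rightarrow> nat set) option" where
  "tab_f la i T =
     (let W = linked_word la i T; w = map fst W in
      if \<exists>C. combined_form w C then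
        let b = snd (W ! Min (THE C. combined_form w C)) in Some (T(b := T b - {i}))
      else if \<not> (\<exists>C. right_form w C) then None
      else let b = snd (W ! last_right_end w) in Some (T(b := T b \<union> {i+1})))"

definition first_12_box :: "nat list \<Rightarrow> (box \<Rightarrow> nat set) \<Rightarrow> box option" where
  "first_12_box la T = find (\<lambda>b. 1 \<in> T b \<or> 2 \<in> T b) (reverse_row_reading la)"

definition tab_ebar :: "nat list \<Rightarrow> (box \<Rightarrow> nat set) \<Rightarrow> (box \<Rightarrow> nat set) option" where
  "tab_ebar la T = (case first_12_box la T of
      None \<Rightarrow> None
    | Some b \<Rightarrow>
        if 1 \<notin> T b \<and> 2 \<in> T b then Some (T(b := T b \<union> {1}))
        else if 1 \<in> T b \<and> 2 \<in> T b then Some (T(b := T b - {2}))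
        else None)"

definition tab_fbar :: "nat list \<Rightarrow> (box \<Rightarrow> nat set) \<Rightarrow> (box \<Rightarrow> nat set) option" where
  "tab_fbar la T = (case first_12_box la T of
      None \<Rightarrow> None
    | Some b \<Rightarrow>
        if 1 \<in> T b \<and> 2 \<notin> T b then Some (T(b := T b \<union> {2}))
        else if 1 \<in> T b \<and> 2 \<in> T b then Some (T(b := T b - {1}))
        else None)"

end

theory Submission
  imports Defs
begin

text \<open>
  A filling is a decomposition tableau iff no three boxes in a row or in two adjacent
  rows form one of four patterns, so that set-valued decomposition tableaux are described by
  conditions on triples of boxes. When an operator adds an entry, a new pattern contains another
  box with an entry \<open>i\<close> or \<open>i + 1\<close>; the matching of parentheses then supplies a further such box
  between the two in reading order, and with it an old pattern, except in a few configurations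
  where the entries \<open>i\<close> and \<open>i + 1\<close> in two rows have to be counted.

  For the crystal axioms, call a form of type \<open>(a, b)\<close> if it starts with an unmatched ")" iff \<open>a\<close>, and
  ends with an unmatched "(" iff \<open>b\<close>. A linked word is a sequence of forms in which no form with \<open>b\<close>
  precedes one with \<open>a\<close>: right forms, at most one combined form, left forms, with null forms
  anywhere. The operator \<open>e'\<close> turns the combined form into a right form, or else the first
  left form into a combined form, and \<open>f'\<close> undoes this.
\<close>

section \<open>Hook words and forbidden patterns\<close>

text \<open>Deleting an entry from a box that stays nonempty cannot create a pattern, so closure is
  at issue only where \<open>i\<close> joins \<open>i + 1\<close>, or \<open>i + 1\<close> joins
  \<open>i\<close>. There the old entry is a stand-in for the new one: exchanging them turns a new
  pattern into an old one unless a comparison in it is decided by an entry equal to \<open>i\<close>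
  or \<open>i + 1\<close>. Hence the closure proofs use the linked word only through two facts: a
  suitable letter occurs between two given boxes, and an inequality holds between the numbers of
  boxes with just one of the two letters. Forms are defined as classes of a generated equivalence,
  and matching as an inductive relation in which uniqueness of partners is not built in. So forms
  are constructed box by box, and the blocks of that construction are shown to be the classes. At
  the level of boxes each operator flips one flag of one form and moves no border between forms;
  inverses, string lengths and weights can then be read off one list. A left form admits two steps
  of \<open>e'\<close> and a combined form one, hence the parity in the weight axiom.\<close>

definition rises_once :: "nat list \<Rightarrow> bool" where
  "rises_once w \<longleftrightarrow>
     (\<forall>p q s. p < q \<longrightarrow> q < s \<longrightarrow> s < length w \<longrightarrow> w ! p < w ! q \<longrightarrow> w ! q < w ! s)"

lemma rises_onceD:
  "rises_once w \<Longrightarrow> p < q \<Longrightarrow> q < s \<Longrightarrow> s < length w \<Longrightarrow> w ! p < w ! q \<Longrightarrow> w ! q < w ! s"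
  by (auto simp: rises_once_def)

text \<open>For the converse, cut at the first ascent \<open>q\<close>: up to \<open>q\<close> the
  word descends weakly, and every later letter exceeds \<open>w ! q\<close>, so
  \<open>rises_once\<close> with \<open>w ! q\<close> as its first letter makes the tail strictly
  increasing.\<close>

lemma hook_word_iff:
  "hook_word w \<longleftrightarrow> w \<noteq> [] \<and> (\<forall>x\<in>set w. 0 < x) \<and> rises_once w"
proof (intro iffI conjI)
  assume "hook_word w"
  then obtain m where m: "m \<in> {1..length w}" "sorted_wrt (\<ge>) (take m w)"
      "sorted_wrt (<) (drop (m - 1) w)" and pos: "\<forall>x\<in>set w. 0 < x"
    by (auto simp: hook_word_def)
  show "w \<noteq> []" "\<forall>x\<in>set w. 0 < x" using m pos by auto
  show "rises_once w" unfolding rises_once_def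
  proof (intro allI impI)
    fix p q s assume a: "p < q" "q < s" "s < length w" "w ! p < w ! q"
    have "\<not> q < m"
    proof
      assume "q < m"
      then have "w ! q \<le> w ! p"
        using m(1) m(2)[unfolded sorted_wrt_iff_nth_less, rule_format, of p q] a by simp
      then show False using a by simp
    qed
    then show "w ! q < w ! s"
      using m(1) m(3)[unfolded sorted_wrt_iff_nth_less, rule_format, of "q - (m - 1)" "s - (m - 1)"] a
      by simp
  qed
next
  assume *: "w \<noteq> [] \<and> (\<forall>x\<in>set w. 0 < x) \<and> rises_once w"
  show "hook_word w"
  proof (cases "\<exists>q. Suc q < length w \<and> w ! q < w ! Suc q")
    case False
    then have "sorted_wrt (\<ge>) w"
      by (subst sorted_wrt_iff_nth_Suc_transp) (auto simp: transp_def not_less, meson not_le)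
    moreover have "sorted_wrt (<) (drop (length w - 1) w)"
      by (auto simp: sorted_wrt_iff_nth_less)
    ultimately show ?thesis using * unfolding hook_word_def
      by (intro conjI bexI[of _ "length w"]) (auto simp: Suc_le_eq)
  next
    case True
    define q where "q = (LEAST q. Suc q < length w \<and> w ! q < w ! Suc q)"
    have q: "Suc q < length w" "w ! q < w ! Suc q"
      using LeastI_ex[OF True] by (auto simp: q_def)
    have least: "w ! Suc k \<le> w ! k" if "k < q" for k
      using not_less_Least[of k "\<lambda>q. Suc q < length w \<and> w ! q < w ! Suc q"] that q
      by (auto simp: q_def not_less)
    have "sorted_wrt (\<ge>) (take (Suc q) w)"
      using least by (subst sorted_wrt_iff_nth_Suc_transp) (auto simp: transp_def)
    moreover have "sorted_wrt (<) (drop q w)"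
      unfolding sorted_wrt_iff_nth_less
    proof (intro allI impI)
      fix i j assume ij: "i < j" "j < length (drop q w)"
      have low: "w ! q < w ! (q + l)" if "0 < l" "q + l < length w" for l
      proof (cases "l = 1")
        case False
        with that have "w ! Suc q < w ! (q + l)"
          using rises_onceD[of w q "Suc q" "q + l"] * q by auto
        with q show ?thesis by simp
      qed (use q in simp)
      show "drop q w ! i < drop q w ! j"
      proof (cases "i = 0")
        case True
        then show ?thesis using low[of j] ij by simp
      next
        case False
        then show ?thesis
          using low[of i] ij rises_onceD[of w q "q + i" "q + j"] * by simp
      qed
    qed
    ultimately show ?thesis using * q unfolding hook_word_def
      by (intro conjI bexI[of _ "Suc q"]) (auto simp: Suc_le_eq)
  qed
qed

section \<open>Subwords as strictly increasing lists of positions\<close>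

lemma nths_eq_map: "nths w N = map ((!) w) (filter (\<lambda>i. i \<in> N) [0..<length w])"
  by (induction w rule: rev_induct) (auto simp: nths_append nth_append intro!: map_cong filter_cong)

lemma subseq_iff_indices:
  "subseq v w \<longleftrightarrow> (\<exists>js. sorted_wrt (<) js \<and> set js \<subseteq> {..<length w} \<and> v = map ((!) w) js)"
proof
  assume "subseq v w"
  then obtain N where "v = nths w N" by (auto simp: subseq_conv_nths)
  then show "\<exists>js. sorted_wrt (<) js \<and> set js \<subseteq> {..<length w} \<and> v = map ((!) w) js"
    by (intro exI[of _ "filter (\<lambda>i. i \<in> N) [0..<length w]"])
      (auto simp: nths_eq_map sorted_wrt_filter strict_sorted_iff)
next
  assume "\<exists>js. sorted_wrt (<) js \<and> set js \<subseteq> {..<length w} \<and> v = map ((!) w) js"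
  then obtain js where js: "sorted_wrt (<) js" "set js \<subseteq> {..<length w}" "v = map ((!) w) js"
    by blast
  have "filter (\<lambda>i. i \<in> set js) [0..<length w] = js"
    by (rule sorted_distinct_set_unique) (use js in \<open>auto simp: strict_sorted_iff sorted_wrt_filter\<close>)
  then have "v = nths w (set js)" by (simp add: nths_eq_map js(3))
  then show "subseq v w" by (auto simp: subseq_conv_nths)
qed

text \<open>Positions in the ambient word replace positions in the subword, so that indices in
  \<open>v @ u\<close> can be compared directly.\<close>

lemma rises_once_map_nth_iff:
  assumes "sorted_wrt (<) js"
  shows "rises_once (map ((!) w) js) \<longleftrightarrow>
    (\<forall>p\<in>set js. \<forall>q\<in>set js. \<forall>s\<in>set js. p < q \<longrightarrow> q < s \<longrightarrow> w ! p < w ! q \<longrightarrow> w ! q < w ! s)"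
    (is "?L = ?R")
proof
  have less: "a < b \<longleftrightarrow> js ! a < js ! b" if "a < length js" "b < length js" for a b
    using assms that unfolding sorted_wrt_iff_nth_less
    by (metis linorder_neqE_nat order_less_asym)
  {
    assume ?L
    show ?R
    proof (intro ballI impI)
      fix p q s assume "p \<in> set js" "q \<in> set js" "s \<in> set js" and a: "p < q" "q < s" "w ! p < w ! q"
      then obtain p' q' s' where "p = js ! p'" "q = js ! q'" "s = js ! s'"
        "p' < length js" "q' < length js" "s' < length js"
        by (metis in_set_conv_nth)
      then show "w ! q < w ! s"
        using rises_onceD[OF \<open>?L\<close>, of p' q' s'] a by (simp add: less)
    qed
  }
  {
    assume ?R
    have "w ! (js ! q) < w ! (js ! s)"
      if "p < q" "q < s" "s < length js" "w ! (js ! p) < w ! (js ! q)" for p q s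
      using \<open>?R\<close>[rule_format, of "js ! p" "js ! q" "js ! s"] that less[of p q] less[of q s] by simp
    then show ?L unfolding rises_once_def by simp
  }
qed

text \<open>Indices count from \<open>0\<close>, so \<open>v ! c\<close> stands in a box just below \<open>u ! (c + 1)\<close>.\<close>

definition compatible_rows :: "nat list \<Rightarrow> nat list \<Rightarrow> bool" where
  "compatible_rows u v \<longleftrightarrow>
     (\<forall>c<length v. v ! c < u ! 0) \<and>
     (\<forall>a c. a < c \<longrightarrow> c < length v \<longrightarrow> u ! Suc a \<le> v ! c \<longrightarrow> v ! a < v ! c) \<and>
     (\<forall>a c. a \<le> c \<longrightarrow> c < length v \<longrightarrow> v ! c < u ! a \<longrightarrow> u ! Suc c \<le> u ! a)"

text \<open>Let \<open>c\<close> be the last position used in \<open>v\<close> and \<open>a\<close>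
  the first used in \<open>u\<close>. If \<open>c < a\<close>, there is room for at most
  \<open>length u\<close> positions. Otherwise the hook shape of the subword and compatibility
  exclude a whole interval: positions \<open>a - 1\<close> to \<open>c - 1\<close> of
  \<open>v\<close> when \<open>u ! a \<le> v ! c\<close>, positions \<open>a + 1\<close> to
  \<open>c + 1\<close> of \<open>u\<close> when \<open>v ! c < u ! a\<close>. Either gap pays for
  the overlap.\<close>

lemma hook_subword_length_le:
  assumes u: "rises_once u" and v: "rises_once v" and len: "length v < length u"
    and comp: "compatible_rows u v" and w: "rises_once w" "subseq w (v @ u)"
  shows "length w \<le> length u"
proof -
  obtain js where js: "sorted_wrt (<) js" "set js \<subseteq> {..<length (v @ u)}" "w = map ((!) (v @ u)) js"
    using w(2) unfolding subseq_iff_indices by blast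
  have tri: "(v @ u) ! q < (v @ u) ! s"
    if "p \<in> set js" "q \<in> set js" "s \<in> set js" "p < q" "q < s" "(v @ u) ! p < (v @ u) ! q" for p q s
    using w(1) that unfolding js(3) rises_once_map_nth_iff[OF js(1)] by blast
  define J where "J = {j \<in> set js. j < length v}"
  define I where "I = {a. length v + a \<in> set js}"
  have J: "J \<subseteq> {..<length v}" by (auto simp: J_def)
  have I: "I \<subseteq> {..<length u}" using js(2) by (auto simp: I_def)
  have finJ: "finite J" and finI: "finite I"
    using J I by (auto intro: finite_subset)
  have split: "set js = J \<union> (+) (length v) ` I"
    by (auto simp: J_def I_def image_iff) (metis le_add_diff_inverse not_less)
  have "length w = card (set js)"
    using js by (simp add: strict_sorted_iff distinct_card)
  also have "\<dots> = card J + card I"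
    unfolding split by (subst card_Un_disjoint) (auto simp: finJ finI card_image J_def)
  finally have lw: "length w = card J + card I" .
  show ?thesis
  proof (cases "J = {} \<or> I = {}")
    case True
    then show ?thesis
    proof
      assume "J = {}"
      then show ?thesis using lw card_mono[OF _ I] by simp
    next
      assume "I = {}"
      then show ?thesis using lw card_mono[OF _ J] len by simp
    qed
  next
    case False
    define c where "c = Max J"
    define a where "a = Min I"
    have c: "c \<in> J" "\<And>j. j \<in> J \<Longrightarrow> j \<le> c" and a: "a \<in> I" "\<And>j. j \<in> I \<Longrightarrow> a \<le> j"
      using False finJ finI by (auto simp: c_def a_def)
    have ca: "c < length v" "a < length u" "c \<in> set js" "length v + a \<in> set js"
      using c(1) a(1) J I by (auto simp: J_def I_def)
    have cJ: "card J \<le> Suc c"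
      using card_mono[of "{..c}" J] c(2) by auto
    have cI: "card I \<le> length u - a"
      using card_mono[of "{a..<length u}" I] a(2) I by (simp add: subset_iff)
    show ?thesis
    proof (cases "u ! a \<le> v ! c")
      case True
      show ?thesis
      proof (cases "a \<le> c")
        case False
        then show ?thesis using cJ cI lw ca(2) by simp
      next
        case ac: True
        have "a \<noteq> 0"
        proof
          assume "a = 0"
          then show False using comp True ca(1) unfolding compatible_rows_def by force
        qed
        then obtain a' where a': "a = Suc a'" using not0_implies_Suc by blast
        have lt: "v ! a' < v ! c"
          using comp True ca(1) ac a' unfolding compatible_rows_def by simp
        have "J \<subseteq> insert c {..<a'}"
        proof
          fix p assume p: "p \<in> J"
          show "p \<in> insert c {..<a'}"
          proof (rule ccontr)
            assume "\<not> ?thesis"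
            then have pc: "p < c" "a' \<le> p" using c(2)[OF p] by auto
            have "\<not> v ! p < v ! c"
              using tri[of p c "length v + a"] p ca pc True by (auto simp: J_def nth_append)
            moreover have "a' \<noteq> p" using calculation lt by auto
            moreover have "v ! a' < v ! p" using calculation(1) lt by simp
            ultimately show False
              using rises_onceD[OF v, of a' p c] pc ca by simp
          qed
        qed
        then have "card J \<le> card (insert c {..<a'})" by (rule card_mono[rotated]) simp
        also have "\<dots> \<le> Suc a'" by (metis card_insert_le_m1 card_lessThan diff_Suc_1 le_refl zero_less_Suc)
        finally show ?thesis using cI lw ca a' by simp
      qed
    next
      case False
      show ?thesis
      proof (cases "a \<le> c")
        case ac: False
        then show ?thesis using cJ cI lw ca by simp
      next
        case True
        have le: "u ! Suc c \<le> u ! a"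
          using comp False True ca(1) unfolding compatible_rows_def by simp
        have "I \<subseteq> insert a {Suc (Suc c)..<length u}"
        proof
          fix b assume b: "b \<in> I"
          show "b \<in> insert a {Suc (Suc c)..<length u}"
          proof (rule ccontr)
            assume "\<not> ?thesis"
            then have ab: "a < b" "b \<le> Suc c" using a(2)[OF b] b I by auto
            have "u ! a < u ! b"
              using tri[of c "length v + a" "length v + b"] b ca ab False
              by (auto simp: I_def nth_append)
            then show False
              using rises_onceD[OF u, of a b "Suc c"] ab ca le len
              by (cases "b = Suc c") auto
          qed
        qed
        then have "card I \<le> card (insert a {Suc (Suc c)..<length u})"
          by (rule card_mono[rotated]) simp
        also have "\<dots> \<le> Suc (length u - Suc (Suc c))"
          by (metis card_atLeastLessThan card_insert_le_m1 diff_Suc_1 le_refl zero_less_Suc)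
        finally show ?thesis using cJ lw ca len by simp
      qed
    qed
  qed
qed

text \<open>Each violated condition yields a hook subword with \<open>length u + 1\<close> letters:
  \<open>v ! c\<close> followed by all of \<open>u\<close>; or \<open>v\<close> up to
  \<open>a\<close>, then \<open>v ! c\<close>, then \<open>u\<close> from \<open>a + 1\<close> on;
  or \<open>v\<close> up to \<open>c\<close>, then \<open>u ! a\<close>, then \<open>u\<close> from
  \<open>c + 1\<close> on.\<close>

lemma compatible_rowsI:
  assumes u: "rises_once u" and v: "rises_once v" and len: "length v < length u"
    and max: "\<And>w. rises_once w \<Longrightarrow> subseq w (v @ u) \<Longrightarrow> length w \<le> length u"
  shows "compatible_rows u v"
proof -
  let ?k = "length v" and ?m = "length u"
  have short: "length js \<le> ?m"
    if "sorted_wrt (<) js" "set js \<subseteq> {..<?k + ?m}"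
      "\<And>p q s. p \<in> set js \<Longrightarrow> q \<in> set js \<Longrightarrow> s \<in> set js \<Longrightarrow> p < q \<Longrightarrow> q < s \<Longrightarrow>
         (v @ u) ! p < (v @ u) ! q \<Longrightarrow> (v @ u) ! q < (v @ u) ! s" for js
  proof -
    have "rises_once (map ((!) (v @ u)) js)"
      unfolding rises_once_map_nth_iff[OF that(1)] using that(3) by blast
    moreover have "subseq (map ((!) (v @ u)) js) (v @ u)"
      unfolding subseq_iff_indices using that(1,2) by auto
    ultimately show ?thesis using max by fastforce
  qed
  have "v ! c < u ! 0" if c: "c < ?k" for c
  proof (rule ccontr)
    assume ge: "\<not> ?thesis"
    have "length (c # [?k..<?k + ?m]) \<le> ?m"
    proof (rule short)
      fix p q s assume a: "p \<in> set (c # [?k..<?k + ?m])" "q \<in> set (c # [?k..<?k + ?m])"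
        "s \<in> set (c # [?k..<?k + ?m])" "p < q" "q < s" "(v @ u) ! p < (v @ u) ! q"
      then obtain b b' where b: "q = ?k + b" "s = ?k + b'" "b < b'" "b' < ?m"
        using c by (auto simp: le_iff_add)
      \<comment> \<open>If the smaller letter of the ascent is \<open>v ! c\<close>, it can be
        replaced by \<open>u ! 0\<close>, which is at most \<open>v ! c\<close>.\<close>
      have "0 < b \<and> u ! 0 < u ! b \<or> (\<exists>d<b. u ! d < u ! b)"
      proof (cases "p < ?k")
        case True
        then have "v ! c < u ! b" using a b c by (auto simp: nth_append)
        then show ?thesis using ge by (cases "b = 0") auto
      next
        case False
        then have "p - ?k < b" "u ! (p - ?k) < u ! b" using a b by (auto simp: nth_append)
        then show ?thesis by blast
      qed
      then show "(v @ u) ! q < (v @ u) ! s"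
        using rises_onceD[OF u] b by (auto simp: nth_append)
    qed (use c in auto)
    then show False by simp
  qed
  moreover have "v ! a < v ! c" if ac: "a < c" and c: "c < ?k" and le: "u ! Suc a \<le> v ! c" for a c
  proof (rule ccontr)
    assume ge: "\<not> ?thesis"
    let ?js = "[0..<Suc a] @ [c] @ [?k + Suc a..<?k + ?m]"
    have mem: "j \<in> set ?js \<longleftrightarrow> j \<le> a \<or> j = c \<or> ?k + Suc a \<le> j \<and> j < ?k + ?m" for j
      by auto
    \<comment> \<open>The part taken from \<open>v\<close> descends weakly, so every ascent of the
      chosen subword ends in \<open>u\<close>.\<close>
    have desc: "v ! q \<le> v ! p" if "p \<le> a" "q \<le> a \<or> q = c" "p < q" for p q
    proof (rule ccontr)
      assume lt: "\<not> ?thesis"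
      then have "v ! p < v ! q" by simp
      then have "v ! p < v ! a"
      proof (cases "q \<le> a")
        case True
        with \<open>v ! p < v ! q\<close> \<open>p < q\<close> show ?thesis
          using rises_onceD[OF v, of p q a] ac c by (cases "q = a") auto
      next
        case False
        with \<open>v ! p < v ! q\<close> that ge show ?thesis by auto
      qed
      moreover from this have "p < a" using that by (cases "p = a") auto
      ultimately show False using rises_onceD[OF v, of p a c] ac c ge by simp
    qed
    have "length ?js \<le> ?m"
    proof (rule short)
      fix p q s assume "p \<in> set ?js" "q \<in> set ?js" "s \<in> set ?js"
        and a: "p < q" "q < s" "(v @ u) ! p < (v @ u) ! q"
      then have p: "p \<le> a \<or> p = c \<or> ?k + Suc a \<le> p" and q: "q \<le> a \<or> q = c \<or> ?k + Suc a \<le> q"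
        and s: "s < ?k + ?m"
        using ac c len unfolding mem by auto
      have "\<not> q < ?k"
      proof
        assume "q < ?k"
        then have "q \<le> a \<or> q = c" "p \<le> a" using p q a ac by auto
        then show False using desc[of p q] a ac c by (auto simp: nth_append)
      qed
      then obtain b where b: "q = ?k + b" "Suc a \<le> b" using q ac c by (auto simp: le_iff_add)
      have "s = ?k + (s - ?k)" "b < s - ?k" "s - ?k < ?m" using s a b by auto
      then obtain b' where b': "s = ?k + b'" "b < b'" "b' < ?m" by blast
      have "\<exists>d<b. u ! d < u ! b"
      proof (cases "p < ?k")
        case True
        have "v ! c \<le> v ! p"
          using p True desc[of p c] ac by (cases "p = c") auto
        then have "u ! Suc a < u ! b" using True a b le by (auto simp: nth_append)
        then show ?thesis using b(2) by (intro exI[of _ "Suc a"]) (auto simp: le_less)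
      next
        case False
        then show ?thesis using a b by (intro exI[of _ "p - ?k"]) (auto simp: nth_append)
      qed
      then show "(v @ u) ! q < (v @ u) ! s"
        using rises_onceD[OF u] b b' by (auto simp: nth_append)
    qed (use ac c len in \<open>auto simp: sorted_wrt_append\<close>)
    then show False using ac c len by simp
  qed
  moreover have "u ! Suc c \<le> u ! a" if ac: "a \<le> c" and c: "c < ?k" and lt: "v ! c < u ! a" for a c
  proof (rule ccontr)
    assume gt: "\<not> ?thesis"
    let ?js = "[0..<Suc c] @ [?k + a] @ [?k + Suc c..<?k + ?m]"
    \<comment> \<open>Here the part taken from \<open>u\<close> is strictly increasing from its
      first letter \<open>u ! a\<close> on.\<close>
    have inc: "u ! b < u ! b'"
      if "b = a \<or> Suc c \<le> b" "b < b'" "b' = a \<or> Suc c \<le> b'" "b' < ?m" for b b'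
    proof -
      have hi: "u ! a < u ! d" if "Suc c \<le> d" "d < ?m" for d
        using that gt rises_onceD[OF u, of a "Suc c" d] ac by (cases "d = Suc c") auto
      show ?thesis
        using that hi[of b'] hi[of b] rises_onceD[OF u, of a b b'] ac by (cases "b = a") auto
    qed
    have "length ?js \<le> ?m"
    proof (rule short)
      fix p q s assume "p \<in> set ?js" "q \<in> set ?js" "s \<in> set ?js"
        and a: "p < q" "q < s" "(v @ u) ! p < (v @ u) ! q"
      then have p: "p \<le> c \<or> p = ?k + a \<or> ?k + Suc c \<le> p" and q: "q \<le> c \<or> q = ?k + a \<or> ?k + Suc c \<le> q"
        and s: "s \<le> c \<or> s = ?k + a \<or> ?k + Suc c \<le> s" "s < ?k + ?m"
        using c ac len by auto
      show "(v @ u) ! q < (v @ u) ! s"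
      proof (cases "s < ?k")
        case True
        then show ?thesis using a rises_onceD[OF v, of p q s] by (auto simp: nth_append)
      next
        case False
        then obtain b' where b': "s = ?k + b'" by (metis le_add_diff_inverse not_less)
        show ?thesis
        proof (cases "q < ?k")
          case True
          then have qc: "q \<le> c" using q c by auto
          then have "v ! q \<le> v ! c"
            using a True c rises_onceD[OF v, of p q c] by (cases "q = c") (auto simp: nth_append)
          moreover have "u ! a \<le> u ! b'"
            using inc[of a b'] s b' c ac by (cases "b' = a") auto
          ultimately show ?thesis using lt True b' by (simp add: nth_append)
        next
          case False
          then obtain b where "q = ?k + b" by (metis le_add_diff_inverse not_less)
          then show ?thesis using inc[of b b'] q s b' c a by (auto simp: nth_append)
        qed
      qed
    qed (use ac c len in \<open>auto simp: sorted_wrt_append\<close>)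
    then show False using ac c len by simp
  qed
  ultimately show ?thesis unfolding compatible_rows_def by blast
qed

text \<open>Maximality among hook words and among words with \<open>rises_once\<close> differ only
  by the empty word, since the letters of a subword stay positive.\<close>

lemma maximal_hook_subword_iff:
  assumes u: "hook_word u" and v: "hook_word v" and len: "length v < length u"
  shows "maximal_hook_subword u (v @ u) \<longleftrightarrow> compatible_rows u v"
proof
  assume m: "maximal_hook_subword u (v @ u)"
  have "length w \<le> length u" if "rises_once w" "subseq w (v @ u)" for w
  proof (cases "w = []")
    case False
    have "set w \<subseteq> set (v @ u)"
      using that(2) by (metis set_nths_subset subseq_conv_nths)
    then have "hook_word w" using False that u v unfolding hook_word_iff by auto
    then show ?thesis using m that(2) unfolding maximal_hook_subword_def by blast
  qed simp
  then show "compatible_rows u v"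
    using assms by (intro compatible_rowsI) (auto simp: hook_word_iff)
next
  assume "compatible_rows u v"
  then show "maximal_hook_subword u (v @ u)"
    using assms hook_subword_length_le unfolding maximal_hook_subword_def hook_word_iff
    by (auto intro: list_emb_append2)
qed

text \<open>The conditions of \<open>rises_once\<close> and \<open>compatible_rows\<close> in box
  coordinates, for all choices of entries at once. Boxes outside the shape will be empty, so no
  condition has to mention the shape.\<close>

definition no_pattern :: "(box \<Rightarrow> nat set) \<Rightarrow> bool" where
  "no_pattern T \<longleftrightarrow>
     (\<forall>r p q s x y z. p < q \<longrightarrow> q < s \<longrightarrow> x \<in> T (r, p) \<longrightarrow> y \<in> T (r, q) \<longrightarrow> z \<in> T (r, s) \<longrightarrow>
        x < y \<longrightarrow> y < z) \<and>
     (\<forall>r k x z. x \<in> T (r, r) \<longrightarrow> z \<in> T (Suc r, k) \<longrightarrow> z < x) \<and>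
     (\<forall>r j k x y z. j < k \<longrightarrow> x \<in> T (r, j) \<longrightarrow> y \<in> T (Suc r, j) \<longrightarrow> z \<in> T (Suc r, k) \<longrightarrow>
        x \<le> z \<longrightarrow> y < z) \<and>
     (\<forall>r j k x y z. j < k \<longrightarrow> x \<in> T (r, j) \<longrightarrow> y \<in> T (r, k) \<longrightarrow> z \<in> T (Suc r, k) \<longrightarrow>
        z < x \<longrightarrow> y \<le> x)"

lemma no_patternI:
  assumes "\<And>r p q s x y z. p < q \<Longrightarrow> q < s \<Longrightarrow> x \<in> T (r, p) \<Longrightarrow> y \<in> T (r, q) \<Longrightarrow>
      z \<in> T (r, s) \<Longrightarrow> x < y \<Longrightarrow> z \<le> y \<Longrightarrow> False"
    and "\<And>r k x z. x \<in> T (r, r) \<Longrightarrow> z \<in> T (Suc r, k) \<Longrightarrow> x \<le> z \<Longrightarrow> False"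
    and "\<And>r j k x y z. j < k \<Longrightarrow> x \<in> T (r, j) \<Longrightarrow> y \<in> T (Suc r, j) \<Longrightarrow>
      z \<in> T (Suc r, k) \<Longrightarrow> x \<le> z \<Longrightarrow> z \<le> y \<Longrightarrow> False"
    and "\<And>r j k x y z. j < k \<Longrightarrow> x \<in> T (r, j) \<Longrightarrow> y \<in> T (r, k) \<Longrightarrow>
      z \<in> T (Suc r, k) \<Longrightarrow> z < x \<Longrightarrow> x < y \<Longrightarrow> False"
  shows "no_pattern T"
  unfolding no_pattern_def
  by (intro conjI allI impI; rule ccontr; unfold not_less not_le; rule assms; assumption)

lemma no_patternD:
  assumes "no_pattern T"
  shows no_pattern_row: "p < q \<Longrightarrow> q < s \<Longrightarrow> x \<in> T (r, p) \<Longrightarrow> y \<in> T (r, q) \<Longrightarrow>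
      z \<in> T (r, s) \<Longrightarrow> x < y \<Longrightarrow> y < z"
    and no_pattern_diagonal: "x \<in> T (r, r) \<Longrightarrow> z \<in> T (Suc r, k) \<Longrightarrow> z < x"
    and no_pattern_left: "j < k \<Longrightarrow> x \<in> T (r, j) \<Longrightarrow> y \<in> T (Suc r, j) \<Longrightarrow>
      z \<in> T (Suc r, k) \<Longrightarrow> x \<le> z \<Longrightarrow> y < z"
    and no_pattern_right: "j < k \<Longrightarrow> x \<in> T (r, j) \<Longrightarrow> y \<in> T (r, k) \<Longrightarrow>
      z \<in> T (Suc r, k) \<Longrightarrow> z < x \<Longrightarrow> y \<le> x"
proof -
  note * = assms[unfolded no_pattern_def]
  show "p < q \<Longrightarrow> q < s \<Longrightarrow> x \<in> T (r, p) \<Longrightarrow> y \<in> T (r, q) \<Longrightarrow> z \<in> T (r, s) \<Longrightarrow>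
      x < y \<Longrightarrow> y < z"
    by (rule *[THEN conjunct1, rule_format])
  show "x \<in> T (r, r) \<Longrightarrow> z \<in> T (Suc r, k) \<Longrightarrow> z < x"
    by (rule *[THEN conjunct2, THEN conjunct1, rule_format])
  show "j < k \<Longrightarrow> x \<in> T (r, j) \<Longrightarrow> y \<in> T (Suc r, j) \<Longrightarrow> z \<in> T (Suc r, k) \<Longrightarrow> x \<le> z \<Longrightarrow> y < z"
    by (rule *[THEN conjunct2, THEN conjunct2, THEN conjunct1, rule_format])
  show "j < k \<Longrightarrow> x \<in> T (r, j) \<Longrightarrow> y \<in> T (r, k) \<Longrightarrow> z \<in> T (Suc r, k) \<Longrightarrow> z < x \<Longrightarrow> y \<le> x"
    by (rule *[THEN conjunct2, THEN conjunct2, THEN conjunct2, rule_format])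
qed

text \<open>All conditions are universal in the entries. This settles every operator that deletes an
  entry.\<close>

lemma no_pattern_mono:
  assumes T: "no_pattern T" and "\<And>b. T' b \<subseteq> T b"
  shows "no_pattern T'"
proof -
  have sub: "x \<in> T' b \<Longrightarrow> x \<in> T b" for x b using assms(2) by blast
  show ?thesis
    by (rule no_patternI)
      (use no_pattern_row[OF T, OF _ _ sub sub sub] no_pattern_diagonal[OF T, OF sub sub]
        no_pattern_left[OF T, OF _ sub sub sub] no_pattern_right[OF T, OF _ sub sub sub]
       in \<open>meson leD\<close>)+
qed

section \<open>The shifted diagram, and tableaux as fillings without patterns\<close>

lemma SD_iff:
  "(r, c) \<in> SD la \<longleftrightarrow> 1 \<le> r \<and> r \<le> length la \<and> r \<le> c \<and> c < r + part la r"
proof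
  assume "1 \<le> r \<and> r \<le> length la \<and> r \<le> c \<and> c < r + part la r"
  then have "(r, c) = (r, r + (Suc c - r) - 1)" "r \<in> {1..length la}" "Suc c - r \<in> {1..part la r}"
    by auto
  then show "(r, c) \<in> SD la" unfolding SD_def by blast
qed (auto simp: SD_def)

lemma part_pos:
  assumes "strict_partition la" "1 \<le> r" "r \<le> length la"
  shows "0 < part la r"
proof -
  have "part la r \<in> set la" unfolding part_def using assms by (intro nth_mem) auto
  then show ?thesis using assms(1) by (metis strict_partition_def gr0I)
qed

lemma part_Suc_less:
  assumes "strict_partition la" "1 \<le> r" "Suc r \<le> length la"
  shows "part la (Suc r) < part la r"
  using assms
  by (auto simp: strict_partition_def part_def sorted_wrt_iff_nth_less)

lemma SD_left:
  "(r, c) \<in> SD la \<Longrightarrow> r \<le> c' \<Longrightarrow> c' \<le> c \<Longrightarrow> (r, c') \<in> SD la"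
  by (auto simp: SD_iff)

text \<open>Row \<open>Suc r\<close> is indented by one and at least one box shorter, so it ends no
  later than row \<open>r\<close>.\<close>

lemma SD_up:
  assumes "strict_partition la" "(Suc r, c) \<in> SD la" "1 \<le> r"
  shows "(r, c) \<in> SD la"
  using assms part_Suc_less[of la r] by (auto simp: SD_iff)

lemma SD_col_ge: "(r, c) \<in> SD la \<Longrightarrow> 1 \<le> r \<and> r \<le> c"
  by (auto simp: SD_iff)

lemma finite_SD: "finite (SD la)"
proof -
  have "SD la = (\<Union>r\<in>{1..length la}. (\<lambda>j. (r, r + j - 1)) ` {1..part la r})"
    unfolding SD_def by auto
  then show ?thesis by simp
qed

lemma length_row_word: "length (row_word la D r) = part la r"
  by (simp add: row_word_def)

lemma row_word_nth: "c < part la r \<Longrightarrow> row_word la D r ! c = D (r, r + c)"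
  by (simp add: row_word_def del: upt_Suc)

lemma rises_once_row_word:
  assumes "1 \<le> r" "r \<le> length la"
  shows "rises_once (row_word la D r) \<longleftrightarrow>
    (\<forall>p q s. p < q \<longrightarrow> q < s \<longrightarrow> (r, p) \<in> SD la \<longrightarrow> (r, q) \<in> SD la \<longrightarrow> (r, s) \<in> SD la \<longrightarrow>
       D (r, p) < D (r, q) \<longrightarrow> D (r, q) < D (r, s))" (is "?L \<longleftrightarrow> ?R")
proof
  assume L: ?L
  show ?R
  proof (intro allI impI)
    fix p q s
    assume a: "p < q" "q < s" "(r, p) \<in> SD la" "(r, q) \<in> SD la" "(r, s) \<in> SD la" "D (r, p) < D (r, q)"
    then show "D (r, q) < D (r, s)"
      using rises_onceD[OF L, of "p - r" "q - r" "s - r"]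
      by (auto simp: SD_iff length_row_word row_word_nth)
  qed
next
  assume R: ?R
  show ?L unfolding rises_once_def
  proof (intro allI impI)
    fix p q s
    assume a: "p < q" "q < s" "s < length (row_word la D r)"
      "row_word la D r ! p < row_word la D r ! q"
    then show "row_word la D r ! q < row_word la D r ! s"
      using R[rule_format, of "r + p" "r + q" "r + s"] assms
      by (auto simp: SD_iff length_row_word row_word_nth)
  qed
qed

text \<open>Because of the indentation of the lower row, \<open>a \<le> c\<close> for list positions
  becomes \<open>j < k\<close> for columns.\<close>

lemma compatible_row_words:
  assumes la: "strict_partition la" and r: "1 \<le> r" "Suc r \<le> length la"
  shows "compatible_rows (row_word la D r) (row_word la D (Suc r)) \<longleftrightarrow>
    (\<forall>k. (Suc r, k) \<in> SD la \<longrightarrow> D (Suc r, k) < D (r, r)) \<and>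
    (\<forall>j k. j < k \<longrightarrow> (Suc r, j) \<in> SD la \<longrightarrow> (Suc r, k) \<in> SD la \<longrightarrow>
       D (r, j) \<le> D (Suc r, k) \<longrightarrow> D (Suc r, j) < D (Suc r, k)) \<and>
    (\<forall>j k. j < k \<longrightarrow> (r, j) \<in> SD la \<longrightarrow> (Suc r, k) \<in> SD la \<longrightarrow>
       D (Suc r, k) < D (r, j) \<longrightarrow> D (r, k) \<le> D (r, j))"
proof -
  let ?k = "part la (Suc r)"
  have less: "?k < part la r" using part_Suc_less[OF la r] .
  have all: "(\<forall>k. (Suc r, k) \<in> SD la \<longrightarrow> P k) \<longleftrightarrow> (\<forall>c<?k. P (Suc r + c))" for P
    using r by (auto simp: SD_iff) (metis add.commute le_Suc_ex nat_add_left_cancel_less add_Suc)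
  have 1: "(\<forall>c<?k. row_word la D (Suc r) ! c < row_word la D r ! 0) \<longleftrightarrow>
      (\<forall>k. (Suc r, k) \<in> SD la \<longrightarrow> D (Suc r, k) < D (r, r))"
    unfolding all using less by (auto simp: row_word_nth)
  have 2: "(\<forall>a c. a < c \<longrightarrow> c < ?k \<longrightarrow> row_word la D r ! Suc a \<le> row_word la D (Suc r) ! c \<longrightarrow>
        row_word la D (Suc r) ! a < row_word la D (Suc r) ! c) \<longleftrightarrow>
      (\<forall>j k. j < k \<longrightarrow> (Suc r, j) \<in> SD la \<longrightarrow> (Suc r, k) \<in> SD la \<longrightarrow>
       D (r, j) \<le> D (Suc r, k) \<longrightarrow> D (Suc r, j) < D (Suc r, k))" (is "?A \<longleftrightarrow> ?B")
  proof
    assume A: ?A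
    show ?B
    proof (intro allI impI)
      fix j k assume "j < k" "(Suc r, j) \<in> SD la" "(Suc r, k) \<in> SD la" "D (r, j) \<le> D (Suc r, k)"
      then show "D (Suc r, j) < D (Suc r, k)"
        using A[rule_format, of "j - Suc r" "k - Suc r"] less
        by (auto simp: SD_iff row_word_nth Suc_diff_Suc)
    qed
  next
    assume B: ?B
    show ?A
    proof (intro allI impI)
      fix a c assume "a < c" "c < ?k" "row_word la D r ! Suc a \<le> row_word la D (Suc r) ! c"
      then show "row_word la D (Suc r) ! a < row_word la D (Suc r) ! c"
        using B[rule_format, of "Suc r + a" "Suc r + c"] less r
        by (auto simp: SD_iff row_word_nth)
    qed
  qed
  have 3: "(\<forall>a c. a \<le> c \<longrightarrow> c < ?k \<longrightarrow> row_word la D (Suc r) ! c < row_word la D r ! a \<longrightarrow>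
        row_word la D r ! Suc c \<le> row_word la D r ! a) \<longleftrightarrow>
      (\<forall>j k. j < k \<longrightarrow> (r, j) \<in> SD la \<longrightarrow> (Suc r, k) \<in> SD la \<longrightarrow>
       D (Suc r, k) < D (r, j) \<longrightarrow> D (r, k) \<le> D (r, j))" (is "?A \<longleftrightarrow> ?B")
  proof
    assume A: ?A
    show ?B
    proof (intro allI impI)
      fix j k assume "j < k" "(r, j) \<in> SD la" "(Suc r, k) \<in> SD la" "D (Suc r, k) < D (r, j)"
      then show "D (r, k) \<le> D (r, j)"
        using A[rule_format, of "j - r" "k - Suc r"] less
        by (auto simp: SD_iff row_word_nth Suc_diff_Suc)
    qed
  next
    assume B: ?B
    show ?A
    proof (intro allI impI)
      fix a c assume "a \<le> c" "c < ?k" "row_word la D (Suc r) ! c < row_word la D r ! a"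
      then show "row_word la D r ! Suc c \<le> row_word la D r ! a"
        using B[rule_format, of "r + a" "Suc r + c"] less r
        by (auto simp: SD_iff row_word_nth)
    qed
  qed
  show ?thesis
    unfolding compatible_rows_def length_row_word 1 2 3 ..
qed

text \<open>Singletons turn an ordinary filling into a set-valued one, so that one notion of pattern
  serves both.\<close>

lemma decomposition_tableau_iff:
  assumes la: "strict_partition la"
  shows "decomposition_tableau la D \<longleftrightarrow>
    (\<forall>b\<in>SD la. 0 < D b) \<and> no_pattern (\<lambda>b. if b \<in> SD la then {D b} else {})"
    (is "_ \<longleftrightarrow> ?pos \<and> no_pattern ?T")
proof (cases ?pos)
  case pos: True
  have hook: "hook_word (row_word la D r) \<longleftrightarrow> rises_once (row_word la D r)"
    if r: "r \<in> {1..length la}" for r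
  proof -
    have "row_word la D r \<noteq> []"
      using part_pos[OF la, of r] r length_row_word[of la D r] by auto
    moreover have "\<forall>x\<in>set (row_word la D r). 0 < x"
      using pos r by (auto simp: in_set_conv_nth length_row_word row_word_nth SD_iff)
    ultimately show ?thesis by (simp add: hook_word_iff)
  qed
  have "decomposition_tableau la D \<longleftrightarrow>
      (\<forall>r\<in>{1..length la}. rises_once (row_word la D r)) \<and>
      (\<forall>r\<in>{1..length la - 1}. compatible_rows (row_word la D r) (row_word la D (Suc r)))"
  proof (cases "\<forall>r\<in>{1..length la}. rises_once (row_word la D r)")
    case True
    have "maximal_hook_subword (row_word la D r) (row_word la D (r + 1) @ row_word la D r) \<longleftrightarrow>
        compatible_rows (row_word la D r) (row_word la D (Suc r))"
      if "r \<in> {1..length la - 1}" for r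
      using that True hook[of r] hook[of "Suc r"] part_Suc_less[OF la, of r]
      by (subst Suc_eq_plus1[symmetric], subst maximal_hook_subword_iff)
        (auto simp: length_row_word)
    then show ?thesis
      using True pos hook unfolding decomposition_tableau_def by simp
  next
    case False
    then show ?thesis using hook unfolding decomposition_tableau_def by blast
  qed
  also have "\<dots> \<longleftrightarrow> no_pattern ?T"
  proof
    assume *: "(\<forall>r\<in>{1..length la}. rises_once (row_word la D r)) \<and>
      (\<forall>r\<in>{1..length la - 1}. compatible_rows (row_word la D r) (row_word la D (Suc r)))"
    have row: "D (r, q) < D (r, s)"
      if "p < q" "q < s" "(r, p) \<in> SD la" "(r, q) \<in> SD la" "(r, s) \<in> SD la" "D (r, p) < D (r, q)"
      for r p q s
      using * that rises_once_row_word[of r la D] by (auto simp: SD_iff)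
    have rows: "compatible_rows (row_word la D r) (row_word la D (Suc r)) \<and> 1 \<le> r \<and> Suc r \<le> length la"
      if "(r, j) \<in> SD la" "(Suc r, k) \<in> SD la" for r j k
      using * that by (auto simp: SD_iff)
    show "no_pattern ?T"
    proof (rule no_patternI)
      fix r k x z assume "x \<in> ?T (r, r)" "z \<in> ?T (Suc r, k)" "x \<le> z"
      then show False
        using rows[of r r k] compatible_row_words[OF la, of r D] by (auto split: if_splits)
    next
      fix r j k x y z
      assume "j < k" "x \<in> ?T (r, j)" "y \<in> ?T (Suc r, j)" "z \<in> ?T (Suc r, k)" "x \<le> z" "z \<le> y"
      then show False
        using rows[of r j k] compatible_row_words[OF la, of r D] by (fastforce split: if_splits)
    next
      fix r j k x y z
      assume "j < k" "x \<in> ?T (r, j)" "y \<in> ?T (r, k)" "z \<in> ?T (Suc r, k)" "z < x" "x < y"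
      then show False
        using rows[of r j k] compatible_row_words[OF la, of r D] by (fastforce split: if_splits)
    qed (use row in \<open>fastforce split: if_splits\<close>)
  next
    assume T: "no_pattern ?T"
    have "compatible_rows (row_word la D r) (row_word la D (Suc r))"
      if "r \<in> {1..length la - 1}" for r
    proof -
      have r: "1 \<le> r" "Suc r \<le> length la" using that by auto
      have up: "(r, c) \<in> SD la" if "(Suc r, c) \<in> SD la" for c
        using SD_up[OF la that r(1)] .
      have diag: "(r, r) \<in> SD la" using r part_pos[OF la, of r] by (auto simp: SD_iff)
      show ?thesis unfolding compatible_row_words[OF la r]
      proof (intro conjI allI impI)
        fix k assume "(Suc r, k) \<in> SD la"
        then show "D (Suc r, k) < D (r, r)"
          using no_pattern_diagonal[OF T, of "D (r, r)" r "D (Suc r, k)" k] diag by simp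
      next
        fix j k
        assume "j < k" "(Suc r, j) \<in> SD la" "(Suc r, k) \<in> SD la" "D (r, j) \<le> D (Suc r, k)"
        then show "D (Suc r, j) < D (Suc r, k)"
          using no_pattern_left[OF T, of j k "D (r, j)" r "D (Suc r, j)" "D (Suc r, k)"] up by simp
      next
        fix j k
        assume "j < k" "(r, j) \<in> SD la" "(Suc r, k) \<in> SD la" "D (Suc r, k) < D (r, j)"
        then show "D (r, k) \<le> D (r, j)"
          using no_pattern_right[OF T, of j k "D (r, j)" r "D (r, k)" "D (Suc r, k)"] up by simp
      qed
    qed
    moreover have "rises_once (row_word la D r)" if "r \<in> {1..length la}" for r
    proof (subst rises_once_row_word; (intro allI impI)?)
      fix p q s
      assume "p < q" "q < s" "(r, p) \<in> SD la" "(r, q) \<in> SD la" "(r, s) \<in> SD la"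
        "D (r, p) < D (r, q)"
      then show "D (r, q) < D (r, s)"
        using no_pattern_row[OF T, of p q s "D (r, p)" r "D (r, q)" "D (r, s)"] by simp
    qed (use that in auto)
    ultimately show "(\<forall>r\<in>{1..length la}. rises_once (row_word la D r)) \<and>
      (\<forall>r\<in>{1..length la - 1}. compatible_rows (row_word la D r) (row_word la D (Suc r)))"
      by blast
  qed
  finally show ?thesis using pos by simp
qed (auto simp: decomposition_tableau_def)

text \<open>A pattern lives in at most three boxes, all distinct, so one distribution that picks the
  offending entries there already exhibits it.\<close>

lemma no_pattern_set_valued:
  assumes ne: "\<And>b. b \<in> S \<Longrightarrow> T b \<noteq> {}" and out: "\<And>b. b \<notin> S \<Longrightarrow> T b = {}"
  shows "no_pattern T \<longleftrightarrow>
    (\<forall>D. (\<forall>b\<in>S. D b \<in> T b) \<longrightarrow> no_pattern (\<lambda>b. if b \<in> S then {D b} else {}))"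
proof (intro iffI allI impI)
  fix D assume "no_pattern T" and D: "\<forall>b\<in>S. D b \<in> T b"
  have "(if b \<in> S then {D b} else {}) \<subseteq> T b" for b using D by simp
  with \<open>no_pattern T\<close> show "no_pattern (\<lambda>b. if b \<in> S then {D b} else {})"
    by (rule no_pattern_mono)
next
  assume *: "\<forall>D. (\<forall>b\<in>S. D b \<in> T b) \<longrightarrow> no_pattern (\<lambda>b. if b \<in> S then {D b} else {})"
  have ex: "\<exists>T'. no_pattern T' \<and> x \<in> T' b1 \<and> y \<in> T' b2 \<and> z \<in> T' b3"
    if "x \<in> T b1" "y \<in> T b2" "z \<in> T b3" "b1 \<noteq> b2" "b1 \<noteq> b3" "b2 \<noteq> b3" for x y z b1 b2 b3
  proof -
    define D where "D = ((\<lambda>b. SOME x. x \<in> T b)(b1 := x, b2 := y, b3 := z))"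
    have "D b \<in> T b" if "b \<in> S" for b
      using ne[OF that] \<open>x \<in> T b1\<close> \<open>y \<in> T b2\<close> \<open>z \<in> T b3\<close>
      by (auto simp: D_def some_in_eq)
    with * have "no_pattern (\<lambda>b. if b \<in> S then {D b} else {})" by blast
    moreover have "b1 \<in> S" "b2 \<in> S" "b3 \<in> S" using that out by blast+
    ultimately show ?thesis using that
      by (intro exI[of _ "\<lambda>b. if b \<in> S then {D b} else {}"]) (auto simp: D_def)
  qed
  have ex2: "\<exists>T'. no_pattern T' \<and> x \<in> T' b1 \<and> y \<in> T' b2"
    if "x \<in> T b1" "y \<in> T b2" "b1 \<noteq> b2" for x y b1 b2
  proof -
    define D where "D = ((\<lambda>b. SOME x. x \<in> T b)(b1 := x, b2 := y))"
    have "D b \<in> T b" if "b \<in> S" for b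
      using ne[OF that] \<open>x \<in> T b1\<close> \<open>y \<in> T b2\<close> by (auto simp: D_def some_in_eq)
    with * have "no_pattern (\<lambda>b. if b \<in> S then {D b} else {})" by blast
    moreover have "b1 \<in> S" "b2 \<in> S" using that out by blast+
    ultimately show ?thesis using that
      by (intro exI[of _ "\<lambda>b. if b \<in> S then {D b} else {}"]) (auto simp: D_def)
  qed
  show "no_pattern T"
  proof (rule no_patternI)
    fix r p q s x y z
    assume a: "p < q" "q < s" "x \<in> T (r, p)" "y \<in> T (r, q)" "z \<in> T (r, s)" "x < y" "z \<le> y"
    then obtain T' where "no_pattern T'" "x \<in> T' (r, p)" "y \<in> T' (r, q)" "z \<in> T' (r, s)"
      using ex[of x "(r, p)" y "(r, q)" z "(r, s)"] by auto
    then show False using no_pattern_row[of T' p q s x r y z] a by simp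
  next
    fix r k x z assume a: "x \<in> T (r, r)" "z \<in> T (Suc r, k)" "x \<le> z"
    then obtain T' where "no_pattern T'" "x \<in> T' (r, r)" "z \<in> T' (Suc r, k)"
      using ex2[of x "(r, r)" z "(Suc r, k)"] by auto
    then show False using no_pattern_diagonal[of T' x r z k] a by simp
  next
    fix r j k x y z
    assume a: "j < k" "x \<in> T (r, j)" "y \<in> T (Suc r, j)" "z \<in> T (Suc r, k)" "x \<le> z" "z \<le> y"
    then obtain T' where "no_pattern T'" "x \<in> T' (r, j)" "y \<in> T' (Suc r, j)" "z \<in> T' (Suc r, k)"
      using ex[of x "(r, j)" y "(Suc r, j)" z "(Suc r, k)"] by auto
    then show False using no_pattern_left[of T' j k x r y z] a by simp
  next
    fix r j k x y z
    assume a: "j < k" "x \<in> T (r, j)" "y \<in> T (r, k)" "z \<in> T (Suc r, k)" "z < x" "x < y"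
    then obtain T' where "no_pattern T'" "x \<in> T' (r, j)" "y \<in> T' (r, k)" "z \<in> T' (Suc r, k)"
      using ex[of x "(r, j)" y "(r, k)" z "(Suc r, k)"] by auto
    then show False using no_pattern_right[of T' j k x r y z] a by simp
  qed
qed

lemma SetDecTab_iff:
  assumes la: "strict_partition la"
  shows "T \<in> SetDecTab n la \<longleftrightarrow>
    (\<forall>b\<in>SD la. T b \<noteq> {} \<and> T b \<subseteq> {1..n}) \<and> (\<forall>b. b \<notin> SD la \<longrightarrow> T b = {}) \<and> no_pattern T"
    (is "?L \<longleftrightarrow> ?R")
proof -
  have *: "(\<forall>D. (\<forall>b\<in>SD la. D b \<in> T b) \<longrightarrow> decomposition_tableau la D) \<longleftrightarrow> no_pattern T"
    if "\<And>b. b \<in> SD la \<Longrightarrow> T b \<noteq> {} \<and> (\<forall>x\<in>T b. 0 < x)" "\<And>b. b \<notin> SD la \<Longrightarrow> T b = {}"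
    unfolding decomposition_tableau_iff[OF la]
    using that no_pattern_set_valued[of "SD la" T] by fastforce
  show ?thesis
  proof
    assume ?L
    then show ?R using * unfolding SetDecTab_def set_valued_decomposition_tableau_def by auto
  next
    assume R: ?R
    then have "\<And>b. b \<in> SD la \<Longrightarrow> finite (T b) \<and> T b \<noteq> {} \<and> (\<forall>x\<in>T b. 0 < x)"
      by (meson finite_subset finite_atLeastAtMost atLeastAtMost_iff subsetD zero_less_one
          order_less_le_trans)
    then show ?L using * R unfolding SetDecTab_def set_valued_decomposition_tableau_def by auto
  qed
qed

section \<open>Enlarging one box of a tableau\<close>

definition before :: "box \<Rightarrow> box \<Rightarrow> bool" where
  "before a b \<longleftrightarrow> fst a < fst b \<or> fst a = fst b \<and> snd b < snd a"

lemma before_iff [simp]: "before (r, c) (r', c') \<longleftrightarrow> r < r' \<or> r = r' \<and> c' < c"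
  by (simp add: before_def)

definition only :: "(box \<Rightarrow> nat set) \<Rightarrow> nat \<Rightarrow> nat \<Rightarrow> box \<Rightarrow> bool" where
  "only T a a' x \<longleftrightarrow> a \<in> T x \<and> a' \<notin> T x"

text \<open>
  A forbidden pattern created by enlarging a box involves a second box with an entry \<open>i\<close> or
  \<open>i + 1\<close>; the hypotheses of the next two lemmas are the configurations where this can happen.
\<close>

lemma no_pattern_insert_lower:
  assumes T: "no_pattern T" and b: "Suc i \<in> T (r, c)"
    and row1: "\<And>q s z. c < q \<Longrightarrow> q < s \<Longrightarrow> Suc i \<in> T (r, q) \<Longrightarrow> z \<in> T (r, s) \<Longrightarrow> z \<le> Suc i \<Longrightarrow> False"
    and row3: "\<And>p q w. p < q \<Longrightarrow> q < c \<Longrightarrow> w \<in> T (r, p) \<Longrightarrow> w < i \<Longrightarrow> i \<in> T (r, q) \<Longrightarrow> False"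
    and diag: "\<And>k. c = r \<Longrightarrow> i \<in> T (Suc r, k) \<Longrightarrow> False"
    and left_x: "\<And>k y. c < k \<Longrightarrow> i \<in> T (Suc r, k) \<Longrightarrow> y \<in> T (Suc r, c) \<Longrightarrow> i \<le> y \<Longrightarrow> False"
    and left_z: "\<And>r' j x. r = Suc r' \<Longrightarrow> j < c \<Longrightarrow> i \<in> T (r, j) \<Longrightarrow> x \<in> T (r', j) \<Longrightarrow> x \<le> i \<Longrightarrow> False"
    and right_x: "\<And>k z. c < k \<Longrightarrow> Suc i \<in> T (r, k) \<Longrightarrow> z \<in> T (Suc r, k) \<Longrightarrow> z < i \<Longrightarrow> False"
    and right_z: "\<And>r' j y. r = Suc r' \<Longrightarrow> j < c \<Longrightarrow> Suc i \<in> T (r', j) \<Longrightarrow> y \<in> T (r', c) \<Longrightarrow>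
      Suc i < y \<Longrightarrow> False"
  shows "no_pattern (T((r, c) := insert i (T (r, c))))" (is "no_pattern ?T")
proof -
  have mem: "x \<in> ?T a \<Longrightarrow> x \<in> T a \<or> a = (r, c) \<and> x = i" for x a
    by (auto split: if_splits)
  show ?thesis
  proof (rule no_patternI)
    fix r1 p q s x y z
    assume "p < q" "q < s" "x \<in> ?T (r1, p)" "y \<in> ?T (r1, q)" "z \<in> ?T (r1, s)" "x < y" "z \<le> y"
    \<comment> \<open>Exchange the new \<open>i\<close> for the old \<open>Suc i\<close>. The
      pattern survives, against \<open>T\<close>, unless the new entry is \<open>x\<close> and
      \<open>y = Suc i\<close>, or the new entry is \<open>z\<close> and \<open>y = i\<close>; these
      cases are \<open>row1\<close> and \<open>row3\<close>.\<close>
    then show False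
      using mem[of x "(r1, p)"] mem[of y "(r1, q)"] mem[of z "(r1, s)"]
        no_pattern_row[OF T, of p q s x r1 y z] no_pattern_row[OF T, of p q s "Suc i" r1 y z]
        no_pattern_row[OF T, of p q s x r1 "Suc i" z] no_pattern_row[OF T, of p q s x r1 y "Suc i"]
        row1[of q s z] row3[of p q x] b
      by (cases "y = Suc i"; cases "y = i") auto
  next
    fix r1 k x z
    assume "x \<in> ?T (r1, r1)" "z \<in> ?T (Suc r1, k)" "x \<le> z"
    then show False
      using mem[of x "(r1, r1)"] mem[of z "(Suc r1, k)"] diag[of k] b
        no_pattern_diagonal[OF T, of x r1 z k] no_pattern_diagonal[OF T, of "Suc i" r1 z k]
        no_pattern_diagonal[OF T, of x r1 "Suc i" k]
      by (cases "z = i") auto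
  next
    fix r1 j k x y z
    assume "j < k" "x \<in> ?T (r1, j)" "y \<in> ?T (Suc r1, j)" "z \<in> ?T (Suc r1, k)" "x \<le> z" "z \<le> y"
    then show False
      using mem[of x "(r1, j)"] mem[of y "(Suc r1, j)"] mem[of z "(Suc r1, k)"]
        left_x[of k y] left_z[of r1 j x] b
        no_pattern_left[OF T, of j k x r1 y z] no_pattern_left[OF T, of j k "Suc i" r1 y z]
        no_pattern_left[OF T, of j k x r1 "Suc i" z] no_pattern_left[OF T, of j k x r1 y "Suc i"]
      by (cases "z = i"; cases "y = i") auto
  next
    fix r1 j k x y z
    assume "j < k" "x \<in> ?T (r1, j)" "y \<in> ?T (r1, k)" "z \<in> ?T (Suc r1, k)" "z < x" "x < y"
    then show False
      using mem[of x "(r1, j)"] mem[of y "(r1, k)"] mem[of z "(Suc r1, k)"]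
        right_x[of k z] right_z[of r1 j y] b
        no_pattern_right[OF T, of j k x r1 y z] no_pattern_right[OF T, of j k "Suc i" r1 y z]
        no_pattern_right[OF T, of j k x r1 "Suc i" z] no_pattern_right[OF T, of j k x r1 y "Suc i"]
      by (cases "x = Suc i"; cases "y = Suc i") auto
  qed
qed

lemma no_pattern_insert_upper:
  assumes T: "no_pattern T" and b: "i \<in> T (r, c)"
    and row2: "\<And>p s z. p < c \<Longrightarrow> c < s \<Longrightarrow> i \<in> T (r, p) \<Longrightarrow> z \<in> T (r, s) \<Longrightarrow> z \<le> Suc i \<Longrightarrow> False"
    and row2': "\<And>p s w. p < c \<Longrightarrow> c < s \<Longrightarrow> w \<in> T (r, p) \<Longrightarrow> w < i \<Longrightarrow> Suc i \<in> T (r, s) \<Longrightarrow> False"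
    and diag: "\<And>r'. r = Suc r' \<Longrightarrow> Suc i \<in> T (r', r') \<Longrightarrow> False"
    and left_y: "\<And>r' k x. r = Suc r' \<Longrightarrow> c < k \<Longrightarrow> Suc i \<in> T (r, k) \<Longrightarrow> x \<in> T (r', c) \<Longrightarrow>
      x \<le> Suc i \<Longrightarrow> False"
    and left_z: "\<And>r' j y. r = Suc r' \<Longrightarrow> j < c \<Longrightarrow> Suc i \<in> T (r', j) \<Longrightarrow> y \<in> T (r, j) \<Longrightarrow>
      Suc i \<le> y \<Longrightarrow> False"
    and right_x: "\<And>k y. c < k \<Longrightarrow> i \<in> T (Suc r, k) \<Longrightarrow> y \<in> T (r, k) \<Longrightarrow> Suc i < y \<Longrightarrow> False"
    and right_y: "\<And>j z. j < c \<Longrightarrow> i \<in> T (r, j) \<Longrightarrow> z \<in> T (Suc r, c) \<Longrightarrow> z < i \<Longrightarrow> False"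
  shows "no_pattern (T((r, c) := insert (Suc i) (T (r, c))))" (is "no_pattern ?T")
proof -
  have mem: "x \<in> ?T a \<Longrightarrow> x \<in> T a \<or> a = (r, c) \<and> x = Suc i" for x a
    by (auto split: if_splits)
  show ?thesis
  proof (rule no_patternI)
    fix r1 p q s x y z
    assume "p < q" "q < s" "x \<in> ?T (r1, p)" "y \<in> ?T (r1, q)" "z \<in> ?T (r1, s)" "x < y" "z \<le> y"
    \<comment> \<open>Now the old \<open>i\<close> replaces the new \<open>Suc i\<close>. Only a new
      middle entry can lose the pattern, through \<open>x = i\<close> or
      \<open>z = Suc i\<close>.\<close>
    then show False
      using mem[of x "(r1, p)"] mem[of y "(r1, q)"] mem[of z "(r1, s)"]
        no_pattern_row[OF T, of p q s x r1 y z] no_pattern_row[OF T, of p q s i r1 y z]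
        no_pattern_row[OF T, of p q s x r1 i z] no_pattern_row[OF T, of p q s x r1 y i]
        row2[of p s z] row2'[of p s x] b
      by (cases "x = i"; cases "z = Suc i") auto
  next
    fix r1 k x z
    assume "x \<in> ?T (r1, r1)" "z \<in> ?T (Suc r1, k)" "x \<le> z"
    then show False
      using mem[of x "(r1, r1)"] mem[of z "(Suc r1, k)"] diag[of r1] b
        no_pattern_diagonal[OF T, of x r1 z k] no_pattern_diagonal[OF T, of i r1 z k]
        no_pattern_diagonal[OF T, of x r1 i k]
      by (cases "x = Suc i") auto
  next
    fix r1 j k x y z
    assume "j < k" "x \<in> ?T (r1, j)" "y \<in> ?T (Suc r1, j)" "z \<in> ?T (Suc r1, k)" "x \<le> z" "z \<le> y"
    then show False
      using mem[of x "(r1, j)"] mem[of y "(Suc r1, j)"] mem[of z "(Suc r1, k)"]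
        left_y[of r1 k x] left_z[of r1 j y] b
        no_pattern_left[OF T, of j k x r1 y z] no_pattern_left[OF T, of j k i r1 y z]
        no_pattern_left[OF T, of j k x r1 i z] no_pattern_left[OF T, of j k x r1 y i]
      by (cases "z = Suc i"; cases "x = Suc i") auto
  next
    fix r1 j k x y z
    assume "j < k" "x \<in> ?T (r1, j)" "y \<in> ?T (r1, k)" "z \<in> ?T (Suc r1, k)" "z < x" "x < y"
    then show False
      using mem[of x "(r1, j)"] mem[of y "(r1, k)"] mem[of z "(Suc r1, k)"]
        right_x[of k y] right_y[of j z] b
        no_pattern_right[OF T, of j k x r1 y z] no_pattern_right[OF T, of j k i r1 y z]
        no_pattern_right[OF T, of j k x r1 i z] no_pattern_right[OF T, of j k x r1 y i]
      by (cases "x = i"; cases "z = i") auto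
  qed
qed

text \<open>The conditions of \<open>SetDecTab\<close> other than the range of the entries.
  Nonemptiness is what supplies an entry in a box known only to lie in the shape.\<close>

locale filling =
  fixes la :: "nat list" and T :: "box \<Rightarrow> nat set"
  assumes la: "strict_partition la"
    and nonempty: "\<And>b. b \<in> SD la \<Longrightarrow> T b \<noteq> {}"
    and outside: "\<And>b. b \<notin> SD la \<Longrightarrow> T b = {}"
    and T: "no_pattern T"
begin

lemmas row = no_pattern_row[OF T] and diagonal = no_pattern_diagonal[OF T]
  and left = no_pattern_left[OF T] and right = no_pattern_right[OF T]

lemma in_SD: "x \<in> T b \<Longrightarrow> b \<in> SD la"
  using outside by blast

lemma elem_row:
  assumes "x \<in> T (r, c)" "r \<le> c'" "c' \<le> c"
  obtains y where "y \<in> T (r, c')"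
  using assms SD_left in_SD nonempty by blast

text \<open>The entry \<open>y\<close> certifies that row \<open>r\<close> exists; a box above a box
  of the next row is then in the shape.\<close>

lemma elem_above:
  assumes "x \<in> T (Suc r, c)" "y \<in> T (r, j)"
  obtains z where "z \<in> T (r, c)"
proof -
  have "(r, c) \<in> SD la"
    using assms in_SD SD_up[OF la] SD_col_ge by blast
  then show ?thesis using nonempty that by blast
qed

lemma col_ge: "x \<in> T (r, c) \<Longrightarrow> r \<le> c"
  using in_SD SD_col_ge by blast

end

text \<open>The box where \<open>e'\<close> adds \<open>i\<close>, with what the linked word says
  about it. \<open>pred\<close>: an \<open>i + 1\<close> read earlier lies in a form whose last box
  has \<open>i\<close> but not \<open>i + 1\<close>. \<open>count\<close>: no unmatched ")" follows,
  and the partner of the "(" of \<open>(r, c)\<close>, if any, is in a linked box, so in each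
  stretch beginning just after \<open>(r, c)\<close> the boxes with only \<open>i\<close> do not
  outnumber those with only \<open>i + 1\<close>.\<close>

locale raising = filling +
  fixes i r c :: nat
  assumes b: "Suc i \<in> T (r, c)" and b': "i \<notin> T (r, c)"
    and pred: "\<And>x. before x (r, c) \<Longrightarrow> Suc i \<in> T x \<Longrightarrow> \<exists>t. before x t \<and> before t (r, c) \<and> i \<in> T t"
    and count: "\<And>y. before (r, c) y \<Longrightarrow>
      card {x \<in> SD la. before (r, c) x \<and> (x = y \<or> before x y) \<and> only T i (Suc i) x}
      \<le> card {x \<in> SD la. before (r, c) x \<and> (x = y \<or> before x y) \<and> only T (Suc i) i x}"
begin

text \<open>\<open>count\<close> for the stretch up to \<open>y\<close> gives a box with only
  \<open>i + 1\<close>; it differs from \<open>y\<close>, which has only \<open>i\<close>.\<close>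

lemma partner:
  assumes "before (r, c) y" "only T i (Suc i) y"
  obtains t where "before (r, c) t" "before t y" "Suc i \<in> T t"
proof -
  let ?A = "{x \<in> SD la. before (r, c) x \<and> (x = y \<or> before x y) \<and> only T i (Suc i) x}"
  let ?B = "{x \<in> SD la. before (r, c) x \<and> (x = y \<or> before x y) \<and> only T (Suc i) i x}"
  have "y \<in> ?A" using assms in_SD[of i y] by (simp add: only_def)
  then have "?A \<noteq> {}" by blast
  moreover have "finite ?A" by (rule finite_subset[OF _ finite_SD[of la]]) blast
  ultimately have "0 < card ?A" by (simp add: card_gt_0_iff)
  then have "0 < card ?B" using count[OF assms(1)] by linarith
  then obtain t where "t \<in> ?B" by (metis (no_types, lifting) card_gt_0_iff ex_in_conv)
  moreover from this have "t \<noteq> y" using assms(2) by (auto simp: only_def)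
  ultimately show ?thesis by (intro that[of t]) (auto simp: only_def)
qed

text \<open>A row is read from right to left, so \<open>pred\<close> puts an \<open>i\<close> in a
  column between \<open>c\<close> and \<open>q\<close>; together with the other two entries it is
  already a row pattern.\<close>

lemma no_row1:
  assumes "c < q" "q < s" "Suc i \<in> T (r, q)" "z \<in> T (r, s)" "z \<le> Suc i"
  shows False
proof -
  have "\<exists>t. before (r, q) t \<and> before t (r, c) \<and> i \<in> T t"
    using assms by (intro pred) auto
  then obtain t where t: "before (r, q) t" "before t (r, c)" "i \<in> T t" by blast
  then obtain t' where "t = (r, t')" "c < t'" "t' < q" by (cases t) auto
  then show False using row[of t' q s i r "Suc i" z] t assms by auto
qed

text \<open>An \<open>i + 1\<close> between the columns \<open>q\<close> and \<open>c\<close>,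
  supplied by \<open>partner\<close>, forms a row pattern with \<open>w\<close> and the
  \<open>i + 1\<close> of \<open>(r, c)\<close>.\<close>

lemma no_row3:
  assumes "p < q" "q < c" "w \<in> T (r, p)" "w < i" "i \<in> T (r, q)"
  shows False
proof -
  have "Suc i \<notin> T (r, q)" using row[of p q c w r "Suc i" "Suc i"] assms b by auto
  then obtain t where t: "before (r, c) t" "before t (r, q)" "Suc i \<in> T t"
    using partner[of "(r, q)"] assms by (auto simp: only_def)
  then obtain t' where "t = (r, t')" "q < t'" "t' < c" by (cases t) auto
  then show False using row[of p t' c w r "Suc i" "Suc i"] t assms b by auto
qed

text \<open>The diagonal box is read last in its row, so the partner would have to lie in row
  \<open>Suc r\<close>, where the diagonal entry \<open>Suc i\<close> excludes it.\<close>

lemma no_diag: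
  assumes "c = r" "i \<in> T (Suc r, k)"
  shows False
proof -
  have no: "Suc i \<notin> T (Suc r, k')" for k' using diagonal[of "Suc i" r "Suc i" k'] assms b by auto
  then obtain t where t: "before (r, c) t" "before t (Suc r, k)" "Suc i \<in> T t"
    using partner[of "(Suc r, k)"] assms by (auto simp: only_def)
  obtain r' t' where tt: "t = (r', t')" by (cases t)
  have "r' = Suc r" using t tt assms col_ge[of "Suc i" r' t'] by auto
  then show False using t tt no by auto
qed

lemma no_left_z:
  assumes "j < c" "i \<in> T (r, j)" "x \<in> T (r', j)" "x \<le> i" "r = Suc r'"
  shows False
proof -
  have "Suc i \<notin> T (r, j)" using left[of j c x r' "Suc i" "Suc i"] assms b by auto
  then obtain t where t: "before (r, c) t" "before t (r, j)" "Suc i \<in> T t"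
    using partner[of "(r, j)"] assms by (auto simp: only_def)
  then obtain t' where "t = (r, t')" "j < t'" "t' < c" by (cases t) auto
  then show False using row[of j t' c i r "Suc i" "Suc i"] t assms b by auto
qed

lemma no_right_x:
  assumes "c < k" "Suc i \<in> T (r, k)" "z \<in> T (Suc r, k)" "z < i"
  shows False
proof -
  have "\<exists>t. before (r, k) t \<and> before t (r, c) \<and> i \<in> T t"
    using assms by (intro pred) auto
  then obtain t where t: "before (r, k) t" "before t (r, c)" "i \<in> T t" by blast
  then obtain t' where "t = (r, t')" "c < t'" "t' < k" by (cases t) auto
  then show False using right[of t' k i r "Suc i" z] t assms by auto
qed

text \<open>The \<open>i\<close> given by \<open>pred\<close> lies in row \<open>r\<close> right of
  \<open>c\<close> or in row \<open>r'\<close> left of \<open>j\<close>. In the first case the entry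
  above it must exceed \<open>y\<close> and yet be at most \<open>Suc i\<close>. In the second,
  \<open>(r, j)\<close> is forced to contain \<open>i\<close>, with a smaller \<open>w\<close> to
  its left, and the partner of that \<open>i\<close> completes a row pattern.\<close>

lemma no_right_z:
  assumes r: "r = Suc r'" and "j < c" "Suc i \<in> T (r', j)" "y \<in> T (r', c)" "Suc i < y"
  shows False
proof -
  have "\<exists>t. before (r', j) t \<and> before t (r, c) \<and> i \<in> T t"
    using assms by (intro pred) auto
  then obtain t where t: "before (r', j) t" "before t (r, c)" "i \<in> T t" by blast
  obtain r1 t' where tt: "t = (r1, t')" by (cases t)
  consider "r1 = r" "c < t'" | "r1 = r'" "t' < j" using t tt r by auto
  then show False
  proof cases
    case 1
    then obtain y' where y': "y' \<in> T (r', t')"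
      using elem_above[of i r' t' "Suc i" j] t tt r assms by auto
    then have "y < y'" using row[of j c t' "Suc i" r' y y'] assms 1 by auto
    moreover have "y' \<le> Suc i" using right[of j t' "Suc i" r' y' i] assms y' t tt 1 by auto
    ultimately show False using assms by simp
  next
    case 2
    have it: "i \<in> T (r', t')" using t tt 2 by simp
    have "t' \<noteq> r'" using diagonal[of i r' "Suc i" c] it b r by auto
    then have t'r: "r \<le> t'" using col_ge[OF it] r by simp
    obtain w where w: "w \<in> T (r, t')" using elem_row[OF b, of t'] t'r 2 assms by auto
    \<comment> \<open>The conditions through \<open>(r', t')\<close>, \<open>(r', j)\<close> and
      \<open>(r, c)\<close> leave \<open>i\<close> as the only possible entry of
      \<open>(r, j)\<close>.\<close>
    have v: "v = i \<and> w < i" if v: "v \<in> T (r, j)" for v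
    proof -
      have "w < Suc i" using left[of t' c i r' w "Suc i"] it w b r 2 assms by auto
      moreover have "i \<le> v" using right[of t' j i r' "Suc i" v] it v r 2 assms by (meson less_irrefl not_less Suc_n_not_le_n)
      moreover have "w < v" using left[of t' j i r' w v] it w v r 2 calculation by auto
      moreover have "v < Suc i" using row[of t' j c w r v "Suc i"] calculation w v b 2 assms by auto
      ultimately show ?thesis by auto
    qed
    obtain v where v0: "v \<in> T (r, j)" using elem_row[OF b, of j] t'r 2 assms by auto
    then have iw: "i \<in> T (r, j)" "w < i" using v by auto
    moreover have "Suc i \<notin> T (r, j)" using v[of "Suc i"] by auto
    ultimately obtain u where u: "before (r, c) u" "before u (r, j)" "Suc i \<in> T u"
      using partner[of "(r, j)"] assms by (auto simp: only_def)
    then obtain u' where "u = (r, u')" "j < u'" "u' < c" by (cases u) auto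
    then show False using row[of t' u' c w r "Suc i" "Suc i"] u iw w 2 b by auto
  qed
qed

text \<open>The partner of the \<open>i\<close> in \<open>(Suc r, k)\<close> lies in row
  \<open>r\<close> left of \<open>c\<close> or in row \<open>Suc r\<close> right of
  \<open>k\<close>. The first yields an ascent to \<open>y\<close> in row \<open>Suc r\<close> that
  is followed by \<open>i < y\<close>, the second an old pattern with \<open>(r, c)\<close> and
  \<open>y\<close>.\<close>

lemma no_left_x_gt:
  assumes "c < k" "i \<in> T (Suc r, k)" "y \<in> T (Suc r, c)" "i < y"
  shows False
proof -
  have "Suc i \<notin> T (Suc r, k)" using left[of c k "Suc i" r y "Suc i"] assms b by auto
  then obtain t where t: "before (r, c) t" "before t (Suc r, k)" "Suc i \<in> T t"
    using partner[of "(Suc r, k)"] assms by (auto simp: only_def)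
  obtain r1 t' where tt: "t = (r1, t')" by (cases t)
  consider "r1 = r" "t' < c" | "r1 = Suc r" "k < t'" using t tt by force
  then show False
  proof cases
    case 1
    have it: "Suc i \<in> T (r, t')" using t tt 1 by simp
    have "t' \<noteq> r" using diagonal[of "Suc i" r y c] it assms by auto
    then have "Suc r \<le> t'" using col_ge[OF it] by simp
    then obtain w where w: "w \<in> T (Suc r, t')" using elem_row[OF assms(3), of t'] 1 by auto
    have "w < y" using left[of t' c "Suc i" r w y] it w assms 1 by auto
    then show False using row[of t' c k w "Suc r" y i] w assms 1 by auto
  next
    case 2
    then show False using left[of c t' "Suc i" r y "Suc i"] t tt b assms by auto
  qed
qed

text \<open>
  The row of \<open>(r, c)\<close> contains at most one entry \<open>i + 1\<close> for each of the entries \<open>i\<close> that the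
  pattern forces into the row below; this contradicts the count.
\<close>

lemma no_left_x_eq:
  assumes ck: "c < k" and ik: "i \<in> T (Suc r, k)" and ic: "i \<in> T (Suc r, c)"
  shows False
proof -
  have up: "y \<le> i" if "y \<in> T (Suc r, c)" for y
    using no_left_x_gt[OF ck ik that] by (cases "i < y") auto
  \<comment> \<open>\<open>m\<close> is the leftmost column up to \<open>c\<close> in which row
    \<open>r\<close> has \<open>i + 1\<close> without \<open>i\<close>. In columns
    \<open>m + 1\<close> to \<open>c\<close>, row \<open>Suc r\<close> is forced to contain
    \<open>i\<close> and not \<open>i + 1\<close>, while row \<open>r\<close> left of
    \<open>c\<close> has at most \<open>c - m\<close> boxes with only \<open>i + 1\<close>.\<close>
  define P where "P t \<longleftrightarrow> t \<le> c \<and> Suc i \<in> T (r, t) \<and> i \<notin> T (r, t)" for t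
  define m where "m = (LEAST t. P t)"
  have "P c" using b b' by (simp add: P_def)
  then have m: "P m" and least: "\<And>t. P t \<Longrightarrow> m \<le> t"
    unfolding m_def by (auto intro: LeastI Least_le)
  have mc: "m \<le> c" and im: "Suc i \<in> T (r, m)" using m by (auto simp: P_def)
  have rm: "r \<le> m" using col_ge[OF im] .
  have lower: "i \<le> w" if "w \<in> T (Suc r, t)" "t < c" for w t
    using row[of t c k w "Suc r" i i] that ic ik ck by (cases "i \<le> w") auto
  have Ac: "only T i (Suc i) (Suc r, c)" using ic up unfolding only_def by force
  have A: "only T i (Suc i) (Suc r, t)" if t: "m < t" "t \<le> c" for t
  proof (cases "t = c")
    case False
    with t have tc: "t < c" by simp
    obtain w where w: "w \<in> T (Suc r, t)" using elem_row[OF ic, of t] t rm by auto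
    have *: "v = i" if v: "v \<in> T (Suc r, t)" for v
    proof (rule ccontr)
      assume "v \<noteq> i"
      then have gt: "Suc i \<le> v" using lower[OF v] tc by simp
      have "m \<noteq> r" using diagonal[of "Suc i" r v t] im v gt by auto
      then obtain w' where w': "w' \<in> T (Suc r, m)" using elem_row[OF ic, of m] rm mc by auto
      have "w' < v" using left[of m t "Suc i" r w' v] im w' v gt t by auto
      then show False using row[of m t c w' "Suc r" v i] w' v ic gt t tc by auto
    qed
    have "i \<in> T (Suc r, t)" using w *[OF w] by simp
    moreover have "Suc i \<notin> T (Suc r, t)" using *[of "Suc i"] by auto
    ultimately show ?thesis unfolding only_def ..
  qed (use Ac in simp)
  have Brow: "t \<in> {m..<c}" if "only T (Suc i) i (r, t)" "t < c" for t
    using that least[of t] by (auto simp: P_def only_def)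
  have no_mid: "Suc i \<notin> T (Suc r, t)" if "c < t" "t < k" for t
    using row[of c t k i "Suc r" "Suc i" i] ic ik that by auto
  let ?A = "\<lambda>y. {x \<in> SD la. before (r, c) x \<and> (x = y \<or> before x y) \<and> only T i (Suc i) x}"
  let ?B = "\<lambda>y. {x \<in> SD la. before (r, c) x \<and> (x = y \<or> before x y) \<and> only T (Suc i) i x}"
  have clash: False if "P \<subseteq> ?A y" "?B y \<subseteq> Q" "finite Q" "card Q < card P" "before (r, c) y" for P Q y
  proof -
    have "card P \<le> card (?A y)" using that(1) finite_SD by (intro card_mono) auto
    moreover have "card (?B y) \<le> card Q" using that by (intro card_mono) auto
    ultimately show False using count[OF that(5)] that(4) by linarith
  qed
  show False
  proof (cases "\<exists>k'\<ge>k. Suc i \<in> T (Suc r, k')")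
    \<comment> \<open>Count up to \<open>(Suc r, Suc m)\<close>: columns \<open>m + 1\<close> to
      \<open>c\<close> and column \<open>k\<close> give \<open>c - m + 1\<close> boxes with only
      \<open>i\<close>, against at most \<open>c - m\<close> with only \<open>i + 1\<close>.\<close>
    case False
    show False
    proof (rule clash)
      show "Pair (Suc r) ` ({m<..c} \<union> {k}) \<subseteq> ?A (Suc r, Suc m)"
      proof
        fix x assume "x \<in> Pair (Suc r) ` ({m<..c} \<union> {k})"
        then obtain t where t: "x = (Suc r, t)" "m < t \<and> t \<le> c \<or> t = k" by auto
        then have "only T i (Suc i) x" using A[of t] False ik by (auto simp: only_def)
        moreover from this have "x \<in> SD la" using in_SD[of i x] by (simp add: only_def)
        ultimately show "x \<in> ?A (Suc r, Suc m)" using t ck mc by auto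
      qed
      show "?B (Suc r, Suc m) \<subseteq> Pair r ` {m..<c}"
      proof
        fix x assume x: "x \<in> ?B (Suc r, Suc m)"
        obtain r1 t where xt: "x = (r1, t)" by (cases x)
        have "\<not> r1 = Suc r"
        proof
          assume "r1 = Suc r"
          then have "m < t" "Suc i \<in> T (Suc r, t)" using x xt by (auto simp: only_def)
          then show False using False no_mid[of t] A[of t]
            by (cases "t \<le> c"; cases "k \<le> t") (auto simp: only_def)
        qed
        then show "x \<in> Pair r ` {m..<c}" using x xt Brow[of t] by auto
      qed
      show "card (Pair r ` {m..<c}) < card (Pair (Suc r) ` ({m<..c} \<union> {k}))"
        using ck mc by (subst (1 2) card_image) (auto simp: inj_on_def card_insert_if)
    qed auto
  next
    case True
    then obtain k' where k': "k \<le> k'" "Suc i \<in> T (Suc r, k')" by blast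
    have "m \<noteq> r" using diagonal[of "Suc i" r "Suc i" k'] im k' by auto
    then have rm': "Suc r \<le> m" using rm by simp
    have Am: "only T i (Suc i) (Suc r, m)"
    proof (cases "m = c")
      case False
      obtain w where w: "w \<in> T (Suc r, m)" using elem_row[OF ic, of m] rm' mc by auto
      have *: "v = i" if v: "v \<in> T (Suc r, m)" for v
        using left[of m k' "Suc i" r v "Suc i"] lower[OF v] im v k' ck mc False
        by auto
      have "i \<in> T (Suc r, m)" using w *[OF w] by simp
      moreover have "Suc i \<notin> T (Suc r, m)" using *[of "Suc i"] by auto
      ultimately show ?thesis unfolding only_def ..
    qed (use Ac in simp)
    \<comment> \<open>Count up to column \<open>m\<close>, which now also has only \<open>i\<close>
      in row \<open>Suc r\<close> and so gains one box. Beyond \<open>k\<close> at most one box,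
      \<open>k'\<close>, has \<open>i + 1\<close>. It is offset by column \<open>k\<close>, unless
      that box has both letters, and then no later box of the row has \<open>i + 1\<close>.
      \<open>E\<close> and \<open>F\<close> record the two cases.\<close>
    define E where "E = (if Suc i \<in> T (Suc r, k) then {} else {k'})"
    define F where "F = (if Suc i \<in> T (Suc r, k) then {} else {k})"
    show False
    proof (rule clash)
      show "Pair (Suc r) ` ({m..c} \<union> F) \<subseteq> ?A (Suc r, m)"
      proof -
        have "only T i (Suc i) (Suc r, t)" if "t \<in> {m..c} \<union> F" for t
          using A[of t] Am that ik by (cases "t = m") (auto simp: only_def F_def split: if_splits)
        moreover have "t = m \<or> m < t" if "t \<in> {m..c} \<union> F" for t
          using that ck mc by (auto simp: F_def split: if_splits)
        moreover have "x \<in> SD la" if "only T i (Suc i) x" for x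
          using that in_SD[of i x] by (simp add: only_def)
        ultimately have *: "only T i (Suc i) (Suc r, t) \<and> (Suc r, t) \<in> SD la \<and> (t = m \<or> m < t)"
          if "t \<in> {m..c} \<union> F" for t using that by blast
        show ?thesis
        proof
          fix x assume "x \<in> Pair (Suc r) ` ({m..c} \<union> F)"
          then obtain t where "x = (Suc r, t)" "t \<in> {m..c} \<union> F" by blast
          then show "x \<in> ?A (Suc r, m)" using *[of t] by simp
        qed
      qed
      show "?B (Suc r, m) \<subseteq> Pair r ` {m..<c} \<union> Pair (Suc r) ` E"
      proof
        fix x assume x: "x \<in> ?B (Suc r, m)"
        obtain r1 t where xt: "x = (r1, t)" by (cases x)
        show "x \<in> Pair r ` {m..<c} \<union> Pair (Suc r) ` E"
        proof (cases "r1 = Suc r")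
          case True
          then have t: "m \<le> t" "Suc i \<in> T (Suc r, t)" "i \<notin> T (Suc r, t)"
            using x xt by (auto simp: only_def)
          have "c < t" using A[of t] Am t by (cases "t = m"; cases "c < t") (auto simp: only_def)
          then have kt: "k < t" using no_mid[of t] t ik by (cases t k rule: linorder_cases) auto
          have "Suc i \<notin> T (Suc r, k)"
            using row[of c k t i "Suc r" "Suc i" "Suc i"] ic t ck kt by auto
          moreover from this have "k < k'" using k' by (cases "k = k'") auto
          moreover have "t = k'"
            using row[of c t k' i "Suc r" "Suc i" "Suc i"] row[of c k' t i "Suc r" "Suc i" "Suc i"]
              ic t k' ck kt by (cases t k' rule: linorder_cases) auto
          ultimately show ?thesis using xt True by (auto simp: E_def)
        next
          case False
          then show ?thesis using x xt Brow[of t] by auto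
        qed
      qed
      have "card (Pair r ` {m..<c} \<union> Pair (Suc r) ` E) \<le> (c - m) + card E"
        by (rule order_trans[OF card_Un_le]) (simp add: card_image inj_on_def)
      also have "\<dots> < card ({m..c} \<union> F)"
        using ck mc by (auto simp: E_def F_def card_insert_if Suc_diff_le)
      also have "\<dots> = card (Pair (Suc r) ` ({m..c} \<union> F))"
        by (simp add: card_image inj_on_def)
      finally show "card (Pair r ` {m..<c} \<union> Pair (Suc r) ` E) < card (Pair (Suc r) ` ({m..c} \<union> F))" .
    qed (auto simp: E_def)
  qed
qed

lemma no_pattern_raised: "no_pattern (T((r, c) := insert i (T (r, c))))"
proof (rule no_pattern_insert_lower[OF T b])
  fix k y assume "c < k" "i \<in> T (Suc r, k)" "y \<in> T (Suc r, c)" "i \<le> y"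
  then show False using no_left_x_gt[of k y] no_left_x_eq[of k] by (cases "y = i") auto
qed (rule no_row1 no_row3 no_diag no_left_z no_right_x no_right_z; assumption)+

end

text \<open>The box where \<open>f'\<close> adds \<open>i + 1\<close>, seen from the other end of
  the word: between \<open>(r, c)\<close> and any later \<open>i\<close> there is an
  \<open>i + 1\<close>, and in each stretch ending just before \<open>(r, c)\<close> the boxes with
  only \<open>i + 1\<close> do not outnumber those with only \<open>i\<close>. The patterns are not
  symmetric under this reversal, so the hard cases are different ones.\<close>

locale lowering = filling +
  fixes i r c :: nat
  assumes b: "i \<in> T (r, c)" and b': "Suc i \<notin> T (r, c)"
    and succ: "\<And>y. before (r, c) y \<Longrightarrow> i \<in> T y \<Longrightarrow>
      \<exists>t. before (r, c) t \<and> before t y \<and> Suc i \<in> T t"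
    and count: "\<And>x. before x (r, c) \<Longrightarrow>
      card {t \<in> SD la. (t = x \<or> before x t) \<and> before t (r, c) \<and> only T (Suc i) i t}
      \<le> card {t \<in> SD la. (t = x \<or> before x t) \<and> before t (r, c) \<and> only T i (Suc i) t}"
begin

lemma partner:
  assumes "before x (r, c)" "only T (Suc i) i x"
  obtains t where "before x t" "before t (r, c)" "i \<in> T t"
proof -
  let ?A = "{t \<in> SD la. (t = x \<or> before x t) \<and> before t (r, c) \<and> only T i (Suc i) t}"
  let ?B = "{t \<in> SD la. (t = x \<or> before x t) \<and> before t (r, c) \<and> only T (Suc i) i t}"
  have "x \<in> ?B" using assms in_SD[of "Suc i" x] by (simp add: only_def)
  then have "?B \<noteq> {}" by blast
  moreover have "finite ?B" by (rule finite_subset[OF _ finite_SD[of la]]) blast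
  ultimately have "0 < card ?B" by (simp add: card_gt_0_iff)
  then have "0 < card ?A" using count[OF assms(1)] by linarith
  then obtain t where "t \<in> ?A" by (metis (no_types, lifting) card_gt_0_iff ex_in_conv)
  moreover from this have "t \<noteq> x" using assms(2) by (auto simp: only_def)
  ultimately show ?thesis by (intro that[of t]) (auto simp: only_def)
qed

lemma no_row2:
  assumes "p < c" "c < s" "i \<in> T (r, p)" "z \<in> T (r, s)" "z \<le> Suc i"
  shows False
proof -
  have "\<exists>t. before (r, c) t \<and> before t (r, p) \<and> Suc i \<in> T t"
    using assms by (intro succ) auto
  then obtain t where t: "before (r, c) t" "before t (r, p)" "Suc i \<in> T t" by blast
  then obtain t' where "t = (r, t')" "p < t'" "t' < c" by (cases t) auto
  then show False using row[of p t' s i r "Suc i" z] t assms by auto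
qed

lemma no_row2':
  assumes "p < c" "c < s" "w \<in> T (r, p)" "w < i" "Suc i \<in> T (r, s)"
  shows False
proof -
  have "i \<notin> T (r, s)" using row[of p c s w r i i] assms b by auto
  then obtain t where t: "before (r, s) t" "before t (r, c)" "i \<in> T t"
    using partner[of "(r, s)"] assms by (auto simp: only_def)
  then obtain t' where "t = (r, t')" "c < t'" "t' < s" by (cases t) auto
  then show False using row[of p c t' w r i i] t assms b by auto
qed

text \<open>The \<open>i + 1\<close> given by \<open>succ\<close> lies left of \<open>c\<close> in
  row \<open>r\<close>, an old pattern at once, or right of \<open>k\<close> in row
  \<open>Suc r\<close>. Then the entry above it must exceed \<open>y\<close> by the row condition
  and must not by the condition on two rows.\<close>

lemma no_right_x:
  assumes "c < k" "i \<in> T (Suc r, k)" "y \<in> T (r, k)" "Suc i < y"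
  shows False
proof -
  have "\<exists>t. before (r, c) t \<and> before t (Suc r, k) \<and> Suc i \<in> T t"
    using assms by (intro succ) auto
  then obtain t where t: "before (r, c) t" "before t (Suc r, k)" "Suc i \<in> T t" by blast
  obtain r1 t' where tt: "t = (r1, t')" by (cases t)
  consider "r1 = r" "t' < c" | "r1 = Suc r" "k < t'" using t tt by force
  then show False
  proof cases
    case 1
    then show False using right[of t' k "Suc i" r y i] t tt assms by auto
  next
    case 2
    then obtain y' where y': "y' \<in> T (r, t')"
      using elem_above[of "Suc i" r t' i c] t tt b by auto
    then have "y < y'" using row[of c k t' i r y y'] assms 2 b by auto
    then show False using right[of k t' y r y' "Suc i"] y' t tt 2 assms by auto
  qed
qed

lemma no_right_y:
  assumes "j < c" "i \<in> T (r, j)" "z \<in> T (Suc r, c)" "z < i"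
  shows False
proof -
  have "\<exists>t. before (r, c) t \<and> before t (r, j) \<and> Suc i \<in> T t"
    using assms by (intro succ) auto
  then obtain t where t: "before (r, c) t" "before t (r, j)" "Suc i \<in> T t" by blast
  then obtain t' where "t = (r, t')" "j < t'" "t' < c" by (cases t) auto
  then show False using row[of j t' c i r "Suc i" i] t assms b by auto
qed

text \<open>Apply \<open>count\<close> to the stretch starting at \<open>(r', m)\<close>: row
  \<open>r'\<close> contributes no \<open>i\<close> from there on, so all its boxes with only
  \<open>i\<close> lie in row \<open>r\<close> right of \<open>c\<close>.\<close>

lemma count_columns:
  assumes r: "r = Suc r'"
    and M: "\<And>t. t \<in> M \<Longrightarrow> t \<le> m \<and> only T (Suc i) i (r', t)" and m: "m \<in> M"
    and noA: "\<And>t. t \<le> m \<Longrightarrow> i \<notin> T (r', t)"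
    and E: "\<And>t. t \<in> E \<Longrightarrow> c < t \<and> only T (Suc i) i (r, t)"
  shows "card M + card E \<le> card {t. c < t \<and> only T i (Suc i) (r, t)}" (is "_ \<le> card ?S")
proof -
  let ?x = "(r', m)"
  let ?A = "{t \<in> SD la. (t = ?x \<or> before ?x t) \<and> before t (r, c) \<and> only T i (Suc i) t}"
  let ?B = "{t \<in> SD la. (t = ?x \<or> before ?x t) \<and> before t (r, c) \<and> only T (Suc i) i t}"
  have fin: "finite {x \<in> SD la. P x}" for P by (rule finite_subset[OF _ finite_SD[of la]]) blast
  have A: "?A \<subseteq> Pair r ` ?S"
  proof
    fix x assume "x \<in> ?A"
    then show "x \<in> Pair r ` ?S" using noA r by (cases x) (auto simp: only_def)
  qed
  have B: "Pair r' ` M \<union> Pair r ` E \<subseteq> ?B"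
  proof
    fix x assume x: "x \<in> Pair r' ` M \<union> Pair r ` E"
    then have "only T (Suc i) i x" using M E by auto
    moreover from this have "x \<in> SD la" using in_SD[of "Suc i" x] by (simp add: only_def)
    moreover have "x = ?x \<or> before ?x x" "before x (r, c)"
      using x M E r by (fastforce simp: le_less)+
    ultimately show "x \<in> ?B" by simp
  qed
  have finU: "finite (Pair r' ` M \<union> Pair r ` E)" using B fin by (rule finite_subset)
  then have finM: "finite M" and finE: "finite E"
    by (auto dest!: finite_imageD simp: inj_on_def)
  have "Pair r ` ?S \<subseteq> SD la" using in_SD by (auto simp: only_def)
  then have "finite (Pair r ` ?S)" using finite_SD by (rule finite_subset)
  then have finS: "finite ?S" by (auto dest!: finite_imageD simp: inj_on_def)
  have "card M + card E = card (Pair r' ` M \<union> Pair r ` E)"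
    using r finM finE by (subst card_Un_disjoint) (auto simp: card_image inj_on_def)
  also have "\<dots> \<le> card ?B" using B fin by (intro card_mono) auto
  also have "\<dots> \<le> card ?A" using r by (intro count) auto
  also have "\<dots> \<le> card (Pair r ` ?S)" using A finS by (intro card_mono) auto
  also have "\<dots> \<le> card ?S" using finS by (rule card_image_le)
  finally show ?thesis .
qed

text \<open>The common core of three critical cases. Let \<open>S\<close> be the columns right of
  \<open>c\<close> where row \<open>r\<close> has only \<open>i\<close>. Above \<open>c\<close> and
  above every column of \<open>S\<close> but the last, as far as they lie right of \<open>j\<close>,
  row \<open>r'\<close> is forced to have only \<open>i + 1\<close>; together with column
  \<open>j\<close> these are too many when \<open>j < c\<close>. When \<open>j = c\<close> one more
  \<open>i + 1\<close> is needed. The column \<open>z\<close> of \<open>right_end\<close> provides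
  it, either by itself or by forcing \<open>i + 1\<close> above the last column of \<open>S\<close>
  as well.\<close>

lemma no_configuration:
  assumes r: "r = Suc r'" and j: "Suc i \<in> T (r', j)" "j \<le> c"
    and noA: "\<And>t. t \<le> j \<Longrightarrow> i \<notin> T (r', t)"
    and right_end: "j = c \<Longrightarrow> \<exists>z>c. Suc i \<in> T (r, z)"
  shows False
proof -
  define S where "S = {t. c < t \<and> only T i (Suc i) (r, t)}"
  have "Pair r ` S \<subseteq> SD la" using in_SD by (auto simp: only_def S_def)
  then have "finite (Pair r ` S)" using finite_SD by (rule finite_subset)
  then have finS: "finite S" by (auto dest!: finite_imageD simp: inj_on_def)
  have iS: "i \<in> T (r, t)" if "t \<in> insert c S" for t using that b by (auto simp: S_def only_def)
  have cS: "c \<notin> S" "\<And>t. t \<in> S \<Longrightarrow> c < t" by (auto simp: S_def)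
  have jr: "r' \<le> j" using col_ge[OF j(1)] .
  have Bj: "only T (Suc i) i (r', j)" using j noA by (auto simp: only_def)
  note count' = count_columns[OF r, folded S_def]
  \<comment> \<open>The entry above such an \<open>i\<close> is at most \<open>Suc i\<close> because
    of \<open>(r', j)\<close>, and exceeds \<open>i\<close> because another \<open>i\<close> follows
    in row \<open>r\<close>.\<close>
  have col: "only T (Suc i) i (r', t)"
    if t: "t \<in> insert c S" and "j < t" and t': "t < t'" "i \<in> T (r, t')" for t t'
  proof -
    obtain w where w: "w \<in> T (r', t)" using elem_above[of i r' t "Suc i" j] iS[OF t] j r by auto
    have "v = Suc i" if v: "v \<in> T (r', t)" for v
      using right[of j t "Suc i" r' v i] left[of t t' v r' i i] iS[OF t] v t' j r \<open>j < t\<close>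
      by (metis Suc_leI le_antisym less_irrefl lessI not_less)
    then show ?thesis using w unfolding only_def by (metis n_not_Suc_n)
  qed
  \<comment> \<open>Right of \<open>j\<close>, an \<open>i\<close> in row \<open>r'\<close> would
    have an entry \<open>w < i\<close> beneath it; then the equal entries \<open>i\<close> in
    columns \<open>m\<close> and \<open>s\<close> of row \<open>r\<close> violate the row
    condition.\<close>
  have none: "i \<notin> T (r', t)"
    if "t < m" "j < m" "i \<in> T (r, m)" "m < s" "i \<in> T (r, s)" for t m s
  proof (cases "t \<le> j")
    case False
    show ?thesis
    proof
      assume it: "i \<in> T (r', t)"
      have "r \<le> t" "t \<le> m" using that False jr r by auto
      then obtain w where w: "w \<in> T (r, t)" using elem_row[OF \<open>i \<in> T (r, m)\<close>] by blast
      have "w < i" using left[of t m i r' w i] it w that r by auto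
      then show False using row[of t m s w r i i] w that by auto
    qed
  qed (use noA in simp)
  show False
  proof (cases "S = {}")
    case True
    have "card {j} + card ({}::nat set) \<le> card S"
      by (rule count'[of _ j]) (use Bj noA in auto)
    then show False using True by simp
  next
    case False
    define ts where "ts = Max S"
    have ts: "ts \<in> S" "\<And>t. t \<in> S \<Longrightarrow> t \<le> ts" using False finS by (auto simp: ts_def)
    define M where "M = insert j (insert c S - {ts})"
    have finM: "finite M" using finS by (simp add: M_def)
    define m where "m = Max M"
    have m: "m \<in> M" "\<And>t. t \<in> M \<Longrightarrow> t \<le> m" using finM using Max_in[OF finM] Max_ge[OF finM] by (auto simp only: m_def M_def)
    have ltts: "t < ts" if "t \<in> insert c S - {ts}" for t using that ts cS by force
    have BM: "only T (Suc i) i (r', t)" if "t \<in> M" for t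
    proof (cases "t = j")
      case False
      then have "j < t" using that j(2) cS by (force simp: M_def)
      then show ?thesis using that False ltts[of t] iS[of ts] ts
        by (intro col[of t ts]) (auto simp: M_def)
    qed (use Bj in simp)
    have noM: "i \<notin> T (r', t)" if "t \<le> m" for t
    proof (cases "t = m")
      case True
      then show ?thesis using BM[OF m(1)] by (simp add: only_def)
    next
      case False
      show ?thesis
      proof (cases "m = j")
        case True
        then show ?thesis using that noA by simp
      next
        case mj: False
        then have "m \<in> insert c S - {ts}" using m(1) by (simp add: M_def)
        moreover have "j < m" using mj m(2)[of j] by (simp add: M_def)
        ultimately show ?thesis
          using none[of t m ts] ltts[of m] iS[of m] iS[of ts] ts that False by auto
      qed
    qed
    show False
    proof (cases "j = c")
      case jc: False
      have "card M + card ({}::nat set) \<le> card S"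
        by (rule count'[of _ m]) (use m BM noM in auto)
      moreover have "card M = Suc (card S)"
        using jc j(2) cS(1) cS(2)[of j] ts finS unfolding M_def
        by (subst card_insert_disjoint) (auto simp: card_Diff_singleton)
      ultimately show False by simp
    next
      case jc: True
      obtain z where z: "c < z" "Suc i \<in> T (r, z)" using right_end[OF jc] by blast
      show False
      proof (cases "i \<in> T (r, z)")
        case False
        have "card M + card {z} \<le> card S"
          by (rule count'[of _ m]) (use m BM noM z False in \<open>auto simp: only_def\<close>)
        moreover have "card M = card S"
          using jc cS ts finS unfolding M_def
          by (subst insert_absorb) (auto simp: card_Diff_singleton)
        ultimately show False by simp
      next
        case iz: True
        \<comment> \<open>After \<open>i\<close> in column \<open>c\<close> and \<open>i + 1\<close>
          in column \<open>z\<close>, row \<open>r\<close> continues above \<open>i + 1\<close>, so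
          \<open>S\<close> lies left of \<open>z\<close>. Hence even the last column of
          \<open>S\<close> has an \<open>i\<close> to its right.\<close>
        have tz: "t < z" if "t \<in> S" for t
        proof (rule ccontr)
          assume "\<not> t < z"
          moreover have "t \<noteq> z" using that z by (auto simp: S_def only_def)
          ultimately show False
            using row[of c z t i r "Suc i" i] b z iS[of t] that by auto
        qed
        have "card (insert j S) + card ({}::nat set) \<le> card S"
        proof (rule count'[of _ ts])
          fix t assume "t \<in> insert j S"
          then show "t \<le> ts \<and> only T (Suc i) i (r', t)"
            using ts cS jc Bj col[of t z] tz iz by (force intro: less_imp_le)
        next
          fix t assume "t \<le> ts"
          show "i \<notin> T (r', t)"
          proof (cases "t = ts")
            case True
            then show ?thesis using col[of ts z] tz[of ts] ts cS jc iz by (auto simp: only_def)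
          next
            case False
            then show ?thesis using none[of t ts z] \<open>t \<le> ts\<close> ts iS[of ts] tz cS jc iz by auto
          qed
        qed (use ts in auto)
        then show False using finS cS jc by simp
      qed
    qed
  qed
qed

text \<open>Take \<open>j = r'\<close> in \<open>no_configuration\<close>: the only box of row
  \<open>r'\<close> up to there is the diagonal one, and its entries exceed the \<open>i\<close> of
  the next row.\<close>

lemma no_diag:
  assumes r: "r = Suc r'" and "Suc i \<in> T (r', r')"
  shows False
proof (rule no_configuration[OF r assms(2)])
  show "r' \<le> c" using col_ge[OF b] r by simp
  show "i \<notin> T (r', t)" if "t \<le> r'" for t
  proof
    assume it: "i \<in> T (r', t)"
    then have "t = r'" using that col_ge[OF it] by simp
    then show False using diagonal[of i r' i c] it b r by auto
  qed
qed (use col_ge[OF b] r in auto)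

text \<open>An \<open>i\<close> in row \<open>r'\<close> at \<open>j\<close> or further left would,
  through the entry beneath it, give an old pattern with \<open>y\<close> and the \<open>i\<close>
  of \<open>(r, c)\<close>; so \<open>no_configuration\<close> applies.\<close>

lemma no_left_z:
  assumes r: "r = Suc r'" and j: "j < c" "Suc i \<in> T (r', j)" and y: "y \<in> T (r, j)" "Suc i \<le> y"
  shows False
proof (rule no_configuration[OF r j(2)])
  show "i \<notin> T (r', t)" if "t \<le> j" for t
  proof
    assume it: "i \<in> T (r', t)"
    show False
    proof (cases "t = j")
      case True
      then show False using left[of j c i r' y i] it y j b r by auto
    next
      case False
      then have tj: "t < j" using that by simp
      have "t \<noteq> r'" using diagonal[of i r' y j] it y r by auto
      then have "r \<le> t" using col_ge[OF it] r by simp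
      then obtain w where w: "w \<in> T (r, t)" using elem_row[OF y(1), of t] tj by auto
      have "w < y" using left[of t j i r' w y] it w y tj r by auto
      then show False using row[of t j c w r y i] w y b tj j by auto
    qed
  qed
qed (use j in auto)

text \<open>By \<open>partner\<close>, an \<open>i\<close> occurs in row \<open>r\<close> right of
  \<open>c\<close> and not beyond \<open>k\<close>. It forces the entries of \<open>(r', c)\<close>
  above \<open>i\<close>, so \<open>x\<close> is \<open>Suc i\<close> and
  \<open>no_configuration\<close> applies with \<open>j = c\<close>.\<close>

lemma no_left_y:
  assumes r: "r = Suc r'" and k: "c < k" "Suc i \<in> T (r, k)" and x: "x \<in> T (r', c)" "x \<le> Suc i"
  shows False
proof -
  have gap: "i \<in> T (r, k) \<or> (\<exists>t. c < t \<and> t < k \<and> i \<in> T (r, t))"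
  proof (cases "i \<in> T (r, k)")
    case False
    then obtain t where t: "before (r, k) t" "before t (r, c)" "i \<in> T t"
      using partner[of "(r, k)"] k by (auto simp: only_def)
    then show ?thesis by (cases t) auto
  qed simp
  have gt: "i < v" if "v \<in> T (r', c)" for v
  proof (rule ccontr)
    assume "\<not> i < v"
    then show False using gap left[of c k v r' i i] left[of c _ v r' i i] that b k r by auto
  qed
  then have "x = Suc i" using x by force
  show False
  proof (rule no_configuration[OF r x(1)[unfolded \<open>x = Suc i\<close>]])
    show "i \<notin> T (r', t)" if "t \<le> c" for t
    proof
      assume it: "i \<in> T (r', t)"
      have tc: "t < c" using gt[of i] it that by (cases "t = c") auto
      have "t \<noteq> r'" using diagonal[of i r' "Suc i" k] it k r by auto
      then have "r \<le> t" using col_ge[OF it] r by simp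
      then obtain w where w: "w \<in> T (r, t)" using elem_row[OF b, of t] tc by auto
      have "w < i" using left[of t c i r' w i] it w b tc r by auto
      then show False using gap row[of t c k w r i i] row[of t c _ w r i i] w b tc k by auto
    qed
  qed (use k in auto)
qed

lemma no_pattern_lowered: "no_pattern (T((r, c) := insert (Suc i) (T (r, c))))"
proof (rule no_pattern_insert_upper[OF T b])
qed (rule no_row2 no_row2' no_diag no_left_y no_left_z no_right_x no_right_y; assumption)+

end

section \<open>Linked words as concatenations of forms\<close>

lemma matchedD:
  assumes "matched w p q"
  shows matched_less: "p < q" and matched_bound: "q < length w"
    and matched_Open: "w ! p = Open" and matched_Close: "w ! q = Close"
  using assms by (auto elim: matched.cases)

lemma matched_inside:
  assumes "matched w p q" "p < k" "k < q"
  shows "w ! k = Dash \<or> (\<exists>l. p < l \<and> l < q \<and> (matched w k l \<or> matched w l k))"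
  using assms by (auto elim: matched.cases)

text \<open>The rule for \<open>matched\<close> inspects only positions between the two ends, so a
  match survives in every larger word.\<close>

lemma matched_shift:
  "matched v p q \<Longrightarrow> matched (a @ v @ b) (length a + p) (length a + q)"
proof (induction rule: matched.induct)
  case (1 p q)
  show ?case
  proof (rule matched.intros)
    fix k assume k: "length a + p < k" "k < length a + q"
    then obtain k' where k': "k = length a + k'" by (metis less_imp_add_positive add.assoc)
    with k have "p < k'" "k' < q" by auto
    from 1(5)[OF this]
    show "(a @ v @ b) ! k = Dash \<or> (\<exists>l>length a + p. l < length a + q \<and>
        (matched (a @ v @ b) k l \<or> matched (a @ v @ b) l k))"
    proof (elim disjE exE conjE)
      assume "v ! k' = Dash"
      then show ?thesis using k' \<open>k' < q\<close> 1 by (simp add: nth_append)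
    next
      fix l assume "p < l" "l < q" "matched (a @ v @ b) (length a + k') (length a + l)"
      then show ?thesis using k' by (intro disjI2 exI[of _ "length a + l"]) auto
    next
      fix l assume "p < l" "l < q" "matched (a @ v @ b) (length a + l) (length a + k')"
      then show ?thesis using k' by (intro disjI2 exI[of _ "length a + l"]) auto
    qed
  qed (use 1 in \<open>auto simp: nth_append\<close>)
qed

text \<open>If \<open>p\<close> had partners \<open>q < q'\<close>, then \<open>q\<close> would have
  a partner \<open>l\<close> strictly between \<open>p\<close> and \<open>q'\<close>. As
  \<open>l < q\<close> lies inside the first pair, it also has a partner \<open>l' < q\<close>. Thus
  \<open>l\<close>, which is nearer to the end of the word than \<open>p\<close>, has two partners,
  and induction applies.\<close>

lemma matched_Open_unique:
  assumes "matched w p q" "matched w p q'"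
  shows "q = q'"
proof -
  have "False" if "matched w p q" "matched w p q'" "q < q'" for p q q'
    using that
  proof (induction "length w - p" arbitrary: p q q' rule: less_induct)
    case less
    have q: "p < q" "q < length w" "w ! q = Close" using less.prems matchedD by blast+
    then obtain l where l: "p < l" "l < q'" "matched w q l \<or> matched w l q"
      using matched_inside[OF less.prems(2), of q] less.prems(3) by auto
    then have lq: "matched w l q" using matched_Open[of w q l] q by auto
    then have "w ! l = Open" "l < q" using matchedD by blast+
    then obtain l' where l': "l' < q" "matched w l l' \<or> matched w l' l"
      using matched_inside[OF less.prems(1), of l] l by auto
    then have "matched w l l'" using matched_Close[of w l' l] \<open>w ! l = Open\<close> by auto
    moreover have "length w - l < length w - p" using l(1) \<open>l < q\<close> q(2) by linarith
    ultimately show False using less.hyps[of l l' q] lq l'(1) by blast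
  qed
  then show ?thesis using assms by (cases q q' rule: linorder_cases) blast+
qed

lemma matched_Close_unique:
  assumes "matched w p q" "matched w p' q"
  shows "p = p'"
proof -
  have "False" if m: "matched w p q" "matched w p' q" "p < p'" for p p'
  proof -
    have "p' < q" "w ! p' = Open" using matchedD[OF m(2)] by auto
    then obtain l where l: "l < q" "matched w p' l \<or> matched w l p'"
      using matched_inside[OF m(1), of p'] m(3) by auto
    then have "matched w p' l" using matched_Close[of w l p'] \<open>w ! p' = Open\<close> by auto
    then show False using matched_Open_unique[OF m(2)] l by auto
  qed
  then show ?thesis using assms by (cases p p' rule: linorder_cases) blast+
qed

lemma directly_linked_sym: "directly_linked w p q \<Longrightarrow> directly_linked w q p"
  unfolding directly_linked_def by blast

lemma directly_linked_shift:
  assumes "directly_linked v p q"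
  shows "directly_linked (a @ v @ b) (length a + p) (length a + q)"
  using assms unfolding directly_linked_def
proof (elim disjE exE conjE)
  fix s t assume "matched v s t" "p \<in> {s..t}" "q \<in> {s..t}"
  then show "(\<exists>s t. matched (a @ v @ b) s t \<and> length a + p \<in> {s..t} \<and> length a + q \<in> {s..t}) \<or>
    (\<exists>k. k + 2 < length (a @ v @ b) \<and> (a @ v @ b) ! (k + 1) = Dash \<and>
      length a + p \<in> {k..k + 2} \<and> length a + q \<in> {k..k + 2})"
    using matched_shift[of v s t a b]
    by (intro disjI1 exI[of _ "length a + s"] exI[of _ "length a + t"]) auto
next
  fix k assume "k + 2 < length v" "v ! (k + 1) = Dash" "p \<in> {k..k + 2}" "q \<in> {k..k + 2}"
  then show "(\<exists>s t. matched (a @ v @ b) s t \<and> length a + p \<in> {s..t} \<and> length a + q \<in> {s..t}) \<or>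
    (\<exists>k. k + 2 < length (a @ v @ b) \<and> (a @ v @ b) ! (k + 1) = Dash \<and>
      length a + p \<in> {k..k + 2} \<and> length a + q \<in> {k..k + 2})"
    by (intro disjI2 exI[of _ "length a + k"]) (auto simp: nth_append)
qed

lemma linked_shift:
  assumes "equivclp (directly_linked v) p q"
  shows "equivclp (directly_linked (a @ v @ b)) (length a + p) (length a + q)"
  using assms
proof (induction rule: equivclp_induct)
  case (step y z)
  then show ?case
    by (meson directly_linked_shift equivclp_into_equivclp directly_linked_sym)
qed simp

section \<open>Words that consist of a single form\<close>

definition all_matched :: "symb list \<Rightarrow> bool" where
  "all_matched g \<longleftrightarrow> (\<forall>p<length g. g ! p \<noteq> Dash \<longrightarrow> (\<exists>q. matched g p q \<or> matched g q p))"

text \<open>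
  The word of a single form; \<open>a\<close> tells whether it starts with an unmatched ")", and \<open>b\<close> whether
  it ends with an unmatched "(".
\<close>

definition form_word :: "bool \<Rightarrow> bool \<Rightarrow> symb list \<Rightarrow> bool" where
  "form_word a b g \<longleftrightarrow> g \<noteq> [] \<and>
     hd g = (if a then Close else Open) \<and> last g = (if b then Open else Close) \<and>
     (\<forall>p<length g. g ! p \<noteq> Dash \<longrightarrow>
        a \<and> p = 0 \<or> b \<and> Suc p = length g \<or> (\<exists>q. matched g p q \<or> matched g q p)) \<and>
     (\<forall>p<length g. \<forall>q<length g. equivclp (directly_linked g) p q)"

lemma form_word_Close: "form_word True False [Close]"
  and form_word_Open: "form_word False True [Open]"
  by (auto simp: form_word_def)

text \<open>The link ties the last ")" of \<open>g\<close> to the first "(" of \<open>g'\<close>, so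
  any two positions are equivalent by way of the link symbol, which stands at position
  \<open>length g\<close>.\<close>

lemma form_word_join:
  assumes g: "form_word a False g" and g': "form_word False b g'"
  shows "form_word a b (g @ Dash # g')" (is "form_word a b ?w")
proof -
  let ?n = "length g"
  have ne: "g \<noteq> []" "g' \<noteq> []" using g g' by (auto simp: form_word_def)
  have left: "equivclp (directly_linked ?w) p q" if "p < ?n" "q < ?n" for p q
    using that g linked_shift[of g p q "[]" "Dash # g'"] by (auto simp: form_word_def)
  have right: "equivclp (directly_linked ?w) (Suc (?n + p)) (Suc (?n + q))"
    if "p < length g'" "q < length g'" for p q
    using that g' linked_shift[of g' p q "g @ [Dash]" "[]"] by (auto simp: form_word_def)
  have mid: "directly_linked ?w p q" if "p \<in> {?n - 1..?n + 1}" "q \<in> {?n - 1..?n + 1}" for p q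
    unfolding directly_linked_def using that ne
    by (intro disjI2 exI[of _ "?n - 1"]) (auto simp: nth_append Suc_diff_le Suc_le_eq)
  have to: "equivclp (directly_linked ?w) ?n p" if p: "p < length ?w" for p
  proof -
    have l: "equivclp (directly_linked ?w) ?n (?n - 1)"
      by (rule r_into_equivclp, rule mid) auto
    have r: "equivclp (directly_linked ?w) ?n (Suc ?n)"
      by (rule r_into_equivclp, rule mid) auto
    show ?thesis
    proof (cases p ?n rule: linorder_cases)
      case less
      then show ?thesis using left[of "?n - 1" p] equivclp_trans[OF l] by simp
    next
      case greater
      then have "p = Suc (?n + (p - Suc ?n))" "p - Suc ?n < length g'" using p by auto
      then show ?thesis using right[of 0 "p - Suc ?n"] equivclp_trans[OF r, of p] ne by simp
    qed simp
  qed
  have m: "\<exists>q. matched ?w p q \<or> matched ?w q p"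
    if "p < length ?w" "?w ! p \<noteq> Dash" "\<not> (a \<and> p = 0)" "\<not> (b \<and> Suc p = length ?w)" for p
  proof (cases "p < ?n")
    case True
    then have "\<exists>q. matched g p q \<or> matched g q p"
      using g that ne by (auto simp: form_word_def nth_append)
    then obtain q where "matched g p q \<or> matched g q p" by blast
    then show ?thesis using matched_shift[of g _ _ "[]" "Dash # g'"] by auto
  next
    case False
    with that(2) have "p \<noteq> ?n" by auto
    with False obtain p' where p': "p = Suc (?n + p')" by (metis less_imp_Suc_add linorder_neqE_nat)
    have "?w ! p = g' ! p'" "p' < length g'" using that(1) p' by (auto simp: nth_append)
    then have "\<exists>q. matched g' p' q \<or> matched g' q p'"
      using g' that p' by (auto simp: form_word_def)
    then obtain q where "matched g' p' q \<or> matched g' q p'" by blast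
    then show ?thesis using matched_shift[of g' _ _ "g @ [Dash]" "[]"] p' by auto
  qed
  show ?thesis unfolding form_word_def
  proof (intro conjI allI impI)
    fix p q assume "p < length ?w" "q < length ?w"
    then show "equivclp (directly_linked ?w) p q"
      using to[of p] to[of q] by (meson equivclp_sym equivclp_trans)
  qed (use g g' ne m in \<open>auto simp: form_word_def\<close>)
qed

lemma form_word_paren:
  assumes n: "all_matched n"
  shows "form_word False False (Open # n @ [Close])" (is "form_word _ _ ?w")
proof -
  let ?e = "Suc (length n)"
  have m: "\<exists>q. 0 < q \<and> q < ?e \<and> (matched ?w p q \<or> matched ?w q p)"
    if "0 < p" "p < ?e" "?w ! p \<noteq> Dash" for p
  proof -
    define p' where "p' = p - 1"
    have p': "p = Suc p'" "p' < length n" using that by (auto simp: p'_def)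
    have "?w ! p = n ! p'" using p' by (simp add: nth_append)
    then have "\<exists>q. matched n p' q \<or> matched n q p'"
      using n that p' by (auto simp: all_matched_def)
    then obtain q where "matched n p' q \<or> matched n q p'" by blast
    then show ?thesis
      using matched_shift[of n p' q "[Open]" "[Close]"] matched_shift[of n q p' "[Open]" "[Close]"]
        matchedD[of n p' q] matchedD[of n q p'] p'
      by (intro exI[of _ "Suc q"]) auto
  qed
  have outer: "matched ?w 0 ?e"
  proof (rule matched.intros)
    fix k assume "0 < k" "k < ?e"
    then show "?w ! k = Dash \<or> (\<exists>l. 0 < l \<and> l < ?e \<and> (matched ?w k l \<or> matched ?w l k))"
      using m[of k] by blast
  qed (auto simp: nth_append)
  show ?thesis unfolding form_word_def
  proof (intro conjI allI impI)
    fix p assume "p < length ?w" "?w ! p \<noteq> Dash"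
    then show "False \<and> p = 0 \<or> False \<and> Suc p = length ?w \<or> (\<exists>q. matched ?w p q \<or> matched ?w q p)"
      using m[of p] outer by (cases "p = 0"; cases "p = ?e") auto
  next
    fix p q assume "p < length ?w" "q < length ?w"
    then have "directly_linked ?w p q"
      unfolding directly_linked_def using outer by (intro disjI1 exI[of _ 0] exI[of _ ?e]) auto
    then show "equivclp (directly_linked ?w) p q" by (rule r_into_equivclp)
  qed auto
qed

lemma all_matched_Nil: "all_matched []"
  by (simp add: all_matched_def)

lemma all_matched_append:
  assumes "form_word False False g" "all_matched n"
  shows "all_matched (g @ n)"
  unfolding all_matched_def
proof (intro allI impI)
  fix p assume p: "p < length (g @ n)" "(g @ n) ! p \<noteq> Dash"
  show "\<exists>q. matched (g @ n) p q \<or> matched (g @ n) q p"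
  proof (cases "p < length g")
    case True
    then have "\<exists>q. matched g p q \<or> matched g q p"
      using assms(1) p by (auto simp: form_word_def nth_append)
    then obtain q where "matched g p q \<or> matched g q p" by blast
    then show ?thesis using matched_shift[of g _ _ "[]" n] by auto
  next
    case False
    then obtain p' where p': "p = length g + p'" by (metis le_add_diff_inverse not_less)
    then obtain q where "matched n p' q \<or> matched n q p'"
      using assms(2) p by (auto simp: all_matched_def nth_append)
    then show ?thesis using matched_shift[of n _ _ g "[]"] p' by auto
  qed
qed

text \<open>Each word is listed with its type; \<open>order\<close> says that no unmatched "(" of
  one word could meet an unmatched ")" of a later one. Under these conditions the words turn out to
  be exactly the classes of their concatenation.\<close>

locale form_decomposition =
  fixes bs :: "((bool \<times> bool) \<times> symb list) list"
  assumes form_words: "\<And>x. x \<in> set bs \<Longrightarrow> form_word (fst (fst x)) (snd (fst x)) (snd x)"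
    and order: "sorted_wrt (\<lambda>x y. \<not> (snd (fst x) \<and> fst (fst y))) bs"
begin

abbreviation "w \<equiv> concat (map snd bs)"
abbreviation "N \<equiv> length bs"

definition off :: "nat \<Rightarrow> nat" where
  "off j = length (concat (map snd (take j bs)))"

definition starts :: "nat \<Rightarrow> bool" where "starts j = fst (fst (bs ! j))"
definition ends :: "nat \<Rightarrow> bool" where "ends j = snd (fst (bs ! j))"
definition word :: "nat \<Rightarrow> symb list" where "word j = snd (bs ! j)"
definition block :: "nat \<Rightarrow> nat set" where "block j = {off j..<off (Suc j)}"

lemma form_word: "j < N \<Longrightarrow> form_word (starts j) (ends j) (word j)"
  unfolding starts_def ends_def word_def by (rule form_words) simp

lemma not_ends_starts: "j < k \<Longrightarrow> k < N \<Longrightarrow> ends j \<Longrightarrow> \<not> starts k"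
  using order unfolding sorted_wrt_iff_nth_less starts_def ends_def by auto

lemma off_Suc: "j < N \<Longrightarrow> off (Suc j) = off j + length (word j)"
  by (simp add: off_def word_def take_Suc_conv_app_nth)

lemma word_ne: "j < N \<Longrightarrow> word j \<noteq> []"
  using form_word by (simp add: form_word_def)

lemma off_less_Suc: "j < N \<Longrightarrow> off j < off (Suc j)"
  using off_Suc word_ne by simp

lemma off_mono: "j \<le> k \<Longrightarrow> off j \<le> off k"
  unfolding off_def by (metis concat_append le_Suc_ex length_append map_append take_add le_add1)

lemma off_N: "off N = length w"
  by (simp add: off_def)

lemma w_split: "j < N \<Longrightarrow>
    w = concat (map snd (take j bs)) @ word j @ concat (map snd (drop (Suc j) bs))"
  by (subst id_take_nth_drop[of j bs]) (auto simp: word_def)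

lemma w_nth: "j < N \<Longrightarrow> s < length (word j) \<Longrightarrow> w ! (off j + s) = word j ! s"
  by (subst w_split) (auto simp: off_def nth_append)

lemma matched_word:
  "j < N \<Longrightarrow> matched (word j) s t \<Longrightarrow> matched w (off j + s) (off j + t)"
  by (subst w_split) (auto simp: off_def intro: matched_shift)

lemma block_exists:
  assumes "p < length w"
  obtains j s where "j < N" "p = off j + s" "s < length (word j)"
proof -
  have "p < off k \<Longrightarrow> \<exists>j<k. off j \<le> p \<and> p < off (Suc j)" if "k \<le> N" for k
    using that
  proof (induction k)
    case (Suc k)
    then show ?case by (cases "p < off k") (auto simp: less_Suc_eq not_less)
  qed (simp add: off_def)
  from this[of N] assms obtain j where "j < N" "off j \<le> p" "p < off (Suc j)"
    by (auto simp: off_N)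
  then show ?thesis using that[of j "p - off j"] by (auto simp: off_Suc)
qed

lemma in_block: "j < N \<Longrightarrow> s < length (word j) \<Longrightarrow> off j + s \<in> block j"
  by (simp add: block_def off_Suc)

lemma block_unique:
  assumes "p \<in> block j" "p \<in> block k"
  shows "j = k"
proof (cases j k rule: linorder_cases)
  case less
  then show ?thesis using assms off_mono[of "Suc j" k] by (auto simp: block_def)
next
  case greater
  then show ?thesis using assms off_mono[of "Suc k" j] by (auto simp: block_def)
qed

lemma block_subset: "j < N \<Longrightarrow> block j \<subseteq> {..<length w}"
  using off_mono[of "Suc j" N] by (auto simp: block_def off_N)

lemma word_start: "j < N \<Longrightarrow> word j ! 0 = (if starts j then Close else Open)"
  using form_word[of j] hd_conv_nth[of "word j"] unfolding form_word_def by metis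

lemma word_end: "j < N \<Longrightarrow> word j ! (length (word j) - 1) = (if ends j then Open else Close)"
  using form_word[of j] last_conv_nth[of "word j"] unfolding form_word_def by metis

lemma matched_in_word:
  assumes "j < N" "s < length (word j)" "word j ! s \<noteq> Dash"
    and "\<not> (starts j \<and> s = 0)" "\<not> (ends j \<and> Suc s = length (word j))"
  shows "\<exists>x. matched (word j) s x \<or> matched (word j) x s"
  using form_word[OF assms(1)] assms(2-) unfolding form_word_def by blast

text \<open>Suppose a "(" of block \<open>j\<close> matches a ")" of a later block \<open>k\<close>.
  The "(" lacks a partner in its own block only if it is the final unmatched one, and then
  \<open>order\<close> guarantees the ")" a partner inside block \<open>k\<close>. Either way a
  parenthesis has two partners, against uniqueness.\<close>

lemma matched_same_block:
  assumes m: "matched w p q" and j: "j < N" "p \<in> block j"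
  shows "q \<in> block j"
proof -
  have pq: "p < q" "q < length w" "w ! p = Open" "w ! q = Close" using matchedD[OF m] by auto
  define s where "s = p - off j"
  have s: "p = off j + s" "s < length (word j)" using j by (auto simp: s_def block_def off_Suc)
  obtain k t where k: "k < N" "q = off k + t" "t < length (word k)"
    using block_exists[OF pq(2)] .
  have gs: "word j ! s = Open" "word k ! t = Close" using w_nth s j k pq by auto
  show ?thesis
  proof (cases "j = k")
    case True
    then show ?thesis using k in_block by simp
  next
    case False
    have "j < k"
    proof (rule ccontr)
      assume "\<not> j < k"
      then have "off (Suc k) \<le> off j" using False by (intro off_mono) auto
      then show False using k s pq off_Suc[of k] by auto
    qed
    have "ends j \<and> Suc s = length (word j) \<or> (\<exists>x. matched (word j) s x \<or> matched (word j) x s)"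
    proof (rule ccontr)
      assume no: "\<not> ?thesis"
      have "\<not> (starts j \<and> s = 0)" using gs(1) word_start[OF j(1)] by (cases "s = 0") auto
      moreover have "word j ! s \<noteq> Dash" using gs(1) by simp
      ultimately show False using matched_in_word[OF j(1) s(2)] no by blast
    qed
    then show ?thesis
    proof (elim disjE exE)
      assume "ends j \<and> Suc s = length (word j)"
      then have "\<not> starts k" using not_ends_starts[OF \<open>j < k\<close> k(1)] by simp
      moreover have "\<not> (ends k \<and> Suc t = length (word k))"
        using word_end[OF k(1)] gs by (metis diff_Suc_1 symb.distinct(1))
      ultimately have "\<exists>x. matched (word k) t x \<or> matched (word k) x t"
        using gs k by (intro matched_in_word) auto
      then obtain x where "matched (word k) t x \<or> matched (word k) x t" by blast
      then have "matched (word k) x t" using matchedD[of "word k" t x] gs by auto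
      then have "matched w (off k + x) q" using matched_word k by simp
      then have "p = off k + x" using m matched_Close_unique by blast
      then show ?thesis using j(2) \<open>j < k\<close> off_mono[of "Suc j" k] by (auto simp: block_def)
    next
      fix x assume x: "matched (word j) s x"
      then have "matched w p (off j + x)" using matched_word j s by simp
      then have "q = off j + x" using m matched_Open_unique by blast
      then show ?thesis using matched_bound[OF x] in_block j by simp
    next
      fix x assume "matched (word j) x s"
      then show ?thesis using matchedD[of "word j" x s] gs by auto
    qed
  qed
qed

lemma matched_same_block':
  assumes "matched w p q" "j < N" "q \<in> block j"
  shows "p \<in> block j"
proof -
  have "p < length w" using matchedD[OF assms(1)] by simp
  then obtain k s where "k < N" "p \<in> block k" using block_exists in_block by metis
  then show ?thesis using matched_same_block[OF assms(1)] block_unique assms(3) by blast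
qed

lemma directly_linked_same_block:
  assumes "directly_linked w p q" "j < N" "p \<in> block j"
  shows "q \<in> block j"
  using assms(1) unfolding directly_linked_def
proof (elim disjE exE conjE)
  fix s t assume m: "matched w s t" "p \<in> {s..t}" "q \<in> {s..t}"
  then have "s < length w" using matchedD[OF m(1)] by simp
  then obtain k u where k: "k < N" "s \<in> block k" using block_exists in_block by metis
  then have "t \<in> block k" using matched_same_block[OF m(1)] by blast
  then have "p \<in> block k" "q \<in> block k" using m k by (auto simp: block_def)
  then show ?thesis using block_unique assms(3) by blast
next
  fix k assume k: "k + 2 < length w" "w ! (k + 1) = Dash" "p \<in> {k..k + 2}" "q \<in> {k..k + 2}"
  obtain l s where l: "l < N" "k + 1 = off l + s" "s < length (word l)"
    using block_exists[of "k + 1"] k by auto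
  have "word l ! s = Dash" using w_nth[OF l(1,3)] k l by simp
  \<comment> \<open>The word of a form begins and ends with a parenthesis, so both neighbours of a
    link symbol lie in the same block.\<close>
  then have "s \<noteq> 0" "s \<noteq> length (word l) - 1"
    using word_start[OF l(1)] word_end[OF l(1)] by (metis symb.distinct(4,6) symb.distinct(3,5))+
  then have "p \<in> block l" "q \<in> block l"
    using k l off_Suc[OF l(1)] by (auto simp: block_def)
  then show ?thesis using block_unique assms(3) by blast
qed

lemma linked_iff_same_block:
  assumes "j < N" "p \<in> block j"
  shows "equivclp (directly_linked w) p q \<longleftrightarrow> q \<in> block j"
proof
  assume "equivclp (directly_linked w) p q"
  then show "q \<in> block j"
  proof (induction rule: equivclp_induct)
    case (step y z)
    then show ?case using directly_linked_same_block[OF _ assms(1)] directly_linked_sym by blast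
  qed (use assms in simp)
next
  assume "q \<in> block j"
  then have "equivclp (directly_linked (word j)) (p - off j) (q - off j)"
    using form_word[OF assms(1)] assms by (auto simp: form_word_def block_def off_Suc)
  from linked_shift[OF this, of "concat (map snd (take j bs))" "concat (map snd (drop (Suc j) bs))"]
  show "equivclp (directly_linked w) p q"
    using assms \<open>q \<in> block j\<close> w_split[OF assms(1)] by (auto simp: off_def[symmetric] block_def)
qed

lemma forms_eq: "forms w = block ` {..<N}"
proof -
  have cls: "{(x, y). equivclp (directly_linked w) x y} `` {p} = block j"
    if "j < N" "p \<in> block j" for j p
    using linked_iff_same_block[OF that] by auto
  show ?thesis unfolding forms_def quotient_def
  proof (intro equalityI subsetI)
    fix C assume "C \<in> (\<Union>x\<in>{..<length w}. {{(x, y). equivclp (directly_linked w) x y} `` {x}})"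
    then obtain p where p: "p < length w" "C = {(x, y). equivclp (directly_linked w) x y} `` {p}"
      by auto
    then obtain j s where "j < N" "p \<in> block j" using block_exists in_block by metis
    then show "C \<in> block ` {..<N}" using cls p by auto
  next
    fix C assume "C \<in> block ` {..<N}"
    then obtain j where j: "j < N" "C = block j" by auto
    then have "off j \<in> block j" using off_less_Suc by (simp add: block_def)
    then show "C \<in> (\<Union>x\<in>{..<length w}. {{(x, y). equivclp (directly_linked w) x y} `` {x}})"
      using cls[OF j(1)] j block_subset[OF j(1)] by (intro UN_I[of "off j"]) auto
  qed
qed

lemma Min_block: "j < N \<Longrightarrow> Min (block j) = off j"
  using off_less_Suc[of j] by (intro Min_eqI) (auto simp: block_def)

lemma Max_block: "j < N \<Longrightarrow> Max (block j) = off (Suc j) - 1"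
  using off_less_Suc[of j] by (intro Max_eqI) (auto simp: block_def)

lemma nth_Min: "j < N \<Longrightarrow> w ! Min (block j) = (if starts j then Close else Open)"
  using w_nth[of j 0] word_ne[of j] word_start[of j] by (simp add: Min_block)

lemma nth_Max: "j < N \<Longrightarrow> w ! Max (block j) = (if ends j then Open else Close)"
  using w_nth[of j "length (word j) - 1"] word_ne[of j] word_end[of j]
  by (cases "length (word j)") (auto simp: Max_block off_Suc)

lemma unmatched_Min: "j < N \<Longrightarrow> starts j \<Longrightarrow> unmatched w (Min (block j))"
proof -
  assume j: "j < N" "starts j"
  have b: "off j \<in> block j" using off_less_Suc[OF j(1)] by (simp add: block_def)
  have c: "w ! off j = Close" using nth_Min[OF j(1)] j by (simp add: Min_block)
  have "\<not> matched w (off j) q" for q using matched_Open[of w "off j" q] c by auto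
  moreover have "\<not> matched w q (off j)" for q
    using matched_same_block'[of q "off j" j] matched_less[of w q "off j"] j b
    by (auto simp: block_def)
  ultimately show "unmatched w (Min (block j))"
    using c b block_subset[OF j(1)] by (auto simp: unmatched_def Min_block j)
qed

lemma unmatched_Max: "j < N \<Longrightarrow> ends j \<Longrightarrow> unmatched w (Max (block j))"
proof -
  assume j: "j < N" "ends j"
  let ?m = "off (Suc j) - 1"
  have b: "?m \<in> block j" using off_less_Suc[OF j(1)] by (auto simp: block_def)
  have c: "w ! ?m = Open" using nth_Max[OF j(1)] j by (simp add: Max_block)
  have "\<not> matched w q ?m" for q using matched_Close[of w q ?m] c by auto
  moreover have "\<not> matched w ?m q" for q
    using matched_same_block[of ?m q j] matched_less[of w ?m q] j b
    by (auto simp: block_def)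
  ultimately show "unmatched w (Max (block j))"
    using c b block_subset[OF j(1)] by (auto simp: unmatched_def Max_block j)
qed

lemma unmatched_in_block:
  assumes "j < N" "p \<in> block j" "unmatched w p"
  shows "w ! p = Close \<and> starts j \<or> w ! p = Open \<and> ends j"
proof -
  define s where "s = p - off j"
  have s: "p = off j + s" "s < length (word j)" using assms by (auto simp: s_def block_def off_Suc)
  have "word j ! s \<noteq> Dash" using assms(3) w_nth[OF assms(1) s(2)] s by (auto simp: unmatched_def)
  moreover have "\<not> matched (word j) s q \<and> \<not> matched (word j) q s" for q
    using assms(3) matched_word[OF assms(1)] s by (auto simp: unmatched_def)
  ultimately have "starts j \<and> s = 0 \<or> ends j \<and> Suc s = length (word j)"
    using matched_in_word[OF assms(1) s(2)] by blast
  then show ?thesis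
    using w_nth[OF assms(1) s(2)] s(1) word_start[OF assms(1)] word_end[OF assms(1)]
    by (metis diff_Suc_1)
qed

lemma left_form_iff: "left_form w C \<longleftrightarrow> (\<exists>j<N. C = block j \<and> \<not> starts j \<and> ends j)"
proof
  assume "left_form w C"
  then obtain j where j: "j < N" "C = block j"
      and C: "\<not> (\<exists>p\<in>C. unmatched w p \<and> w ! p = Close)" "w ! Max C = Open"
    by (auto simp: left_form_def forms_eq)
  have "Min (block j) \<in> block j"
    using off_less_Suc[OF j(1)] unfolding Min_block[OF j(1)] by (simp add: block_def)
  then have "\<not> starts j" using C unmatched_Min[OF j(1)] nth_Min[OF j(1)] j by auto
  moreover have "ends j" using C nth_Max[OF j(1)] j by (auto split: if_splits)
  ultimately show "\<exists>j<N. C = block j \<and> \<not> starts j \<and> ends j" using j by blast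
next
  assume "\<exists>j<N. C = block j \<and> \<not> starts j \<and> ends j"
  then show "left_form w C"
    using unmatched_in_block unmatched_Max nth_Max by (fastforce simp: left_form_def forms_eq)
qed

lemma right_form_iff: "right_form w C \<longleftrightarrow> (\<exists>j<N. C = block j \<and> starts j \<and> \<not> ends j)"
proof
  assume "right_form w C"
  then obtain j where j: "j < N" "C = block j"
      and C: "\<not> (\<exists>p\<in>C. unmatched w p \<and> w ! p = Open)" "w ! Min C = Close"
    by (auto simp: right_form_def forms_eq)
  have "Max (block j) \<in> block j"
    using off_less_Suc[OF j(1)] unfolding Max_block[OF j(1)] by (auto simp: block_def)
  then have "\<not> ends j" using C unmatched_Max[OF j(1)] nth_Max[OF j(1)] j by auto
  moreover have "starts j" using C nth_Min[OF j(1)] j by (auto split: if_splits)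
  ultimately show "\<exists>j<N. C = block j \<and> starts j \<and> \<not> ends j" using j by blast
next
  assume "\<exists>j<N. C = block j \<and> starts j \<and> \<not> ends j"
  then show "right_form w C"
    using unmatched_in_block unmatched_Min nth_Min by (fastforce simp: right_form_def forms_eq)
qed

lemma combined_form_iff: "combined_form w C \<longleftrightarrow> (\<exists>j<N. C = block j \<and> starts j \<and> ends j)"
  unfolding combined_form_def forms_eq
  using unmatched_Max unmatched_Min nth_Max nth_Min by (auto split: if_splits)

text \<open>Of two combined forms the earlier would end with "(" and the later start with ")",
  against \<open>order\<close>.\<close>

lemma combined_unique: "j < N \<Longrightarrow> k < N \<Longrightarrow> starts j \<Longrightarrow> ends j \<Longrightarrow> starts k \<Longrightarrow> ends k \<Longrightarrow> j = k"
  using not_ends_starts by (metis linorder_neqE_nat)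

lemma first_left_start_eq:
  assumes "j < N" "\<not> starts j" "ends j" "\<And>k. k < j \<Longrightarrow> starts k \<or> \<not> ends k"
  shows "first_left_start w = off j"
proof -
  have "Min ` {C. left_form w C} = off ` {k. k < N \<and> \<not> starts k \<and> ends k}"
    by (force simp: left_form_iff Min_block)
  moreover have "Min (off ` {k. k < N \<and> \<not> starts k \<and> ends k}) = off j"
  proof (rule Min_eqI)
    fix y assume "y \<in> off ` {k. k < N \<and> \<not> starts k \<and> ends k}"
    then obtain k where "y = off k" "\<not> starts k" "ends k" by auto
    then show "off j \<le> y" using assms(4)[of k] off_mono[of j k] by (cases "k < j") auto
  qed (use assms in auto)
  ultimately show ?thesis by (simp add: first_left_start_def)
qed

lemma last_right_end_eq:
  assumes "j < N" "starts j" "\<not> ends j" "\<And>k. j < k \<Longrightarrow> k < N \<Longrightarrow> \<not> starts k \<or> ends k"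
  shows "last_right_end w = off (Suc j) - 1"
proof -
  have "Max ` {C. right_form w C} = (\<lambda>k. off (Suc k) - 1) ` {k. k < N \<and> starts k \<and> \<not> ends k}"
    by (force simp: right_form_iff Max_block)
  moreover have "Max ((\<lambda>k. off (Suc k) - 1) ` {k. k < N \<and> starts k \<and> \<not> ends k}) = off (Suc j) - 1"
  proof (rule Max_eqI)
    fix y assume "y \<in> (\<lambda>k. off (Suc k) - 1) ` {k. k < N \<and> starts k \<and> \<not> ends k}"
    then obtain k where "y = off (Suc k) - 1" "starts k" "\<not> ends k" "k < N" by auto
    then show "y \<le> off (Suc j) - 1"
      using assms(4)[of k] off_mono[of "Suc k" "Suc j"] by (cases "j < k") auto
  qed (use assms in auto)
  ultimately show ?thesis by (simp add: last_right_end_def)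
qed

end

section \<open>Words of boxes\<close>

text \<open>A box is recorded by whether it contributes ")" and whether it contributes "(".\<close>

definition kind :: "(box \<Rightarrow> nat set) \<Rightarrow> nat \<Rightarrow> box \<Rightarrow> bool \<times> bool" where
  "kind T i x = (i \<in> T x, Suc i \<in> T x)"

definition symbs :: "bool \<times> bool \<Rightarrow> symb list" where
  "symbs k = (if fst k then [Close] else []) @ (if fst k \<and> snd k then [Dash] else []) @
     (if snd k then [Open] else [])"

lemma symbs_simps [simp]:
  "symbs (True, True) = [Close, Dash, Open]" "symbs (True, False) = [Close]"
  "symbs (False, True) = [Open]" "symbs (False, False) = []"
  by (simp_all add: symbs_def)

abbreviation word_of :: "(bool \<times> bool) list \<Rightarrow> symb list" where
  "word_of ks \<equiv> concat (map symbs ks)"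

text \<open>
  \<open>inner\<close> collects the words that may stand between two matched parentheses; only there can a
  linked pair ")-(" be matched on both sides.
\<close>

inductive null_kinds :: "(bool \<times> bool) list \<Rightarrow> bool" and inner :: "(bool \<times> bool) list \<Rightarrow> bool" where
  null_Nil: "null_kinds []"
| null_Cons: "inner u \<Longrightarrow> null_kinds n \<Longrightarrow> null_kinds ((False, True) # u @ (True, False) # n)"
| inner_null: "null_kinds n \<Longrightarrow> inner n"
| inner_link: "null_kinds n \<Longrightarrow> inner u \<Longrightarrow> inner (n @ (True, True) # u)"

lemma null_kinds_append: "null_kinds m \<Longrightarrow> null_kinds n \<Longrightarrow> null_kinds (m @ n)"
  by (induction m rule: null_kinds_inner.inducts(1)[where ?P2.0 = "\<lambda>_. True"])
    (auto intro: null_kinds_inner.intros)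

lemma inner_append_link: "inner u \<Longrightarrow> null_kinds n \<Longrightarrow> inner (u @ (True, True) # n)"
  by (induction u rule: null_kinds_inner.inducts(2)[where ?P1.0 = "\<lambda>_. True"])
    (auto intro: null_kinds_inner.intros)

text \<open>A form of several boxes is a chain of matched pairs glued by linked boxes. Only an
  initial ")" in its first box and a final "(" in its last box can be unmatched; these are the flags
  \<open>a\<close> and \<open>b\<close>, and they are all that the operators change.\<close>

definition form_kinds :: "bool \<Rightarrow> bool \<Rightarrow> (bool \<times> bool) list \<Rightarrow> bool" where
  "form_kinds a b ks \<longleftrightarrow> ks = [(a, b)] \<and> (a \<or> b) \<or>
     (\<exists>u. inner u \<and> ks = (a, True) # u @ [(True, b)])"

text \<open>A linked box closes the surrounding pair and opens a new one, so an \<open>inner\<close>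
  word need not be matched within itself and becomes so only inside a pair of parentheses. Hence the
  different conclusions in the mutual induction.\<close>

lemma word_of_null_inner:
  shows "null_kinds n \<Longrightarrow> all_matched (word_of n)"
    and "inner u \<Longrightarrow> form_word False False (Open # word_of u @ [Close])"
proof (induction rule: null_kinds_inner.inducts)
  case (null_Cons u n)
  then have "all_matched ((Open # word_of u @ [Close]) @ word_of n)"
    by (intro all_matched_append)
  then show ?case by simp
next
  case (inner_link n u)
  have "form_word False False ((Open # word_of n @ [Close]) @ Dash # Open # word_of u @ [Close])"
    by (rule form_word_join[OF form_word_paren]) (use inner_link in auto)
  then show ?case by simp
qed (auto simp: all_matched_Nil form_word_paren)

lemma form_kinds_word:
  assumes "form_kinds a b ks"
  shows "form_word a b (word_of ks)"
proof -
  consider "ks = [(a, b)]" "a \<or> b" | u where "inner u" "ks = (a, True) # u @ [(True, b)]"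
    using assms unfolding form_kinds_def by blast
  then show ?thesis
  proof cases
    case 1
    then show ?thesis
      using form_word_Open form_word_Close form_word_join[OF form_word_Close form_word_Open]
      by (cases a; cases b) auto
  next
    case 2
    have mid: "form_word False False (Open # word_of u @ [Close])"
      using word_of_null_inner 2(1) by blast
    have l: "form_word True False (Close # Dash # Open # word_of u @ [Close])"
      using form_word_join[OF form_word_Close mid] by simp
    show ?thesis
      using 2(2) mid l form_word_join[OF mid form_word_Open] form_word_join[OF l form_word_Open]
      by (cases a; cases b) auto
  qed
qed

lemma form_kinds_Nil: "\<not> form_kinds a b []"
  by (auto simp: form_kinds_def)

lemma form_kinds_null: "form_kinds False False ks \<Longrightarrow> null_kinds ks"
  by (auto simp: form_kinds_def intro: null_kinds_inner.intros)

text \<open>The new ")" matches the "(" at the end of the form and absorbs the null forms in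
  between; whether the result ends with "(" depends on the new box alone.\<close>

lemma form_kinds_extend:
  assumes "form_kinds a True ks" "null_kinds n"
  shows "form_kinds a b (ks @ n @ [(True, b)])"
proof -
  consider "ks = [(a, True)]" | u where "inner u" "ks = (a, True) # u @ [(True, True)]"
    using assms(1) unfolding form_kinds_def by blast
  then show ?thesis
  proof cases
    case 1
    then show ?thesis unfolding form_kinds_def using inner_null[OF assms(2)] by auto
  next
    case 2
    then show ?thesis unfolding form_kinds_def using inner_append_link[OF 2(1) assms(2)] by auto
  qed
qed

text \<open>The condition \<open>a \<or> b'\<close> is for a form of one box, which has to keep a
  parenthesis.\<close>

lemma form_kinds_change_last:
  "form_kinds a b (ks @ [k]) \<Longrightarrow> a \<or> b' \<Longrightarrow> form_kinds a b' (ks @ [(fst k, b')])"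
  unfolding form_kinds_def
  by (auto simp: append_eq_Cons_conv Cons_eq_append_conv)

lemma form_kinds_change_hd:
  "form_kinds a b (k # ks) \<Longrightarrow> a' \<or> b \<Longrightarrow> form_kinds a' b ((a', snd k) # ks)"
  unfolding form_kinds_def by auto

lemma form_kinds_hd_left: "form_kinds False b (k # ks) \<Longrightarrow> k = (False, True)"
  and form_kinds_last_right: "form_kinds a False (ks @ [k]) \<Longrightarrow> k = (True, False)"
  by (auto simp: form_kinds_def Cons_eq_append_conv)

lemma form_kinds_hd_combined: "form_kinds True True (k # ks) \<Longrightarrow> k = (True, True)"
  and form_kinds_last_combined: "form_kinds True True (ks @ [k]) \<Longrightarrow> k = (True, True)"
  by (auto simp: form_kinds_def Cons_eq_append_conv)

section \<open>Heights of prefixes and suffixes in the lattice path of the parentheses\<close>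

definition excess :: "(bool \<times> bool) list \<Rightarrow> int" where
  "excess ks = (\<Sum>k\<leftarrow>ks. of_bool (fst k) - of_bool (snd k))"

lemma excess_simps [simp]:
  "excess [] = 0" "excess (k # ks) = of_bool (fst k) - of_bool (snd k) + excess ks"
  "excess (ks @ ls) = excess ks + excess ls"
  by (simp_all add: excess_def)

text \<open>A ")" is an up-step and "(" a down-step, so a matched word never rises above its start;
  linked boxes are level steps.\<close>

lemma excess_null_inner:
  shows "null_kinds n \<Longrightarrow> excess n = 0 \<and> (\<forall>m. excess (take m n) \<le> 0)"
    and "inner u \<Longrightarrow> excess u = 0 \<and> (\<forall>m. excess (take m u) \<le> 0)"
proof (induction rule: null_kinds_inner.inducts)
  case (null_Cons u n)
  have "excess (take m ((False, True) # u @ (True, False) # n)) \<le> 0" for m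
    using null_Cons by (cases "m = 0"; cases "m - 1 - length u = 0")
      (auto simp: take_Cons' intro: order_trans)
  then show ?case using null_Cons by simp
next
  case (inner_link n u)
  have "excess (take m (n @ (True, True) # u)) \<le> 0" for m
    using inner_link by (cases "m \<le> length n") (auto simp: take_Cons')
  then show ?case using inner_link by simp
qed auto

lemma excess_form: "form_kinds a b ks \<Longrightarrow> excess ks = of_bool a - of_bool b"
  unfolding form_kinds_def using excess_null_inner(2) by auto

lemma excess_take_form:
  assumes "form_kinds False b ks"
  shows "excess (take m ks) \<le> 0"
  using assms unfolding form_kinds_def
proof (elim disjE exE conjE)
  fix u assume u: "inner u" "ks = (False, True) # u @ [(True, b)]"
  then show ?thesis using excess_null_inner(2)[OF u(1)]
    by (cases "m - 1 \<le> length u") (auto simp: take_Cons' intro: order_trans)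
qed (auto simp: take_Cons')

lemma excess_drop_inner:
  assumes "inner u"
  shows "0 \<le> excess (drop m u)"
proof -
  have "excess (take m u) + excess (drop m u) = excess u"
    by (subst excess_simps(3)[symmetric]) simp
  moreover have "excess u = 0" "excess (take m u) \<le> 0" using excess_null_inner(2)[OF assms] by auto
  ultimately show ?thesis by linarith
qed

lemma excess_drop_form:
  assumes "form_kinds a False ks"
  shows "0 \<le> excess (drop m ks)"
  using assms unfolding form_kinds_def
proof (elim disjE exE conjE)
  fix u assume u: "inner u" "ks = (a, True) # u @ [(True, False)]"
  show ?thesis
  proof (cases m)
    case 0
    then show ?thesis using u excess_null_inner(2)[OF u(1)] by simp
  next
    case (Suc m')
    then show ?thesis using u excess_drop_inner[OF u(1), of m'] by (auto simp: drop_Cons')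
  qed
qed (auto simp: drop_Cons')

text \<open>Dropping the first box removes a "(", but as the form ends with "(", the partner of the
  removed one sits in a linked box, which is a level step.\<close>

lemma excess_take_tail:
  assumes "form_kinds a True (k # ks)"
  shows "excess (take m ks) \<le> 0"
  using assms unfolding form_kinds_def
proof (elim disjE exE conjE)
  fix u assume u: "inner u" "k # ks = (a, True) # u @ [(True, True)]"
  then show ?thesis using excess_null_inner(2)[OF u(1)]
    by (cases "m \<le> length u") (auto simp: take_Cons')
qed auto

text \<open>The form starts with ")", so its first box is linked whenever it is not the only
  one.\<close>

lemma excess_drop_front:
  assumes "form_kinds True b (ks @ [k])"
  shows "0 \<le> excess (drop m ks)"
  using assms unfolding form_kinds_def
proof (elim disjE exE conjE)
  fix u assume u: "inner u" "ks @ [k] = (True, True) # u @ [(True, b)]"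
  then have "ks = (True, True) # u" by (cases ks) auto
  then show ?thesis
    using excess_null_inner(2)[OF u(1)] excess_drop_inner[OF u(1)] by (auto simp: drop_Cons')
qed auto

section \<open>Cutting a list of boxes into forms\<close>

definition decomposes :: "('x \<Rightarrow> bool \<times> bool) \<Rightarrow> ((bool \<times> bool) \<times> 'x list) list \<Rightarrow> 'x list \<Rightarrow> bool" where
  "decomposes \<kappa> bs xs \<longleftrightarrow> xs = concat (map snd bs) \<and>
     (\<forall>x\<in>set bs. form_kinds (fst (fst x)) (snd (fst x)) (map \<kappa> (snd x))) \<and>
     sorted_wrt (\<lambda>x y. \<not> (snd (fst x) \<and> fst (fst y))) bs"

text \<open>Read the boxes one by one. A box with ")" merges with the last form ending with "(" and
  with everything after that form, which by the order condition consists of null forms. Without such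
  a form, or without ")", the box becomes a form of its own.\<close>

lemma decomposes_exists:
  assumes "\<And>x. x \<in> set xs \<Longrightarrow> \<kappa> x \<noteq> (False, False)"
  shows "\<exists>bs. decomposes \<kappa> bs xs"
  using assms
proof (induction xs rule: rev_induct)
  case Nil
  show ?case by (intro exI[of _ "[]"]) (simp add: decomposes_def)
next
  case (snoc x xs)
  then obtain bs where bs: "decomposes \<kappa> bs xs" by auto
  obtain p q where pq: "\<kappa> x = (p, q)" "p \<or> q" using snoc.prems[of x] by (cases "\<kappa> x") auto
  show ?case
  proof (cases "p \<and> (\<exists>y\<in>set bs. snd (fst y))")
    case False
    then have "decomposes \<kappa> (bs @ [((p, q), [x])]) (xs @ [x])"
      using bs pq by (auto simp: decomposes_def sorted_wrt_append form_kinds_def)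
    then show ?thesis ..
  next
    case True
    then obtain bs1 y bs2 where split: "bs = bs1 @ y # bs2" "snd (fst y)" "\<forall>z\<in>set bs2. \<not> snd (fst z)"
      using split_list_last_prop[of bs "\<lambda>y. snd (fst y)"] by auto
    define a g where "a = fst (fst y)" and "g = snd y"
    then have y: "y = ((a, True), g)" using split(2) by (simp add: prod_eq_iff)
    have "null_kinds (map \<kappa> (snd z))" if "z \<in> set bs2" for z
    proof -
      have "\<not> snd (fst z)" using split(3) that by blast
      moreover have "\<not> fst (fst z)"
        using bs split(1,2) that by (auto simp: decomposes_def sorted_wrt_append)
      moreover have "form_kinds (fst (fst z)) (snd (fst z)) (map \<kappa> (snd z))"
        using bs split(1) that by (simp add: decomposes_def)
      ultimately show ?thesis by (simp add: form_kinds_null)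
    qed
    then have "null_kinds (map \<kappa> (concat (map snd bs2)))"
      by (induction bs2) (auto intro: null_Nil null_kinds_append)
    then have "form_kinds a q (map \<kappa> (g @ concat (map snd bs2) @ [x]))"
      using form_kinds_extend[of a "map \<kappa> g"] bs split y pq True by (auto simp: decomposes_def)
    then have "decomposes \<kappa> (bs1 @ [((a, q), g @ concat (map snd bs2) @ [x])]) (xs @ [x])"
      using bs split y by (auto simp: decomposes_def sorted_wrt_append)
    then show ?thesis ..
  qed
qed

text \<open>Only the flags of the form containing \<open>y\<close> change; the borders between the
  forms stay in place.\<close>

lemma decomposes_update:
  assumes d: "decomposes \<kappa> (xs @ (c, g) # ys) L" and L: "distinct L"
    and \<kappa>: "\<And>x. x \<noteq> y \<Longrightarrow> \<kappa>' x = \<kappa> x" and y: "y \<in> set g"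
    and f: "form_kinds a b (map \<kappa>' g)"
    and order: "\<And>x. x \<in> set xs \<Longrightarrow> \<not> (snd (fst x) \<and> a)" "\<And>z. z \<in> set ys \<Longrightarrow> \<not> (b \<and> fst (fst z))"
  shows "decomposes \<kappa>' (xs @ ((a, b), g) # ys) L"
proof -
  have "form_kinds (fst (fst z)) (snd (fst z)) (map \<kappa>' (snd z))" if "z \<in> set (xs @ ys)" for z
  proof -
    have "y \<notin> set (snd z)" using d L y that by (auto simp: decomposes_def)
    then have "map \<kappa>' (snd z) = map \<kappa> (snd z)" using \<kappa> by (metis map_cong)
    moreover have "form_kinds (fst (fst z)) (snd (fst z)) (map \<kappa> (snd z))"
      using d that by (auto simp: decomposes_def)
    ultimately show ?thesis by (simp only:)
  qed
  then show ?thesis using d f order by (auto simp: decomposes_def sorted_wrt_append)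
qed

section \<open>The operators in terms of forms\<close>

lemma sorted_wrt_concat:
  assumes "\<And>ys. ys \<in> set yss \<Longrightarrow> sorted_wrt P ys"
    and "sorted_wrt (\<lambda>ys zs. \<forall>y\<in>set ys. \<forall>z\<in>set zs. P y z) yss"
  shows "sorted_wrt P (concat yss)"
  using assms by (induction yss) (auto simp: sorted_wrt_append)

lemma set_reading: "set (reverse_row_reading la) = SD la"
proof -
  have "set (reverse_row_reading la) =
      (\<Union>r\<in>{1..<length la + 1}. (\<lambda>j. (r, r + j - 1)) ` {1..<part la r + 1})"
    unfolding reverse_row_reading_def set_concat set_map set_rev set_upt image_image ..
  also have "\<dots> = SD la"
    unfolding SD_def Suc_eq_plus1[symmetric] atLeastLessThanSuc_atLeastAtMost by blast
  finally show ?thesis .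
qed

lemma sorted_reading: "sorted_wrt before (reverse_row_reading la)"
  unfolding reverse_row_reading_def
proof (rule sorted_wrt_concat)
  fix ys assume "ys \<in> set (map (\<lambda>r. map (\<lambda>j. (r, r + j - 1)) (rev [1..<part la r + 1])) [1..<length la + 1])"
  then show "sorted_wrt before ys"
    by (auto simp: sorted_wrt_iff_nth_less rev_nth simp del: upt_Suc)
next
  show "sorted_wrt (\<lambda>ys zs. \<forall>y\<in>set ys. \<forall>z\<in>set zs. before y z)
     (map (\<lambda>r. map (\<lambda>j. (r, r + j - 1)) (rev [1..<part la r + 1])) [1..<length la + 1])"
    by (auto simp: sorted_wrt_map sorted_wrt_iff_nth_less simp del: upt_Suc)
qed

lemma before_irrefl: "\<not> before x x"
  by (simp add: before_def)

lemma before_asym: "before x y \<Longrightarrow> \<not> before y x"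
  by (auto simp: before_def)

lemma sorted_before_distinct: "sorted_wrt before xs \<Longrightarrow> distinct xs"
  by (induction xs) (auto simp: before_irrefl)

text \<open>The boxes that contribute a character. The operators do not change this list, since the
  box they touch keeps \<open>i\<close> or \<open>i + 1\<close>.\<close>

definition boxes :: "nat list \<Rightarrow> nat \<Rightarrow> (box \<Rightarrow> nat set) \<Rightarrow> box list" where
  "boxes la i T = filter (\<lambda>x. i \<in> T x \<or> Suc i \<in> T x) (reverse_row_reading la)"

lemma sorted_boxes: "sorted_wrt before (boxes la i T)"
  unfolding boxes_def by (rule sorted_wrt_filter[OF sorted_reading])

lemma distinct_boxes: "distinct (boxes la i T)"
  by (rule sorted_before_distinct[OF sorted_boxes])

lemma set_boxes: "set (boxes la i T) = {x \<in> SD la. i \<in> T x \<or> Suc i \<in> T x}"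
  by (auto simp: boxes_def set_reading)

lemma boxes_cong:
  "(\<And>x. i \<in> T' x \<or> Suc i \<in> T' x \<longleftrightarrow> i \<in> T x \<or> Suc i \<in> T x) \<Longrightarrow> boxes la i T' = boxes la i T"
  by (simp add: boxes_def)

abbreviation box_word :: "nat \<Rightarrow> (box \<Rightarrow> nat set) \<Rightarrow> box list \<Rightarrow> (symb \<times> box) list" where
  "box_word i T xs \<equiv> concat (map (box_symbs i T) xs)"

lemma linked_word_boxes: "linked_word la i T = box_word i T (boxes la i T)"
proof -
  have "box_word i T xs = box_word i T (filter (\<lambda>x. i \<in> T x \<or> Suc i \<in> T x) xs)" for xs
    by (induction xs) (auto simp: box_symbs_def)
  then show ?thesis by (simp add: linked_word_def boxes_def)
qed

lemma fst_box_symbs: "map fst (box_symbs i T x) = symbs (kind T i x)"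
  by (auto simp: box_symbs_def symbs_def kind_def)

lemma fst_box_word: "map fst (box_word i T xs) = word_of (map (kind T i) xs)"
  by (induction xs) (auto simp: fst_box_symbs)

lemma snd_box_symbs: "y \<in> set (box_symbs i T x) \<Longrightarrow> snd y = x"
  by (auto simp: box_symbs_def split: if_splits)

lemma box_symbs_ne: "i \<in> T x \<or> Suc i \<in> T x \<Longrightarrow> box_symbs i T x \<noteq> []"
  by (auto simp: box_symbs_def)

definition decomp :: "nat list \<Rightarrow> nat \<Rightarrow> (box \<Rightarrow> nat set) \<Rightarrow> ((bool \<times> bool) \<times> box list) list \<Rightarrow> bool" where
  "decomp la i T bs \<longleftrightarrow> decomposes (kind T i) bs (boxes la i T)"

lemma decomp_exists: "\<exists>bs. decomp la i T bs"
  unfolding decomp_def by (rule decomposes_exists) (auto simp: set_boxes kind_def)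

locale decomposed =
  fixes la i T bs
  assumes decomp: "decomp la i T bs"
begin

lemma boxes_eq: "boxes la i T = concat (map snd bs)"
  using decomp by (simp add: decomp_def decomposes_def)

lemma form_kinds: "((a, b), g) \<in> set bs \<Longrightarrow> form_kinds a b (map (kind T i) g)"
  using decomp by (fastforce simp: decomp_def decomposes_def)

text \<open>The forms spelled out in characters; through this list the theory of
  \<open>form_decomposition\<close> applies to the linked word.\<close>

definition cs :: "((bool \<times> bool) \<times> symb list) list" where
  "cs = map (\<lambda>x. (fst x, word_of (map (kind T i) (snd x)))) bs"

sublocale form_decomposition cs
proof
  show "form_word (fst (fst x)) (snd (fst x)) (snd x)" if x: "x \<in> set cs" for x
  proof -
    obtain y where "y \<in> set bs" "x = (fst y, word_of (map (kind T i) (snd y)))"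
      using x unfolding cs_def set_map by blast
    moreover from this have "form_kinds (fst (fst y)) (snd (fst y)) (map (kind T i) (snd y))"
      using decomp by (simp add: decomp_def decomposes_def)
    ultimately show ?thesis by (simp only: fst_conv snd_conv form_kinds_word)
  qed
  show "sorted_wrt (\<lambda>x y. \<not> (snd (fst x) \<and> fst (fst y))) cs"
    using decomp by (simp add: cs_def decomp_def decomposes_def sorted_wrt_map)
qed

abbreviation "W \<equiv> linked_word la i T"

lemma fst_W: "map fst W = w"
  unfolding linked_word_boxes fst_box_word boxes_eq cs_def
  by (induction bs) auto

lemma N_eq: "N = length bs"
  by (simp add: cs_def)

lemma starts_nth: "j < N \<Longrightarrow> starts j = fst (fst (bs ! j))" "j < N \<Longrightarrow> ends j = snd (fst (bs ! j))"
  unfolding starts_def ends_def by (simp_all add: cs_def)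

lemma at_block:
  assumes bs: "bs = xs @ y # ys"
  shows "length xs < N" "starts (length xs) = fst (fst y)" "ends (length xs) = snd (fst y)"
proof -
  have *: "length xs < length bs" "bs ! length xs = y" by (simp_all add: bs)
  show "length xs < N" using *(1) N_eq by simp
  then show "starts (length xs) = fst (fst y)" "ends (length xs) = snd (fst y)"
    by (simp_all only: starts_nth *)
qed

lemma before_block:
  assumes bs: "bs = xs @ y # ys" and k: "k < length xs"
  shows "\<exists>x\<in>set xs. starts k = fst (fst x) \<and> ends k = snd (fst x)"
proof -
  have *: "bs ! k = xs ! k" "k < length bs" using k by (simp_all add: bs nth_append)
  then have "k < N" using N_eq by simp
  then show ?thesis using k by (intro bexI[of _ "xs ! k"]) (simp_all only: starts_nth * nth_mem simp_thms)
qed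

lemma after_block:
  assumes bs: "bs = xs @ y # ys" and k: "length xs < k" "k < N"
  shows "\<exists>z\<in>set ys. starts k = fst (fst z) \<and> ends k = snd (fst z)"
proof -
  define m where "m = k - Suc (length xs)"
  have "k < length bs" using k N_eq by simp
  then have *: "bs ! k = ys ! m" "m < length ys" using k by (auto simp: bs m_def nth_append)
  then show ?thesis using k by (intro bexI[of _ "ys ! m"]) (simp_all only: starts_nth * nth_mem simp_thms)
qed

text \<open>The linked word cut at one form, with what is needed to find the boxes of the first and
  last characters of that form.\<close>

lemma W_at:
  assumes "bs = xs @ ((a, b), g) # ys"
  shows "starts (length xs) = a" "ends (length xs) = b"
    and "W = box_word i T (concat (map snd xs)) @ box_word i T g @ box_word i T (concat (map snd ys))"
    and "off (length xs) = length (box_word i T (concat (map snd xs)))"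
    and "off (Suc (length xs)) = off (length xs) + length (box_word i T g)"
    and "g \<noteq> []" "\<And>x. x \<in> set g \<Longrightarrow> i \<in> T x \<or> Suc i \<in> T x"
    and "form_kinds a b (map (kind T i) g)"
proof -
  show "starts (length xs) = a" "ends (length xs) = b"
    using at_block[OF assms] by (simp_all only: fst_conv snd_conv)
  show "W = box_word i T (concat (map snd xs)) @ box_word i T g @ box_word i T (concat (map snd ys))"
    unfolding linked_word_boxes boxes_eq using assms by simp
  have len: "length (box_word i T zs) = length (word_of (map (kind T i) zs))" for zs
    by (subst fst_box_word[symmetric]) simp
  have "take (length xs) cs = map (\<lambda>x. (fst x, word_of (map (kind T i) (snd x)))) xs"
    unfolding cs_def by (simp add: assms)
  moreover have "concat (map snd (map (\<lambda>x. (fst x, word_of (map (kind T i) (snd x)))) zs)) =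
      word_of (map (kind T i) (concat (map snd zs)))" for zs :: "((bool \<times> bool) \<times> box list) list"
    by (induction zs) auto
  ultimately show "off (length xs) = length (box_word i T (concat (map snd xs)))"
    unfolding len off_def by (simp only:)
  show "off (Suc (length xs)) = off (length xs) + length (box_word i T g)"
  proof -
    have "length xs < length bs" and g: "bs ! length xs = ((a, b), g)" by (simp_all add: assms)
    then have "cs ! length xs = ((a, b), word_of (map (kind T i) g))"
      unfolding cs_def by (subst nth_map) (simp_all only: g fst_conv snd_conv)
    then have "word (length xs) = word_of (map (kind T i) g)" by (simp only: word_def snd_conv)
    then show ?thesis unfolding len using off_Suc[OF at_block(1)[OF assms]] by (simp only:)
  qed
  show f: "form_kinds a b (map (kind T i) g)" using form_kinds assms by simp
  then show "g \<noteq> []" using form_kinds_Nil by auto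
  show "i \<in> T x \<or> Suc i \<in> T x" if "x \<in> set g" for x
  proof -
    have "x \<in> set (boxes la i T)" using that assms by (simp add: boxes_eq)
    then show ?thesis by (simp add: set_boxes)
  qed
qed

lemma box_at_start:
  assumes "bs = xs @ ((a, b), g) # ys"
  shows "snd (W ! off (length xs)) = hd g"
proof -
  note at = W_at[OF assms]
  obtain x g' where g: "g = x # g'" using at(6) by (cases g) auto
  obtain s S where S: "box_symbs i T x = s # S"
    using box_symbs_ne[of i T x] at(7)[of x] g by (cases "box_symbs i T x") auto
  then have "W ! off (length xs) = s" by (simp add: at(3,4) g nth_append)
  then show ?thesis using snd_box_symbs[of s i T x] S g by simp
qed

lemma box_at_end:
  assumes "bs = xs @ ((a, b), g) # ys"
  shows "snd (W ! (off (Suc (length xs)) - 1)) = last g"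
proof -
  note at = W_at[OF assms]
  obtain x g' where g: "g = g' @ [x]" using at(6) by (cases g rule: rev_cases) auto
  obtain s S where S: "box_symbs i T x = S @ [s]"
    using box_symbs_ne[of i T x] at(7)[of x] g by (cases "box_symbs i T x" rule: rev_cases) auto
  then have "W ! (off (Suc (length xs)) - 1) = s" by (simp add: at(3,4,5) g nth_append)
  then show ?thesis using snd_box_symbs[of s i T x] S g by simp
qed

lemma block_split:
  assumes "j < N"
  obtains xs g ys where "bs = xs @ ((starts j, ends j), g) # ys" "length xs = j"
proof -
  have "bs = take j bs @ bs ! j # drop (Suc j) bs" using assms id_take_nth_drop N_eq by simp
  moreover have "bs ! j = ((starts j, ends j), snd (bs ! j))"
    using assms by (simp add: starts_nth)
  ultimately show ?thesis using that[of "take j bs" "snd (bs ! j)" "drop (Suc j) bs"] assms N_eq by simp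
qed

lemma order_at:
  assumes "bs = xs @ ((a, b), g) # ys"
  shows "a \<Longrightarrow> x \<in> set xs \<Longrightarrow> \<not> snd (fst x)" "b \<Longrightarrow> y \<in> set ys \<Longrightarrow> \<not> fst (fst y)"
  using decomp assms by (auto simp: decomp_def decomposes_def sorted_wrt_append)

lemma unambiguous: "linked_word_unambiguous W"
  unfolding linked_word_unambiguous_def Let_def fst_W
proof (intro conjI allI impI)
  fix C C' assume "combined_form w C \<and> combined_form w C'"
  then show "C = C'" using combined_unique by (auto simp: combined_form_iff)
next
  fix C assume "left_form w C"
  then show "w ! Min C = Open" using nth_Min by (auto simp: left_form_iff)
next
  fix C assume "right_form w C"
  then show "w ! Max C = Close" using nth_Max by (auto simp: right_form_iff)
next
  fix C assume "combined_form w C"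
  then obtain j where j: "j < N" "C = block j" "starts j" "ends j"
    by (auto simp: combined_form_iff)
  obtain xs g ys where bs: "bs = xs @ ((True, True), g) # ys" "length xs = j"
    using block_split[OF j(1)] j by auto
  note at = W_at[OF bs(1)]
  have triple: "box_symbs i T x = [(Close, x), (Dash, x), (Open, x)]" if "kind T i x = (True, True)" for x
    using that by (simp add: box_symbs_def kind_def)
  obtain x g' where g: "g = x # g'" using at(6) by (cases g) auto
  have "kind T i x = (True, True)" using at(8) g form_kinds_hd_combined by simp
  then have "take 3 (drop (Min C) W) = [(Close, x), (Dash, x), (Open, x)]"
    using j bs(2) by (simp add: Min_block at(3) at(4)[unfolded bs(2)] g triple)
  then show "\<exists>b. take 3 (drop (Min C) W) = [(Close, b), (Dash, b), (Open, b)]" by blast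
  obtain y g'' where g: "g = g'' @ [y]" using at(6) by (cases g rule: rev_cases) auto
  have "kind T i y = (True, True)" using at(8) g form_kinds_last_combined[of "map (kind T i) g''"] by simp
  note triple = triple[OF this]
  \<comment> \<open>The last box contributes three characters, so its link begins two positions
    before the end of the form.\<close>
  have Max: "Max C = off j + length (box_word i T g'') + 2"
    using j by (simp add: Max_block at(5)[unfolded bs(2)] g triple)
  then show "2 \<le> Max C" by simp
  have "take 3 (drop (Max C - 2) W) = [(Close, y), (Dash, y), (Open, y)]"
    by (simp add: Max at(3) at(4)[unfolded bs(2)] g triple)
  then show "\<exists>b. take 3 (drop (Max C - 2) W) = [(Close, b), (Dash, b), (Open, b)]" by blast
qed

lemma tab_combined:
  assumes "bs = xs @ ((True, True), g) # ys"
  shows "tab_e la i T = Some (T(last g := T (last g) - {Suc i}))"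
    and "tab_f la i T = Some (T(hd g := T (hd g) - {i}))"
proof -
  have j: "length xs < N" "starts (length xs)" "ends (length xs)"
    using at_block[OF assms] by simp_all
  then have c: "combined_form w (block (length xs))" by (auto simp: combined_form_iff)
  have the: "(THE C. combined_form w C) = block (length xs)"
  proof (rule the_equality)
    fix C assume "combined_form w C"
    then show "C = block (length xs)" using combined_unique j by (auto simp: combined_form_iff)
  qed (rule c)
  have ex: "\<exists>C. combined_form w C" using c by blast
  show "tab_e la i T = Some (T(last g := T (last g) - {Suc i}))"
    using ex box_at_end[OF assms] j(1)
    by (simp add: tab_e_def Let_def fst_W the Max_block)
  show "tab_f la i T = Some (T(hd g := T (hd g) - {i}))"
    using ex box_at_start[OF assms] j(1)
    by (simp add: tab_f_def Let_def fst_W the Min_block)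
qed

text \<open>No earlier form ends with "(", and no later form starts with ")" because this one ends
  with "("; so there is no combined form on either side.\<close>

lemma tab_e_left:
  assumes bs: "bs = xs @ ((False, True), g) # ys" and xs: "\<And>x. x \<in> set xs \<Longrightarrow> \<not> snd (fst x)"
  shows "tab_e la i T = Some (T(hd g := insert i (T (hd g))))"
proof -
  have j: "length xs < N" "\<not> starts (length xs)" "ends (length xs)"
    using at_block[OF bs] by simp_all
  have less: "\<not> ends k" if "k < length xs" for k
    using before_block[OF bs that] xs by auto
  have "\<not> combined_form w C" for C
    using less j not_ends_starts by (auto simp: combined_form_iff) (metis linorder_neqE_nat)
  moreover have "left_form w (block (length xs))" using j by (auto simp: left_form_iff)
  moreover have "first_left_start w = off (length xs)" using j less by (intro first_left_start_eq) auto
  ultimately show ?thesis using box_at_start[OF bs] by (auto simp: tab_e_def Let_def fst_W)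
qed

lemma tab_e_None:
  assumes "\<And>x. x \<in> set bs \<Longrightarrow> \<not> snd (fst x)"
  shows "tab_e la i T = None"
proof -
  have "\<not> ends j" if "j < N" for j
    using that assms[of "bs ! j"] N_eq by (simp add: starts_nth)
  then show ?thesis by (auto simp: tab_e_def Let_def fst_W combined_form_iff left_form_iff)
qed

lemma tab_f_right:
  assumes bs: "bs = xs @ ((True, False), g) # ys" and ys: "\<And>y. y \<in> set ys \<Longrightarrow> \<not> fst (fst y)"
  shows "tab_f la i T = Some (T(last g := insert (Suc i) (T (last g))))"
proof -
  have j: "length xs < N" "starts (length xs)" "\<not> ends (length xs)"
    using at_block[OF bs] by simp_all
  have greater: "\<not> starts k" if "length xs < k" "k < N" for k
    using after_block[OF bs that] ys by auto
  have "\<not> combined_form w C" for C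
    using greater j not_ends_starts by (auto simp: combined_form_iff) (metis linorder_neqE_nat)
  moreover have "right_form w (block (length xs))" using j by (auto simp: right_form_iff)
  moreover have "last_right_end w = off (Suc (length xs)) - 1"
    using j greater by (intro last_right_end_eq) auto
  ultimately show ?thesis using box_at_end[OF bs] by (auto simp: tab_f_def Let_def fst_W)
qed

lemma tab_f_None:
  assumes "\<And>x. x \<in> set bs \<Longrightarrow> \<not> fst (fst x)"
  shows "tab_f la i T = None"
proof -
  have "\<not> starts j" if "j < N" for j
    using that assms[of "bs ! j"] N_eq by (simp add: starts_nth)
  then show ?thesis by (auto simp: tab_f_def Let_def fst_W combined_form_iff right_form_iff)
qed

end

section \<open>The decomposition before and after an operator\<close>

lemma decomp_update:
  assumes d: "decomp la i T (xs @ (c, g) # ys)" and y: "y \<in> set g"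
    and T': "\<And>x. x \<noteq> y \<Longrightarrow> T' x = T x" "i \<in> T' y \<or> Suc i \<in> T' y"
    and f: "form_kinds a b (map (kind T' i) g)"
    and order: "\<And>x. x \<in> set xs \<Longrightarrow> \<not> (snd (fst x) \<and> a)" "\<And>z. z \<in> set ys \<Longrightarrow> \<not> (b \<and> fst (fst z))"
  shows "decomp la i T' (xs @ ((a, b), g) # ys)"
proof -
  have "y \<in> set (boxes la i T)" using d y by (auto simp: decomp_def decomposes_def)
  then have "boxes la i T' = boxes la i T"
    using T' by (intro boxes_cong) (metis (no_types, lifting) mem_Collect_eq set_boxes)
  moreover have "decomposes (kind T' i) (xs @ ((a, b), g) # ys) (boxes la i T)"
    by (rule decomposes_update[OF d[unfolded decomp_def] distinct_boxes _ y f])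
      (use T'(1) order in \<open>auto simp: kind_def\<close>)
  ultimately show ?thesis by (simp add: decomp_def)
qed

lemma combined_kind:
  assumes "form_kinds True True (map (kind T i) g)"
  shows "kind T i (hd g) = (True, True)" "kind T i (last g) = (True, True)"
proof -
  have "g \<noteq> []" using assms form_kinds_Nil by auto
  then obtain x g' where g: "g = x # g'" by (cases g) auto
  then show "kind T i (hd g) = (True, True)" using form_kinds_hd_combined assms by simp
  obtain y g'' where g': "g = g'' @ [y]" using \<open>g \<noteq> []\<close> by (cases g rule: rev_cases) auto
  then show "kind T i (last g) = (True, True)"
    using form_kinds_last_combined[of "map (kind T i) g''"] assms by simp
qed

lemma left_kind:
  assumes "form_kinds False b (map (kind T i) g)"
  shows "kind T i (hd g) = (False, True)"
  using assms form_kinds_hd_left form_kinds_Nil by (cases g) auto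

lemma right_kind:
  assumes "form_kinds a False (map (kind T i) g)"
  shows "kind T i (last g) = (True, False)"
  using assms form_kinds_last_right[of a "map (kind T i) (butlast g)"] form_kinds_Nil
  by (cases g rule: rev_cases) auto

lemma form_kinds_update_last:
  assumes f: "form_kinds a b (map (kind T i) g)" and d: "distinct g" and ab: "a \<or> b'"
    and T': "\<And>x. x \<noteq> last g \<Longrightarrow> T' x = T x" "kind T' i (last g) = (fst (kind T i (last g)), b')"
  shows "form_kinds a b' (map (kind T' i) g)"
proof -
  obtain y g' where g: "g = g' @ [y]" using form_kinds_Nil f by (cases g rule: rev_cases) auto
  have "kind T' i x = kind T i x" if "x \<in> set g'" for x
    using that d g T'(1)[of x] by (auto simp: kind_def)
  then have eq: "map (kind T' i) g = map (kind T i) g' @ [(fst (kind T i y), b')]"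
    using g T'(2) by simp
  show ?thesis unfolding eq by (rule form_kinds_change_last) (use f ab g in auto)
qed

lemma form_kinds_update_hd:
  assumes f: "form_kinds a b (map (kind T i) g)" and d: "distinct g" and ab: "a' \<or> b"
    and T': "\<And>x. x \<noteq> hd g \<Longrightarrow> T' x = T x" "kind T' i (hd g) = (a', snd (kind T i (hd g)))"
  shows "form_kinds a' b (map (kind T' i) g)"
proof -
  obtain y g' where g: "g = y # g'" using form_kinds_Nil f by (cases g) auto
  have "kind T' i x = kind T i x" if "x \<in> set g'" for x
    using that d g T'(1)[of x] by (auto simp: kind_def)
  then have eq: "map (kind T' i) g = (a', snd (kind T i y)) # map (kind T i) g'"
    using g T'(2) by simp
  show ?thesis unfolding eq by (rule form_kinds_change_hd) (use f ab g in auto)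
qed

context decomposed
begin

lemma distinct_block: "bs = xs @ (c, g) # ys \<Longrightarrow> distinct g"
  using distinct_boxes[of la i T] by (simp add: boxes_eq)

lemma ends_cases:
  obtains (none) "\<And>x. x \<in> set bs \<Longrightarrow> \<not> snd (fst x)"
  | (ends) xs a g ys where "bs = xs @ ((a, True), g) # ys" "\<And>x. x \<in> set xs \<Longrightarrow> \<not> snd (fst x)"
proof (cases "\<exists>x\<in>set bs. snd (fst x)")
  case True
  then obtain xs y ys where s: "bs = xs @ y # ys" "snd (fst y)" "\<forall>x\<in>set xs. \<not> snd (fst x)"
    using split_list_first_prop[of bs "\<lambda>x. snd (fst x)"] by auto
  then have "y = ((fst (fst y), True), snd y)" by (simp add: prod_eq_iff)
  then show ?thesis using s ends[of xs "fst (fst y)" "snd y" ys] by metis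
qed (use none in blast)

lemma starts_cases:
  obtains (none) "\<And>x. x \<in> set bs \<Longrightarrow> \<not> fst (fst x)"
  | (starts) xs b g ys where "bs = xs @ ((True, b), g) # ys" "\<And>x. x \<in> set ys \<Longrightarrow> \<not> fst (fst x)"
proof (cases "\<exists>x\<in>set bs. fst (fst x)")
  case True
  then obtain xs y ys where s: "bs = xs @ y # ys" "fst (fst y)" "\<forall>x\<in>set ys. \<not> fst (fst x)"
    using split_list_last_prop[of bs "\<lambda>x. fst (fst x)"] by auto
  then have "y = ((True, snd (fst y)), snd y)" by (simp add: prod_eq_iff)
  then show ?thesis using s starts[of xs "snd (fst y)" "snd y" ys] by metis
qed (use none in blast)

text \<open>No later form starts with ")", because the combined form ended with "(". So the new
  right form is the last one, and \<open>f'\<close> acts on it.\<close>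

lemma remove_upper:
  assumes bs: "bs = xs @ ((True, True), g) # ys"
  defines "T' \<equiv> T(last g := T (last g) - {Suc i})"
  shows "decomp la i T' (xs @ ((True, False), g) # ys)" "Suc i \<in> T (last g)" "i \<in> T (last g)"
    "tab_f la i T' = Some T"
proof -
  note at = W_at[OF bs]
  show si: "Suc i \<in> T (last g)" "i \<in> T (last g)"
    using combined_kind(2)[OF at(8)] by (simp_all add: kind_def)
  have "form_kinds True False (map (kind T' i) g)"
    by (rule form_kinds_update_last[OF at(8) distinct_block[OF bs]])
      (use si in \<open>auto simp: T'_def kind_def\<close>)
  then show d: "decomp la i T' (xs @ ((True, False), g) # ys)"
    by (rule decomp_update[OF decomp[unfolded bs], of "last g", rotated 3])
      (use at(6) si order_at[OF bs] in \<open>auto simp: T'_def\<close>)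
  interpret d': decomposed la i T' "xs @ ((True, False), g) # ys" using d by unfold_locales
  have "tab_f la i T' = Some (T'(last g := insert (Suc i) (T' (last g))))"
    using order_at(2)[OF bs] by (intro d'.tab_f_right) auto
  also have "T'(last g := insert (Suc i) (T' (last g))) = T"
    using si by (simp add: T'_def fun_upd_idem_iff insert_absorb)
  finally show "tab_f la i T' = Some T" .
qed

lemma remove_lower:
  assumes bs: "bs = xs @ ((True, True), g) # ys"
  defines "T' \<equiv> T(hd g := T (hd g) - {i})"
  shows "decomp la i T' (xs @ ((False, True), g) # ys)" "Suc i \<in> T (hd g)" "i \<in> T (hd g)"
    "tab_e la i T' = Some T"
proof -
  note at = W_at[OF bs]
  show si: "Suc i \<in> T (hd g)" "i \<in> T (hd g)"
    using combined_kind(1)[OF at(8)] by (simp_all add: kind_def)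
  have "form_kinds False True (map (kind T' i) g)"
    by (rule form_kinds_update_hd[OF at(8) distinct_block[OF bs]])
      (use si in \<open>auto simp: T'_def kind_def\<close>)
  then show d: "decomp la i T' (xs @ ((False, True), g) # ys)"
    by (rule decomp_update[OF decomp[unfolded bs], of "hd g", rotated 3])
      (use at(6) si order_at[OF bs] in \<open>auto simp: T'_def\<close>)
  interpret d': decomposed la i T' "xs @ ((False, True), g) # ys" using d by unfold_locales
  have "tab_e la i T' = Some (T'(hd g := insert i (T' (hd g))))"
    using order_at(1)[OF bs] by (intro d'.tab_e_left) auto
  also have "T'(hd g := insert i (T' (hd g))) = T"
    using si by (simp add: T'_def fun_upd_idem_iff insert_absorb)
  finally show "tab_e la i T' = Some T" .
qed

text \<open>Letting this form start with ")" respects the order because no form of \<open>xs\<close>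
  ends with "(". It is then the combined form, on which \<open>f'\<close> acts.\<close>

lemma add_lower:
  assumes bs: "bs = xs @ ((False, True), g) # ys" and xs: "\<And>x. x \<in> set xs \<Longrightarrow> \<not> snd (fst x)"
  defines "T' \<equiv> T(hd g := insert i (T (hd g)))"
  shows "decomp la i T' (xs @ ((True, True), g) # ys)" "Suc i \<in> T (hd g)" "i \<notin> T (hd g)"
    "tab_f la i T' = Some T"
proof -
  note at = W_at[OF bs]
  show si: "Suc i \<in> T (hd g)" "i \<notin> T (hd g)"
    using left_kind[OF at(8)] by (simp_all add: kind_def)
  have "form_kinds True True (map (kind T' i) g)"
    by (rule form_kinds_update_hd[OF at(8) distinct_block[OF bs]])
      (use si in \<open>auto simp: T'_def kind_def\<close>)
  then show d: "decomp la i T' (xs @ ((True, True), g) # ys)"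
    by (rule decomp_update[OF decomp[unfolded bs], of "hd g", rotated 3])
      (use at(6) si order_at(2)[OF bs] xs in \<open>auto simp: T'_def\<close>)
  interpret d': decomposed la i T' "xs @ ((True, True), g) # ys" using d by unfold_locales
  have "tab_f la i T' = Some (T'(hd g := T' (hd g) - {i}))"
    by (intro d'.tab_combined) auto
  also have "T'(hd g := T' (hd g) - {i}) = T"
    using si by (simp add: T'_def fun_upd_idem_iff)
  finally show "tab_f la i T' = Some T" .
qed

lemma add_upper:
  assumes bs: "bs = xs @ ((True, False), g) # ys" and ys: "\<And>y. y \<in> set ys \<Longrightarrow> \<not> fst (fst y)"
  defines "T' \<equiv> T(last g := insert (Suc i) (T (last g)))"
  shows "decomp la i T' (xs @ ((True, True), g) # ys)" "i \<in> T (last g)" "Suc i \<notin> T (last g)"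
    "tab_e la i T' = Some T"
proof -
  note at = W_at[OF bs]
  show si: "i \<in> T (last g)" "Suc i \<notin> T (last g)"
    using right_kind[OF at(8)] by (simp_all add: kind_def)
  have "form_kinds True True (map (kind T' i) g)"
    by (rule form_kinds_update_last[OF at(8) distinct_block[OF bs]])
      (use si in \<open>auto simp: T'_def kind_def\<close>)
  then show d: "decomp la i T' (xs @ ((True, True), g) # ys)"
    by (rule decomp_update[OF decomp[unfolded bs], of "last g", rotated 3])
      (use at(6) si order_at(1)[OF bs] ys in \<open>auto simp: T'_def\<close>)
  interpret d': decomposed la i T' "xs @ ((True, True), g) # ys" using d by unfold_locales
  have "tab_e la i T' = Some (T'(last g := T' (last g) - {Suc i}))"
    by (intro d'.tab_combined) auto
  also have "T'(last g := T' (last g) - {Suc i}) = T"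
    using si by (simp add: T'_def fun_upd_idem_iff)
  finally show "tab_e la i T' = Some T" .
qed

end

section \<open>Closure\<close>

lemma before_trans: "before x y \<Longrightarrow> before y z \<Longrightarrow> before x z"
  by (auto simp: before_def)

text \<open>In a list sorted by reading order the boxes up to \<open>y\<close> form a prefix, so
  counting them becomes a matter of prefix heights.\<close>

lemma filter_up_to:
  assumes "sorted_wrt before R"
  shows "\<exists>m. filter (\<lambda>x. x = y \<or> before x y) R = take m R"
proof -
  have "filter (\<lambda>x. x = y \<or> before x y) R = takeWhile (\<lambda>x. x = y \<or> before x y) R"
    using assms
  proof (induction R)
    case (Cons x R)
    show ?case
    proof (cases "x = y \<or> before x y")
      case False
      have "\<not> (z = y \<or> before z y)" if "z \<in> set R" for z
        using Cons.prems False that before_trans[of x z y] by auto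
      then show ?thesis using False by (simp add: filter_empty_conv)
    qed (use Cons in auto)
  qed simp
  then show ?thesis using takeWhile_eq_take by metis
qed

lemma filter_from:
  assumes "sorted_wrt before R"
  shows "\<exists>m. filter (\<lambda>x. x = y \<or> before y x) R = drop m R"
proof -
  have "filter (\<lambda>x. x = y \<or> before y x) R = dropWhile (\<lambda>x. \<not> (x = y \<or> before y x)) R"
    using assms
  proof (induction R)
    case (Cons x R)
    show ?case
    proof (cases "x = y \<or> before y x")
      case True
      have "z = y \<or> before y z" if "z \<in> set R" for z
        using Cons.prems True that before_trans[of y x z] by auto
      then show ?thesis using True by (simp add: filter_id_conv)
    qed (use Cons in auto)
  qed simp
  then show ?thesis using dropWhile_eq_drop by metis
qed

lemma excess_count:
  "excess (map (kind T i) zs) =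
     int (length (filter (only T i (Suc i)) zs)) - int (length (filter (only T (Suc i) i) zs))"
  by (induction zs) (auto simp: kind_def only_def)

lemma excess_take_blocks:
  assumes "\<And>x. x \<in> set ys \<Longrightarrow> form_kinds (fst (fst x)) (snd (fst x)) (map \<kappa> (snd x)) \<and> \<not> fst (fst x)"
  shows "excess (take m (map \<kappa> (concat (map snd ys)))) \<le> 0"
  using assms
proof (induction ys arbitrary: m)
  case (Cons x ys)
  have "excess (take m (map \<kappa> (snd x))) \<le> 0"
    using Cons.prems[of x] by (intro excess_take_form[of "snd (fst x)"]) auto
  moreover have "excess (take (m - length (snd x)) (map \<kappa> (concat (map snd ys)))) \<le> 0"
    by (intro Cons.IH Cons.prems) simp
  ultimately show ?case by simp
qed simp

lemma excess_drop_blocks: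
  assumes "\<And>x. x \<in> set xs \<Longrightarrow> form_kinds (fst (fst x)) (snd (fst x)) (map \<kappa> (snd x)) \<and> \<not> snd (fst x)"
  shows "0 \<le> excess (drop m (map \<kappa> (concat (map snd xs))))"
  using assms
proof (induction xs arbitrary: m)
  case (Cons x xs)
  have "0 \<le> excess (drop m (map \<kappa> (snd x)))"
    using Cons.prems[of x] by (intro excess_drop_form[of "fst (fst x)"]) auto
  moreover have "0 \<le> excess (drop (m - length (snd x)) (map \<kappa> (concat (map snd xs))))"
    by (intro Cons.IH Cons.prems) simp
  ultimately show ?case by simp
qed simp

context decomposed
begin

lemma in_boxes: "filling la T \<Longrightarrow> i \<in> T x \<or> Suc i \<in> T x \<Longrightarrow> x \<in> set (boxes la i T)"
  using filling.in_SD[of la T _ x] by (auto simp only: set_boxes)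

lemma block_kinds: "x \<in> set bs \<Longrightarrow> form_kinds (fst (fst x)) (snd (fst x)) (map (kind T i) (snd x))"
  using decomp by (simp add: decomp_def decomposes_def)

lemma raising:
  assumes fill: "filling la T" and bs: "bs = xs @ ((False, True), g) # ys"
    and xs: "\<And>x. x \<in> set xs \<Longrightarrow> \<not> snd (fst x)" and y: "hd g = (r, c)"
  shows "raising la T i r c"
proof -
  interpret filling la T by (rule fill)
  let ?X = "concat (map snd xs)" and ?Z = "concat (map snd ys)"
  obtain g' where g: "g = (r, c) # g'" using W_at(6)[OF bs] y by (cases g) auto
  have L: "boxes la i T = ?X @ (r, c) # g' @ ?Z" using bs g by (simp add: boxes_eq)
  have sorted: "sorted_wrt before (?X @ (r, c) # g' @ ?Z)"
    using sorted_boxes[of la i T] L by simp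
  show ?thesis
  proof
    show "Suc i \<in> T (r, c)" "i \<notin> T (r, c)" using add_lower(2,3)[OF bs xs] y by auto
  next
    fix x assume x: "before x (r, c)" "Suc i \<in> T x"
    have "x \<in> set (?X @ (r, c) # g' @ ?Z)" using in_boxes[OF fill, of x] x L by simp
    moreover have "x \<noteq> (r, c)" using x before_irrefl by blast
    moreover have "x \<notin> set (g' @ ?Z)"
      using sorted before_asym[OF x(1)] by (auto simp: sorted_wrt_append)
    ultimately have "x \<in> set ?X" by auto
    then obtain z where z: "z \<in> set xs" "x \<in> set (snd z)" by auto
    \<comment> \<open>No form of \<open>xs\<close> ends with "(", so the last box of the form of
      \<open>x\<close> has \<open>i\<close> but not \<open>i + 1\<close>; it therefore differs from
      \<open>x\<close> and is read after it.\<close>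
    have "form_kinds (fst (fst z)) False (map (kind T i) (snd z))"
      using block_kinds[of z] z xs bs by auto
    then have k: "kind T i (last (snd z)) = (True, False)" by (rule right_kind)
    have "x \<noteq> last (snd z)" using k x by (auto simp: kind_def)
    then obtain h where h: "snd z = h @ [last (snd z)]" "x \<in> set h"
      using z(2) by (metis append_butlast_last_id empty_iff in_set_butlast_appendI append_Nil2 list.set(1) set_ConsD rotate1.simps(2) set_rotate1)
    obtain xs1 xs2 where "xs = xs1 @ z # xs2" using z(1) split_list by fast
    then have "?X = concat (map snd xs1) @ h @ last (snd z) # concat (map snd xs2)" using h(1) by simp
    then have "before x (last (snd z)) \<and> before (last (snd z)) (r, c)"
      using sorted h(2) by (auto simp: sorted_wrt_append)
    moreover have "i \<in> T (last (snd z))" using k by (simp add: kind_def)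
    ultimately show "\<exists>t. before x t \<and> before t (r, c) \<and> i \<in> T t" by blast
  next
    fix y assume y: "before (r, c) y"
    let ?R = "g' @ ?Z" and ?Q = "\<lambda>x. x = y \<or> before x y"
    have R: "sorted_wrt before ?R" using sorted by (simp add: sorted_wrt_append)
    \<comment> \<open>The boxes after \<open>(r, c)\<close> are the rest of its form and then forms
      not starting with ")"; neither part rises above its start.\<close>
    have excess: "excess (take m (map (kind T i) ?R)) \<le> 0" for m
    proof -
      have "excess (take m (map (kind T i) g')) \<le> 0"
        using W_at(8)[OF bs] g by (intro excess_take_tail[of False]) auto
      moreover have "excess (take (m - length g') (map (kind T i) ?Z)) \<le> 0"
      proof (rule excess_take_blocks)
        fix z assume "z \<in> set ys"
        then show "form_kinds (fst (fst z)) (snd (fst z)) (map (kind T i) (snd z)) \<and> \<not> fst (fst z)"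
          using block_kinds[of z] order_at(2)[OF bs, of z] bs by simp
      qed
      ultimately show ?thesis by simp
    qed
    obtain m where m: "filter ?Q ?R = take m ?R" using filter_up_to[OF R] by blast
    have card: "card {x \<in> SD la. before (r, c) x \<and> ?Q x \<and> only T a a' x} =
        length (filter (only T a a') (filter ?Q ?R))"
      if "{a, a'} = {i, Suc i}" for a a'
    proof -
      have eq: "{x \<in> SD la. before (r, c) x \<and> ?Q x \<and> only T a a' x} = set (filter (only T a a') (filter ?Q ?R))"
      proof (intro equalityI subsetI)
        fix x assume x: "x \<in> {x \<in> SD la. before (r, c) x \<and> ?Q x \<and> only T a a' x}"
        then have "x \<in> set (?X @ (r, c) # ?R)"
          using that in_boxes[OF fill, of x] L by (auto simp: only_def doubleton_eq_iff)
        moreover have "x \<noteq> (r, c)" using x before_irrefl by blast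
        moreover have "x \<notin> set ?X"
          using x sorted before_asym[of x "(r, c)"] by (auto simp: sorted_wrt_append)
        ultimately show "x \<in> set (filter (only T a a') (filter ?Q ?R))" using x by auto
      next
        fix x assume "x \<in> set (filter (only T a a') (filter ?Q ?R))"
        then have x: "x \<in> set ?R" "?Q x" "only T a a' x" by auto
        then have "before (r, c) x" using sorted by (auto simp: sorted_wrt_append)
        moreover have "x \<in> SD la" using x(3) in_SD[of a x] by (simp add: only_def)
        ultimately show "x \<in> {x \<in> SD la. before (r, c) x \<and> ?Q x \<and> only T a a' x}" using x by simp
      qed
      show ?thesis unfolding eq
        by (rule distinct_card[OF distinct_filter[OF distinct_filter[OF sorted_before_distinct[OF R]]]])
    qed
    have "int (length (filter (only T i (Suc i)) (filter ?Q ?R)))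
        \<le> int (length (filter (only T (Suc i) i) (filter ?Q ?R)))"
      unfolding m using excess[of m] excess_count[of T i "take m ?R"] by (simp add: take_map)
    then show "card {x \<in> SD la. before (r, c) x \<and> ?Q x \<and> only T i (Suc i) x}
        \<le> card {x \<in> SD la. before (r, c) x \<and> ?Q x \<and> only T (Suc i) i x}"
      by (simp add: card insert_commute)
  qed
qed

lemma lowering:
  assumes fill: "filling la T" and bs: "bs = xs @ ((True, False), g) # ys"
    and ys: "\<And>x. x \<in> set ys \<Longrightarrow> \<not> fst (fst x)" and y: "last g = (r, c)"
  shows "lowering la T i r c"
proof -
  interpret filling la T by (rule fill)
  let ?X = "concat (map snd xs)" and ?Z = "concat (map snd ys)"
  obtain g' where g: "g = g' @ [(r, c)]" using W_at(6)[OF bs] y by (cases g rule: rev_cases) auto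
  have L: "boxes la i T = (?X @ g') @ (r, c) # ?Z" using bs g by (simp add: boxes_eq)
  have sorted: "sorted_wrt before ((?X @ g') @ (r, c) # ?Z)"
    using sorted_boxes[of la i T] L by simp
  show ?thesis
  proof
    show "i \<in> T (r, c)" "Suc i \<notin> T (r, c)" using add_upper(2,3)[OF bs ys] y by auto
  next
    fix x assume x: "before (r, c) x" "i \<in> T x"
    have "x \<in> set ((?X @ g') @ (r, c) # ?Z)" using in_boxes[OF fill, of x] x L by simp
    moreover have "x \<noteq> (r, c)" using x before_irrefl by blast
    moreover have "x \<notin> set (?X @ g')"
      using sorted before_asym[OF x(1)] by (auto simp: sorted_wrt_append)
    ultimately have "x \<in> set ?Z" by auto
    then obtain z where z: "z \<in> set ys" "x \<in> set (snd z)" by auto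
    have "form_kinds False (snd (fst z)) (map (kind T i) (snd z))"
      using block_kinds[of z] z ys bs by auto
    then have k: "kind T i (hd (snd z)) = (False, True)" by (rule left_kind)
    have "x \<noteq> hd (snd z)" using k x by (auto simp: kind_def)
    then obtain h where h: "snd z = hd (snd z) # h" "x \<in> set h"
      using z(2) by (cases "snd z") auto
    obtain ys1 ys2 where "ys = ys1 @ z # ys2" using z(1) split_list by fast
    then have "?Z = concat (map snd ys1) @ hd (snd z) # h @ concat (map snd ys2)"
      using arg_cong[OF h(1), of "\<lambda>u. concat (map snd ys1) @ u @ concat (map snd ys2)"] by simp
    then have "before (r, c) (hd (snd z)) \<and> before (hd (snd z)) x"
      using sorted h(2) by (auto simp: sorted_wrt_append)
    moreover have "Suc i \<in> T (hd (snd z))" using k by (simp add: kind_def)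
    ultimately show "\<exists>t. before (r, c) t \<and> before t x \<and> Suc i \<in> T t" by blast
  next
    fix y assume y: "before y (r, c)"
    let ?R = "?X @ g'" and ?Q = "\<lambda>x. x = y \<or> before y x"
    have R: "sorted_wrt before ?R" using sorted by (simp add: sorted_wrt_append)
    \<comment> \<open>Suffixes matter here, because the stretches of \<open>lowering\<close> end
      just before \<open>(r, c)\<close>.\<close>
    have excess: "0 \<le> excess (drop m (map (kind T i) ?R))" for m
    proof -
      have "0 \<le> excess (drop (m - length ?X) (map (kind T i) g'))"
        using W_at(8)[OF bs] g by (intro excess_drop_front[of False]) auto
      moreover have "0 \<le> excess (drop m (map (kind T i) ?X))"
      proof (rule excess_drop_blocks)
        fix z assume "z \<in> set xs"
        then show "form_kinds (fst (fst z)) (snd (fst z)) (map (kind T i) (snd z)) \<and> \<not> snd (fst z)"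
          using block_kinds[of z] order_at(1)[OF bs, of z] bs by simp
      qed
      ultimately show ?thesis by simp
    qed
    obtain m where m: "filter ?Q ?R = drop m ?R" using filter_from[OF R] by blast
    have card: "card {x \<in> SD la. ?Q x \<and> before x (r, c) \<and> only T a a' x} =
        length (filter (only T a a') (filter ?Q ?R))"
      if "{a, a'} = {i, Suc i}" for a a'
    proof -
      have eq: "{x \<in> SD la. ?Q x \<and> before x (r, c) \<and> only T a a' x} = set (filter (only T a a') (filter ?Q ?R))"
      proof (intro equalityI subsetI)
        fix x assume x: "x \<in> {x \<in> SD la. ?Q x \<and> before x (r, c) \<and> only T a a' x}"
        then have "x \<in> set (?R @ (r, c) # ?Z)"
          using that in_boxes[OF fill, of x] L by (auto simp: only_def doubleton_eq_iff)
        moreover have "x \<noteq> (r, c)" using x before_irrefl by blast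
        moreover have "x \<notin> set ?Z"
          using x sorted before_asym[of x "(r, c)"] by (auto simp: sorted_wrt_append)
        ultimately show "x \<in> set (filter (only T a a') (filter ?Q ?R))" using x by auto
      next
        fix x assume "x \<in> set (filter (only T a a') (filter ?Q ?R))"
        then have x: "x \<in> set ?R" "?Q x" "only T a a' x" by auto
        then have "before x (r, c)" using sorted by (auto simp: sorted_wrt_append)
        moreover have "x \<in> SD la" using x(3) in_SD[of a x] by (simp add: only_def)
        ultimately show "x \<in> {x \<in> SD la. ?Q x \<and> before x (r, c) \<and> only T a a' x}" using x by simp
      qed
      show ?thesis unfolding eq
        by (rule distinct_card[OF distinct_filter[OF distinct_filter[OF sorted_before_distinct[OF R]]]])
    qed
    have "int (length (filter (only T (Suc i) i) (filter ?Q ?R)))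
        \<le> int (length (filter (only T i (Suc i)) (filter ?Q ?R)))"
      unfolding m using excess[of m] excess_count[of T i "drop m ?R"] by (simp add: drop_map)
    then show "card {x \<in> SD la. ?Q x \<and> before x (r, c) \<and> only T (Suc i) i x}
        \<le> card {x \<in> SD la. ?Q x \<and> before x (r, c) \<and> only T i (Suc i) x}"
      by (simp add: card insert_commute)
  qed
qed

end

lemma SetDecTab_filling: "strict_partition la \<Longrightarrow> T \<in> SetDecTab n la \<Longrightarrow> filling la T"
  by unfold_locales (auto simp: SetDecTab_iff)

text \<open>Only emptiness of the box could go wrong, and \<open>x\<close> prevents it.\<close>

lemma SetDecTab_remove:
  assumes la: "strict_partition la" and T: "T \<in> SetDecTab n la" and x: "x \<in> T y" "x \<noteq> z"
  shows "T(y := T y - {z}) \<in> SetDecTab n la"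
proof -
  have "no_pattern (T(y := T y - {z}))"
    by (rule no_pattern_mono[of T]) (use T in \<open>auto simp: SetDecTab_iff[OF la]\<close>)
  then show ?thesis using T x by (auto simp: SetDecTab_iff[OF la])
qed

lemma SetDecTab_insert:
  assumes la: "strict_partition la" and T: "T \<in> SetDecTab n la" and y: "y \<in> SD la" "z \<in> {1..n}"
    and "no_pattern (T(y := insert z (T y)))"
  shows "T(y := insert z (T y)) \<in> SetDecTab n la"
  using assms by (auto simp: SetDecTab_iff[OF la])

lemma tab_e_closed:
  assumes la: "strict_partition la" and i: "i \<in> {1..n-1}" and T: "T \<in> SetDecTab n la"
    and e: "tab_e la i T = Some T'"
  shows "T' \<in> SetDecTab n la"
proof -
  obtain bs where "decomp la i T bs" using decomp_exists by blast
  then interpret decomposed la i T bs by unfold_locales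
  have fill: "filling la T" using SetDecTab_filling[OF la T] .
  from ends_cases show ?thesis
  proof cases
    case none
    then show ?thesis using tab_e_None e by auto
  next
    case (ends xs a g ys)
    show ?thesis
    proof (cases a)
      case True
      then have bs: "bs = xs @ ((True, True), g) # ys" using ends(1) by simp
      then show ?thesis
        using SetDecTab_remove[OF la T remove_upper(3)[OF bs], of "Suc i"] tab_combined(1)[OF bs] e by simp
    next
      case False
      have bs: "bs = xs @ ((False, True), g) # ys" using ends(1) False by simp
      obtain r c where rc: "hd g = (r, c)" by (cases "hd g")
      have "no_pattern (T((r, c) := insert i (T (r, c))))"
        using raising.no_pattern_raised[OF raising[OF fill bs ends(2) rc]] .
      moreover have "(r, c) \<in> SD la"
        using add_lower(2)[OF bs ends(2)] filling.in_SD[OF fill] rc by metis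
      ultimately show ?thesis
        using SetDecTab_insert[OF la T, of "(r, c)" i] tab_e_left[OF bs ends(2)] e i rc by auto
    qed
  qed
qed

lemma tab_f_closed:
  assumes la: "strict_partition la" and i: "i \<in> {1..n-1}" and T: "T \<in> SetDecTab n la"
    and f: "tab_f la i T = Some T'"
  shows "T' \<in> SetDecTab n la"
proof -
  obtain bs where "decomp la i T bs" using decomp_exists by blast
  then interpret decomposed la i T bs by unfold_locales
  have fill: "filling la T" using SetDecTab_filling[OF la T] .
  from starts_cases show ?thesis
  proof cases
    case none
    then show ?thesis using tab_f_None f by auto
  next
    case (starts xs b g ys)
    show ?thesis
    proof (cases b)
      case True
      then have bs: "bs = xs @ ((True, True), g) # ys" using starts(1) by simp
      then show ?thesis
        using SetDecTab_remove[OF la T remove_lower(2)[OF bs], of i] tab_combined(2)[OF bs] f by simp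
    next
      case False
      have bs: "bs = xs @ ((True, False), g) # ys" using starts(1) False by simp
      obtain r c where rc: "last g = (r, c)" by (cases "last g")
      have "no_pattern (T((r, c) := insert (Suc i) (T (r, c))))"
        using lowering.no_pattern_lowered[OF lowering[OF fill bs starts(2) rc]] .
      moreover have "(r, c) \<in> SD la"
        using add_upper(2)[OF bs starts(2)] filling.in_SD[OF fill] rc by metis
      ultimately show ?thesis
        using SetDecTab_insert[OF la T, of "(r, c)" "Suc i"] tab_f_right[OF bs starts(2)] f i rc by auto
    qed
  qed
qed

section \<open>Strings and weights\<close>

lemma iter_op_0: "iter_op g 0 b = Some b"
  by (simp add: iter_op_def)

lemma iter_op_Suc: "iter_op g (Suc k) b = Option.bind (g b) (iter_op g k)"
proof -
  have none: "((\<lambda>x. Option.bind x g) ^^ k) None = None" by (induction k) auto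
  show ?thesis
    unfolding iter_op_def funpow_Suc_right
    by (cases "g b") (simp_all add: none iter_op_def[abs_def])
qed

text \<open>\<open>R b m\<close> certifies that exactly \<open>m\<close> applications of
  \<open>g\<close> remain. The iterates that exist are then those up to \<open>m\<close>, so the
  supremum is attained.\<close>

lemma string_length_eqI:
  assumes zero: "\<And>b. R b 0 \<Longrightarrow> g b = None"
    and Suc: "\<And>b m. R b (Suc m) \<Longrightarrow> \<exists>c. g b = Some c \<and> R c m"
    and "R b m"
  shows "string_length g b = enat m"
proof -
  have "iter_op g k b \<noteq> None \<longleftrightarrow> k \<le> m" for k
    using assms(3)
  proof (induction m arbitrary: b k)
    case 0
    then show ?case using zero by (cases k) (auto simp: iter_op_0 iter_op_Suc)
  next
    case (Suc m)
    then obtain c where "g b = Some c" "R c m" using assms(2) by blast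
    then show ?case using Suc.IH by (cases k) (auto simp: iter_op_0 iter_op_Suc)
  qed
  then have "{k. iter_op g k b \<noteq> None} = {..m}" by auto
  then have "string_length g b = (SUP k\<in>{..m}. enat k)" by (simp add: string_length_def)
  also have "\<dots> = enat m" by (intro antisym SUP_least SUP_upper) auto
  finally show ?thesis .
qed

text \<open>The number of remaining steps of \<open>e'\<close>: a left form becomes combined and
  then right, which takes two steps, and a combined form needs one.\<close>

definition eps :: "((bool \<times> bool) \<times> 'x) list \<Rightarrow> nat" where
  "eps bs = (\<Sum>x\<leftarrow>bs. if snd (fst x) then if fst (fst x) then 1 else 2 else 0)"

definition phi :: "((bool \<times> bool) \<times> 'x) list \<Rightarrow> nat" where
  "phi bs = (\<Sum>x\<leftarrow>bs. if fst (fst x) then if snd (fst x) then 1 else 2 else 0)"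

lemma eps_simps [simp]:
  "eps [] = 0" "eps (x # xs) = (if snd (fst x) then if fst (fst x) then 1 else 2 else 0) + eps xs"
  "eps (xs @ ys) = eps xs + eps ys"
  by (simp_all add: eps_def)

lemma phi_simps [simp]:
  "phi [] = 0" "phi (x # xs) = (if fst (fst x) then if snd (fst x) then 1 else 2 else 0) + phi xs"
  "phi (xs @ ys) = phi xs + phi ys"
  by (simp_all add: phi_def)

lemma eps_0: "(\<And>x. x \<in> set bs \<Longrightarrow> \<not> snd (fst x)) \<Longrightarrow> eps bs = 0"
  by (induction bs) auto

lemma phi_0: "(\<And>x. x \<in> set bs \<Longrightarrow> \<not> fst (fst x)) \<Longrightarrow> phi bs = 0"
  by (induction bs) auto

lemma even_eps: "(\<And>x. x \<in> set bs \<Longrightarrow> \<not> fst (fst x)) \<Longrightarrow> even (eps bs)"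
  by (induction bs) auto

lemma phi_eps: "int (phi bs) - int (eps bs) =
    2 * (\<Sum>x\<leftarrow>bs. of_bool (fst (fst x)) - of_bool (snd (fst x)))"
  by (induction bs) auto

lemma even_eps_phi: "even (eps bs + phi bs)"
  by (induction bs) auto

text \<open>Nothing before the first form ending with "(" contributes to \<open>eps\<close>, and
  every later form contributes 0 or 2, as it cannot start with ")". So \<open>eps bs\<close> is odd
  exactly when that first form is combined, and parity decides which letter changes.\<close>

lemma e_step:
  assumes "decomp la i T bs"
  obtains (zero) "eps bs = 0" "tab_e la i T = None"
  | (insert) y bs' where "even (eps bs)" "eps bs = Suc (eps bs')" "i \<notin> T y" "Suc i \<in> T y"
      "tab_e la i T = Some (T(y := insert i (T y)))" "decomp la i (T(y := insert i (T y))) bs'"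
      "tab_f la i (T(y := insert i (T y))) = Some T"
  | (remove) y bs' where "odd (eps bs)" "eps bs = Suc (eps bs')" "i \<in> T y" "Suc i \<in> T y"
      "tab_e la i T = Some (T(y := T y - {Suc i}))" "decomp la i (T(y := T y - {Suc i})) bs'"
      "tab_f la i (T(y := T y - {Suc i})) = Some T"
proof -
  interpret decomposed la i T bs using assms by unfold_locales
  from ends_cases show ?thesis
  proof cases
    case none
    show ?thesis by (rule zero) (rule eps_0[OF none] tab_e_None[OF none]; assumption)+
  next
    case (ends xs a g ys)
    have xs: "eps xs = 0" using eps_0 ends(2) by blast
    have ys: "even (eps ys)" using even_eps order_at(2)[OF ends(1)] by blast
    show ?thesis
    proof (cases a)
      case True
      then have bs: "bs = xs @ ((True, True), g) # ys" using ends(1) by simp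
      show ?thesis
        by (rule remove[OF _ _ remove_upper(3,2)[OF bs] tab_combined(1)[OF bs] remove_upper(1,4)[OF bs]])
          (use xs ys in \<open>simp_all add: bs\<close>)
    next
      case False
      then have bs: "bs = xs @ ((False, True), g) # ys" using ends(1) by simp
      show ?thesis
        by (rule insert[OF _ _ add_lower(3,2)[OF bs ends(2)] tab_e_left[OF bs ends(2)]
              add_lower(1,4)[OF bs ends(2)]])
          (use xs ys in \<open>simp_all add: bs\<close>)
    qed
  qed
qed

lemma f_step:
  assumes "decomp la i T bs"
  obtains (zero) "phi bs = 0" "tab_f la i T = None"
  | (step) T' bs' where "phi bs = Suc (phi bs')" "tab_f la i T = Some T'" "decomp la i T' bs'"
      "tab_e la i T' = Some T"
proof -
  interpret decomposed la i T bs using assms by unfold_locales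
  from starts_cases show ?thesis
  proof cases
    case none
    show ?thesis by (rule zero) (rule phi_0[OF none] tab_f_None[OF none]; assumption)+
  next
    case (starts xs b g ys)
    have ys: "phi ys = 0" using phi_0 starts(2) by blast
    show ?thesis
    proof (cases b)
      case True
      then have bs: "bs = xs @ ((True, True), g) # ys" using starts(1) by simp
      show ?thesis
        by (rule step[OF _ tab_combined(2)[OF bs] remove_lower(1,4)[OF bs]])
          (use ys in \<open>simp add: bs\<close>)
    next
      case False
      then have bs: "bs = xs @ ((True, False), g) # ys" using starts(1) by simp
      show ?thesis
        by (rule step[OF _ tab_f_right[OF bs starts(2)] add_upper(1,4)[OF bs starts(2)]])
          (use ys in \<open>simp add: bs\<close>)
    qed
  qed
qed

lemma string_length_e: "decomp la i T bs \<Longrightarrow> string_length (tab_e la i) T = enat (eps bs)"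
proof (rule string_length_eqI[where R = "\<lambda>T m. \<exists>bs. decomp la i T bs \<and> eps bs = m"])
  fix T assume "\<exists>bs. decomp la i T bs \<and> eps bs = 0"
  then obtain bs where bs: "decomp la i T bs" "eps bs = 0" by blast
  from bs(1) show "tab_e la i T = None" by (cases rule: e_step) (use bs(2) in simp_all)
next
  fix T m assume "\<exists>bs. decomp la i T bs \<and> eps bs = Suc m"
  then obtain bs where bs: "decomp la i T bs" "eps bs = Suc m" by blast
  from bs(1) show "\<exists>c. tab_e la i T = Some c \<and> (\<exists>bs. decomp la i c bs \<and> eps bs = m)"
  proof (cases rule: e_step)
    case (insert y bs')
    then have "eps bs' = m" using bs(2) by simp
    then show ?thesis using insert(5,6) by blast
  next
    case (remove y bs')
    then have "eps bs' = m" using bs(2) by simp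
    then show ?thesis using remove(5,6) by blast
  qed (use bs(2) in simp)
qed blast

lemma string_length_f: "decomp la i T bs \<Longrightarrow> string_length (tab_f la i) T = enat (phi bs)"
proof (rule string_length_eqI[where R = "\<lambda>T m. \<exists>bs. decomp la i T bs \<and> phi bs = m"])
  fix T assume "\<exists>bs. decomp la i T bs \<and> phi bs = 0"
  then obtain bs where bs: "decomp la i T bs" "phi bs = 0" by blast
  from bs(1) show "tab_f la i T = None" by (cases rule: f_step) (use bs(2) in simp_all)
next
  fix T m assume "\<exists>bs. decomp la i T bs \<and> phi bs = Suc m"
  then obtain bs where bs: "decomp la i T bs" "phi bs = Suc m" by blast
  from bs(1) show "\<exists>c. tab_f la i T = Some c \<and> (\<exists>bs. decomp la i c bs \<and> phi bs = m)"
  proof (cases rule: f_step)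
    case (step T' bs')
    then have "phi bs' = m" using bs(2) by simp
    then show ?thesis using step(2,3) by blast
  qed (use bs(2) in simp)
qed blast

lemma e_f_inverse: "tab_e la i T = Some T' \<longleftrightarrow> tab_f la i T' = Some T"
proof
  assume e: "tab_e la i T = Some T'"
  obtain bs where "decomp la i T bs" using decomp_exists by blast
  then show "tab_f la i T' = Some T"
    by (cases rule: e_step) (use e in simp_all)
next
  assume f: "tab_f la i T' = Some T"
  obtain bs where "decomp la i T' bs" using decomp_exists by blast
  then show "tab_e la i T = Some T'"
    by (cases rule: f_step) (use f in simp_all)
qed

section \<open>Weights, and the crystal for the operators indexed by numbers\<close>

lemma tab_wt_insert:
  assumes "y \<in> SD la" "a \<notin> T y"
  shows "tab_wt la (T(y := insert a (T y))) k = tab_wt la T k + (if k = a then 1 else 0)"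
proof (cases "k = a")
  case True
  have "{b \<in> SD la. a \<in> (T(y := insert a (T y))) b} = insert y {b \<in> SD la. a \<in> T b}"
    using assms by auto
  then show ?thesis
    using True assms finite_SD[of la] by (simp add: tab_wt_def)
next
  case False
  then have "{b \<in> SD la. k \<in> (T(y := insert a (T y))) b} = {b \<in> SD la. k \<in> T b}" by auto
  then show ?thesis using False by (simp add: tab_wt_def)
qed

lemma tab_wt_remove:
  assumes "y \<in> SD la" "a \<in> T y"
  shows "tab_wt la T k = tab_wt la (T(y := T y - {a})) k + (if k = a then 1 else 0)"
  using tab_wt_insert[OF assms(1), of a "T(y := T y - {a})" k] assms(2)
  by (simp add: insert_absorb)

lemma tab_wt_boxes:
  "tab_wt la T i = length (filter (\<lambda>x. i \<in> T x) (boxes la i T))"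
  "tab_wt la T (Suc i) = length (filter (\<lambda>x. Suc i \<in> T x) (boxes la i T))"
proof -
  have "card {b \<in> SD la. a \<in> T b} = length (filter (\<lambda>x. a \<in> T x) (boxes la i T))"
    if "a = i \<or> a = Suc i" for a
  proof -
    have "{b \<in> SD la. a \<in> T b} = set (filter (\<lambda>x. a \<in> T x) (boxes la i T))"
      using that by (auto simp: set_boxes)
    then show ?thesis by (simp only: distinct_card[OF distinct_filter[OF distinct_boxes]])
  qed
  then show "tab_wt la T i = length (filter (\<lambda>x. i \<in> T x) (boxes la i T))"
    "tab_wt la T (Suc i) = length (filter (\<lambda>x. Suc i \<in> T x) (boxes la i T))"
    by (simp_all add: tab_wt_def)
qed

text \<open>The weight difference is the height of the whole word. Matched pairs cancel, so a form
  contributes to it through its two flags only.\<close>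

lemma phi_eps_weight:
  assumes "decomp la i T bs"
  shows "int (phi bs) - int (eps bs) = 2 * (int (tab_wt la T i) - int (tab_wt la T (Suc i)))"
proof -
  interpret decomposed la i T bs using assms by unfold_locales
  have "int (tab_wt la T i) - int (tab_wt la T (Suc i)) = excess (map (kind T i) (boxes la i T))"
  proof -
    have "int (length (filter (\<lambda>x. i \<in> T x) zs)) - int (length (filter (\<lambda>x. Suc i \<in> T x) zs)) =
        excess (map (kind T i) zs)" for zs
      by (induction zs) (auto simp: kind_def)
    then show ?thesis unfolding tab_wt_boxes[of la T i] .
  qed
  also have "\<dots> = excess (map (kind T i) (concat (map snd bs)))" by (simp only: boxes_eq)
  also have "\<dots> = (\<Sum>x\<leftarrow>bs. of_bool (fst (fst x)) - of_bool (snd (fst x)))"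
    using block_kinds
  proof (induction bs)
    case (Cons x bs)
    then show ?case using excess_form[of "fst (fst x)" "snd (fst x)" "map (kind T i) (snd x)"] by simp
  qed simp
  finally show ?thesis using phi_eps[of bs] by simp
qed

lemma sqrt_gl_crystal_SetDecTab:
  assumes la: "strict_partition la"
  shows "sqrt_gl_crystal n (SetDecTab n la) (tab_wt la) (tab_e la) (tab_f la)"
proof
  fix T assume T: "T \<in> SetDecTab n la"
  have "tab_wt la T k = 0" if "k \<notin> {1..n}" for k
  proof -
    have "{b \<in> SD la. k \<in> T b} = {}" using T that unfolding SetDecTab_iff[OF la] by blast
    then show ?thesis unfolding tab_wt_def by (simp only: card.empty)
  qed
  then show "tab_wt la T \<in> nat_vectors n" by (simp add: nat_vectors_def)
next
  fix i T T' assume "i \<in> {1..n-1}" "T \<in> SetDecTab n la" "tab_e la i T = Some T'"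
  then show "T' \<in> SetDecTab n la" by (rule tab_e_closed[OF la])
next
  fix i T T' assume "i \<in> {1..n-1}" "T \<in> SetDecTab n la" "tab_f la i T = Some T'"
  then show "T' \<in> SetDecTab n la" by (rule tab_f_closed[OF la])
next
  fix i T
  obtain bs where bs: "decomp la i T bs" using decomp_exists by blast
  have "(real (phi bs) - real (eps bs)) / 2 = real (tab_wt la T i) - real (tab_wt la T (i + 1))"
  proof -
    have "real_of_int (int (phi bs) - int (eps bs)) =
        real_of_int (2 * (int (tab_wt la T i) - int (tab_wt la T (Suc i))))"
      using phi_eps_weight[OF bs] by simp
    then show ?thesis by simp
  qed
  then show "\<exists>p q. string_length (tab_e la i) T = enat p \<and> string_length (tab_f la i) T = enat q \<and>
      even (p + q) \<and> (real q - real p) / 2 = real (tab_wt la T i) - real (tab_wt la T (i + 1))"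
    using string_length_e[OF bs] string_length_f[OF bs] even_eps_phi[of bs] by blast
next
  fix i T T'
  show "tab_e la i T = Some T' \<longleftrightarrow> tab_f la i T' = Some T" by (rule e_f_inverse)
next
  fix i T T' p
  assume T: "T \<in> SetDecTab n la" and e: "tab_e la i T = Some T'"
    and p: "string_length (tab_e la i) T = enat p"
  obtain bs where bs: "decomp la i T bs" using decomp_exists by blast
  have peps: "p = eps bs" using string_length_e[OF bs] p by simp
  have SD: "y \<in> SD la" if "Suc i \<in> T y" for y
    using that T unfolding SetDecTab_iff[OF la] by blast
  from bs show "vec_diff (tab_wt la T') (tab_wt la T) = (if even p then unit_vec i else - unit_vec (i + 1))"
  proof (cases rule: e_step)
    case (insert y bs')
    have "T' = T(y := insert i (T y))" using e insert(5) by simp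
    then have "tab_wt la T' k = tab_wt la T k + (if k = i then 1 else 0)" for k
      using tab_wt_insert[where T = T, OF SD[OF insert(4)] insert(3)] by simp
    then show ?thesis
      using insert(1) peps by (simp add: vec_diff_def unit_vec_def fun_eq_iff)
  next
    case (remove y bs')
    have "T' = T(y := T y - {Suc i})" using e remove(5) by simp
    then have "tab_wt la T k = tab_wt la T' k + (if k = Suc i then 1 else 0)" for k
      using tab_wt_remove[where T = T, OF SD[OF remove(4)] remove(4)] by simp
    then show ?thesis
      using remove(1) peps by (simp add: vec_diff_def unit_vec_def fun_eq_iff)
  qed (use e in simp)
qed

section \<open>The additional operators\<close>

lemma find_first:
  assumes "sorted_wrt before xs" "find P xs = Some b"
  shows "b \<in> set xs" "P b" "\<And>x. x \<in> set xs \<Longrightarrow> before x b \<Longrightarrow> \<not> P x"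
proof -
  obtain k where k: "k < length xs" "P (xs ! k)" "b = xs ! k" "\<And>j. j < k \<Longrightarrow> \<not> P (xs ! j)"
    using assms(2) by (auto simp: find_Some_iff)
  show "b \<in> set xs" "P b" using k by auto
  fix x assume "x \<in> set xs" "before x b"
  then obtain j where j: "j < length xs" "x = xs ! j" by (auto simp: in_set_conv_nth)
  have "j < k"
  proof (cases j k rule: linorder_cases)
    case equal
    then show ?thesis using j k \<open>before x b\<close> before_irrefl by blast
  next
    case greater
    then have "before b x" using assms(1) j k unfolding sorted_wrt_iff_nth_less by blast
    then show ?thesis using \<open>before x b\<close> before_asym by blast
  qed
  then show "\<not> P x" using k j by simp
qed

lemma first_12_box_Some:
  assumes "first_12_box la T = Some b"
  shows "b \<in> SD la" "1 \<in> T b \<or> 2 \<in> T b"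
    and "\<And>x. x \<in> SD la \<Longrightarrow> before x b \<Longrightarrow> 1 \<notin> T x \<and> 2 \<notin> T x"
  using find_first[OF sorted_reading assms[unfolded first_12_box_def]] by (auto simp: set_reading)

lemma first_12_box_None:
  "first_12_box la T = None \<longleftrightarrow> (\<forall>x\<in>SD la. 1 \<notin> T x \<and> 2 \<notin> T x)"
  by (auto simp: first_12_box_def find_None_iff set_reading)

lemma first_12_box_cong:
  "(\<And>x. 1 \<in> T' x \<or> 2 \<in> T' x \<longleftrightarrow> 1 \<in> T x \<or> 2 \<in> T x) \<Longrightarrow> first_12_box la T' = first_12_box la T"
  by (simp add: first_12_box_def)

section \<open>Closure under the additional operators\<close>

context filling
begin

text \<open>Boxes read earlier contain neither 1 nor 2, and no entry is below 1; what remains is a 1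
  in the next row further right. The box above that 1 was read earlier, so its entries are at least
  3 and give an old pattern with the 2 of \<open>(r, c)\<close>.\<close>

lemma no_pattern_insert_1:
  assumes pos: "\<And>x b. x \<in> T b \<Longrightarrow> 0 < x" and b: "2 \<in> T (r, c)"
    and first: "\<And>x. before x (r, c) \<Longrightarrow> 1 \<notin> T x \<and> 2 \<notin> T x"
  shows "no_pattern (T((r, c) := insert 1 (T (r, c))))"
proof -
  have below: False if k: "c < k" "1 \<in> T (Suc r, k)" for k
  proof -
    obtain y where y: "y \<in> T (r, k)" using elem_above[OF k(2) b] .
    have "y \<noteq> 1" "y \<noteq> 2" "0 < y" using first[of "(r, k)"] k(1) y pos by auto
    then show False using right[of c k 2 r y 1] k b y by simp
  qed
  show ?thesis
  proof (rule no_pattern_insert_lower[OF T])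
    fix k assume "c = r" "1 \<in> T (Suc r, k)"
    then show False using below[of k] col_ge[of 1 "Suc r" k] by simp
  next
    fix k y assume "c < k" "1 \<in> T (Suc r, k)"
    then show False by (rule below)
  next
    fix r' j x assume "r = Suc r'" "x \<in> T (r', j)" "x \<le> 1"
    then show False using first[of "(r', j)"] pos[of x "(r', j)"] by (cases "x = 1") auto
  qed (use b first pos in \<open>fastforce simp: numeral_2_eq_2\<close>)+
qed

text \<open>Again a 1 in the next row further right is the case that remains. The diagonal condition
  excludes \<open>c = r\<close>, so there is an entry below \<open>(r, c)\<close>, and it would have
  to be smaller than 1.\<close>

lemma no_pattern_insert_2:
  assumes pos: "\<And>x b. x \<in> T b \<Longrightarrow> 0 < x" and b: "1 \<in> T (r, c)"
    and first: "\<And>x. before x (r, c) \<Longrightarrow> 1 \<notin> T x \<and> 2 \<notin> T x"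
  shows "no_pattern (T((r, c) := insert 2 (T (r, c))))"
proof -
  have "no_pattern (T((r, c) := insert (Suc 1) (T (r, c))))"
  proof (rule no_pattern_insert_upper[OF T b])
    fix p s z assume "c < s" "z \<in> T (r, s)" "z \<le> Suc 1"
    then show False
      using first[of "(r, s)"] pos[of z "(r, s)"] by (cases "z = 1"; cases "z = 2") auto
  next
    fix k y assume k: "c < k" "1 \<in> T (Suc r, k)" and "y \<in> T (r, k)" "Suc 1 < y"
    have "c \<noteq> r" using diagonal[of 1 r 1 k] k b by auto
    then have "Suc r \<le> c" using col_ge[OF b] by simp
    then obtain w where w: "w \<in> T (Suc r, c)" using elem_row[OF k(2), of c] k(1) by auto
    then show False using left[of c k 1 r w 1] k b pos[OF w] by simp
  qed (use first pos in \<open>fastforce simp: numeral_2_eq_2\<close>)+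
  then show ?thesis by (simp add: numeral_2_eq_2)
qed

end

lemma tab_ebar_closed:
  assumes la: "strict_partition la" and n: "2 \<le> n" and mem: "T \<in> SetDecTab n la"
    and e: "tab_ebar la T = Some T'"
  shows "T' \<in> SetDecTab n la"
proof -
  interpret filling la T using SetDecTab_filling[OF la mem] .
  obtain b where b: "first_12_box la T = Some b"
    using e by (auto simp: tab_ebar_def split: option.splits)
  note fb = first_12_box_Some[OF b]
  obtain r c where rc: "b = (r, c)" by (cases b)
  have pos: "0 < x" if "x \<in> T y" for x y
    using that mem in_SD[OF that] unfolding SetDecTab_iff[OF la] by fastforce
  have first: "1 \<notin> T x \<and> 2 \<notin> T x" if "before x (r, c)" for x
    using fb(3)[of x] that rc outside[of x] by (cases "x \<in> SD la") auto
  show ?thesis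
  proof (cases "1 \<in> T b")
    case True
    then have "T' = T(b := T b - {2})" using e b by (auto simp: tab_ebar_def split: if_splits)
    then show ?thesis using SetDecTab_remove[OF la mem True, of 2] by simp
  next
    case False
    then have "T' = T(b := insert 1 (T b))" using e b by (auto simp: tab_ebar_def split: if_splits)
    moreover have "no_pattern (T(b := insert 1 (T b)))"
      using no_pattern_insert_1[of r c] pos first False fb(2) rc by blast
    ultimately show ?thesis using SetDecTab_insert[OF la mem fb(1), of 1] n by simp
  qed
qed

lemma tab_fbar_closed:
  assumes la: "strict_partition la" and n: "2 \<le> n" and mem: "T \<in> SetDecTab n la"
    and f: "tab_fbar la T = Some T'"
  shows "T' \<in> SetDecTab n la"
proof -
  interpret filling la T using SetDecTab_filling[OF la mem] .
  obtain b where b: "first_12_box la T = Some b"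
    using f by (auto simp: tab_fbar_def split: option.splits)
  note fb = first_12_box_Some[OF b]
  obtain r c where rc: "b = (r, c)" by (cases b)
  have pos: "0 < x" if "x \<in> T y" for x y
    using that mem in_SD[OF that] unfolding SetDecTab_iff[OF la] by fastforce
  have first: "1 \<notin> T x \<and> 2 \<notin> T x" if "before x (r, c)" for x
    using fb(3)[of x] that rc outside[of x] by (cases "x \<in> SD la") auto
  show ?thesis
  proof (cases "2 \<in> T b")
    case True
    then have "T' = T(b := T b - {1})" using f b by (auto simp: tab_fbar_def split: if_splits)
    then show ?thesis using SetDecTab_remove[OF la mem True, of 1] by simp
  next
    case False
    then have "T' = T(b := insert 2 (T b))" using f b by (auto simp: tab_fbar_def split: if_splits)
    moreover have "no_pattern (T(b := insert 2 (T b)))"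
      using no_pattern_insert_2[of r c] pos first False fb(2) rc by blast
    ultimately show ?thesis using SetDecTab_insert[OF la mem fb(1), of 2] n by simp
  qed
qed

section \<open>Strings of the additional operators\<close>

definition bar_eps :: "nat list \<Rightarrow> (box \<Rightarrow> nat set) \<Rightarrow> nat" where
  "bar_eps la T = (case first_12_box la T of None \<Rightarrow> 0
     | Some b \<Rightarrow> if 2 \<in> T b then if 1 \<in> T b then 1 else 2 else 0)"

definition bar_phi :: "nat list \<Rightarrow> (box \<Rightarrow> nat set) \<Rightarrow> nat" where
  "bar_phi la T = (case first_12_box la T of None \<Rightarrow> 0
     | Some b \<Rightarrow> if 1 \<in> T b then if 2 \<in> T b then 1 else 2 else 0)"

text \<open>The box found stays the first one, since after each change it still contains 1 or
  2.\<close>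

lemma ebar_step:
  assumes b: "first_12_box la T = Some b"
  shows "tab_ebar la T = (if 2 \<notin> T b then None else
      if 1 \<in> T b then Some (T(b := T b - {2})) else Some (T(b := insert 1 (T b))))"
    and "tab_fbar la T = (if 1 \<notin> T b then None else
      if 2 \<in> T b then Some (T(b := T b - {1})) else Some (T(b := insert 2 (T b))))"
    and "1 \<in> T b \<Longrightarrow> first_12_box la (T(b := T b - {2})) = Some b"
    and "2 \<in> T b \<Longrightarrow> first_12_box la (T(b := T b - {1})) = Some b"
    and "first_12_box la (T(b := insert 1 (T b))) = Some b"
    and "first_12_box la (T(b := insert 2 (T b))) = Some b"
proof -
  note fb = first_12_box_Some(2)[OF b]
  show "tab_ebar la T = (if 2 \<notin> T b then None else
      if 1 \<in> T b then Some (T(b := T b - {2})) else Some (T(b := insert 1 (T b))))"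
    and "tab_fbar la T = (if 1 \<notin> T b then None else
      if 2 \<in> T b then Some (T(b := T b - {1})) else Some (T(b := insert 2 (T b))))"
    using b fb by (auto simp: tab_ebar_def tab_fbar_def)
  have *: "first_12_box la (T(b := A)) = Some b" if "1 \<in> A \<or> 2 \<in> A" for A
    using first_12_box_cong[of "T(b := A)" T la] that fb b by (auto split: if_splits)
  show "1 \<in> T b \<Longrightarrow> first_12_box la (T(b := T b - {2})) = Some b"
    and "2 \<in> T b \<Longrightarrow> first_12_box la (T(b := T b - {1})) = Some b"
    and "first_12_box la (T(b := insert 1 (T b))) = Some b"
    and "first_12_box la (T(b := insert 2 (T b))) = Some b"
    by (rule *; simp)+
qed

lemma ebar_fbar_inverse: "tab_ebar la T = Some T' \<longleftrightarrow> tab_fbar la T' = Some T"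
proof
  assume e: "tab_ebar la T = Some T'"
  then obtain b where b: "first_12_box la T = Some b"
    by (auto simp: tab_ebar_def split: option.splits)
  show "tab_fbar la T' = Some T"
    using e ebar_step(1)[OF b] ebar_step(2)[OF ebar_step(3)[OF b]] ebar_step(2)[OF ebar_step(5)[OF b]]
    by (auto split: if_splits simp: insert_absorb)
next
  assume f: "tab_fbar la T' = Some T"
  then obtain b where b: "first_12_box la T' = Some b"
    by (auto simp: tab_fbar_def split: option.splits)
  show "tab_ebar la T = Some T'"
    using f ebar_step(2)[OF b] ebar_step(1)[OF ebar_step(4)[OF b]] ebar_step(1)[OF ebar_step(6)[OF b]]
    by (auto split: if_splits simp: insert_absorb)
qed

lemma string_length_ebar: "string_length (tab_ebar la) T = enat (bar_eps la T)"
proof (rule string_length_eqI[where R = "\<lambda>T m. bar_eps la T = m"])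
  fix T assume "bar_eps la T = 0"
  then show "tab_ebar la T = None"
    by (auto simp: bar_eps_def ebar_step(1) split: option.splits if_splits) (simp add: tab_ebar_def)
next
  fix T m assume m: "bar_eps la T = Suc m"
  then obtain b where b: "first_12_box la T = Some b"
    by (auto simp: bar_eps_def split: option.splits)
  have two: "2 \<in> T b" using m b by (cases "2 \<in> T b") (simp_all add: bar_eps_def)
  show "\<exists>c. tab_ebar la T = Some c \<and> bar_eps la c = m"
  proof (cases "1 \<in> T b")
    case True
    then have "m = 0" using m b two by (simp add: bar_eps_def)
    then show ?thesis using ebar_step(1,3)[OF b] True two by (simp add: bar_eps_def)
  next
    case False
    then have "m = 1" using m b two by (simp add: bar_eps_def)
    then show ?thesis using ebar_step(1,5)[OF b] False two by (simp add: bar_eps_def)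
  qed
qed simp

lemma string_length_fbar: "string_length (tab_fbar la) T = enat (bar_phi la T)"
proof (rule string_length_eqI[where R = "\<lambda>T m. bar_phi la T = m"])
  fix T assume "bar_phi la T = 0"
  then show "tab_fbar la T = None"
    by (auto simp: bar_phi_def ebar_step(2) split: option.splits if_splits) (simp add: tab_fbar_def)
next
  fix T m assume m: "bar_phi la T = Suc m"
  then obtain b where b: "first_12_box la T = Some b"
    by (auto simp: bar_phi_def split: option.splits)
  have one: "1 \<in> T b" using m b by (cases "1 \<in> T b") (simp_all add: bar_phi_def)
  show "\<exists>c. tab_fbar la T = Some c \<and> bar_phi la c = m"
  proof (cases "2 \<in> T b")
    case True
    then have "m = 0" using m b one by (simp add: bar_phi_def)
    then show ?thesis using ebar_step(2,4)[OF b] True one by (simp add: bar_phi_def)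
  next
    case False
    then have "m = 1" using m b one by (simp add: bar_phi_def)
    then show ?thesis using ebar_step(2,6)[OF b] False one by (simp add: bar_phi_def)
  qed
qed simp

text \<open>
  Every operator changes a single box, by an amount that depends only on the occurrences of two
  letters; operators with disjoint pairs of letters commute.
\<close>

definition change :: "'x \<times> 'a set \<times> 'a set \<Rightarrow> ('x \<Rightarrow> 'a set) \<Rightarrow> 'x \<Rightarrow> 'a set" where
  "change d T = T(fst d := T (fst d) \<union> fst (snd d) - snd (snd d))"

definition local_operator :: "'a set \<Rightarrow> (('x \<Rightarrow> 'a set) \<Rightarrow> ('x \<Rightarrow> 'a set) option) \<Rightarrow> bool" where
  "local_operator E g \<longleftrightarrow> (\<exists>act. (\<forall>T. g T = map_option (\<lambda>d. change d T) (act T)) \<and>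
     (\<forall>T d. act T = Some d \<longrightarrow> fst (snd d) \<subseteq> E \<and> snd (snd d) \<subseteq> E) \<and>
     (\<forall>T T'. (\<forall>x. T x \<inter> E = T' x \<inter> E) \<longrightarrow> act T = act T'))"

text \<open>Neither choice of box sees the letters that the other operator changes, and even in one
  and the same box the two changes commute because their letters are disjoint.\<close>

lemma local_operators_commute:
  assumes "local_operator E g" "local_operator F h" "E \<inter> F = {}"
  shows "Option.bind (g T) h = Option.bind (h T) g"
proof -
  obtain a where a: "\<And>T. g T = map_option (\<lambda>d. change d T) (a T)"
      "\<And>T d. a T = Some d \<Longrightarrow> fst (snd d) \<subseteq> E \<and> snd (snd d) \<subseteq> E"
      "\<And>T T'. (\<And>x. T x \<inter> E = T' x \<inter> E) \<Longrightarrow> a T = a T'"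
    using assms(1) unfolding local_operator_def by blast
  obtain c where c: "\<And>T. h T = map_option (\<lambda>d. change d T) (c T)"
      "\<And>T d. c T = Some d \<Longrightarrow> fst (snd d) \<subseteq> F \<and> snd (snd d) \<subseteq> F"
      "\<And>T T'. (\<And>x. T x \<inter> F = T' x \<inter> F) \<Longrightarrow> c T = c T'"
    using assms(2) unfolding local_operator_def by blast
  have ac: "a (change d T) = a T" if "c T = Some d" for d
    by (rule a(3)) (use c(2)[OF that] assms(3) in \<open>auto simp: change_def\<close>)
  have ca: "c (change d T) = c T" if "a T = Some d" for d
    by (rule c(3)) (use a(2)[OF that] assms(3) in \<open>auto simp: change_def\<close>)
  have "change d (change d' T) = change d' (change d T)" if "a T = Some d" "c T = Some d'" for d d'
    using a(2)[OF that(1)] c(2)[OF that(2)] assms(3) by (auto simp: change_def fun_eq_iff)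
  then show ?thesis
    using ac ca by (cases "a T"; cases "c T") (auto simp: a(1) c(1))
qed

lemma linked_word_cong:
  assumes "\<And>x. T x \<inter> {i, i + 1} = T' x \<inter> {i, i + 1}"
  shows "linked_word la i T = linked_word la i T'"
proof -
  have "box_symbs i T = box_symbs i T'"
  proof
    show "box_symbs i T x = box_symbs i T' x" for x
      using assms[of x] by (auto simp: box_symbs_def)
  qed
  then show ?thesis unfolding linked_word_def by (simp only:)
qed

lemma local_tab_e: "local_operator {i, i + 1} (tab_e la i)"
  unfolding local_operator_def
proof (rule exI, intro conjI allI impI)
  let ?act = "\<lambda>T. let W = linked_word la i T; w = map fst W in
      if \<exists>C. combined_form w C then Some (snd (W ! Max (THE C. combined_form w C)), {}, {i + 1})
      else if \<not> (\<exists>C. left_form w C) then None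
      else Some (snd (W ! first_left_start w), {i}, {})"
  show "tab_e la i T = map_option (\<lambda>d. change d T) (?act T)" for T
    by (cases "\<exists>C. combined_form (map fst (linked_word la i T)) C";
        cases "\<exists>C. left_form (map fst (linked_word la i T)) C")
      (simp_all only: tab_e_def change_def Let_def if_True if_False simp_thms option.map fst_conv snd_conv
        Un_empty_right Diff_empty)
  show "fst (snd d) \<subseteq> {i, i + 1}" "snd (snd d) \<subseteq> {i, i + 1}" if "?act T = Some d" for T d
    using that by (auto simp: Let_def split: if_splits)
  show "?act T = ?act T'" if "\<forall>x. T x \<inter> {i, i + 1} = T' x \<inter> {i, i + 1}" for T T'
  proof -
    have "linked_word la i T = linked_word la i T'" using that by (intro linked_word_cong) blast
    then show ?thesis by (simp only:)
  qed
qed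

lemma local_tab_f: "local_operator {i, i + 1} (tab_f la i)"
  unfolding local_operator_def
proof (rule exI, intro conjI allI impI)
  let ?act = "\<lambda>T. let W = linked_word la i T; w = map fst W in
      if \<exists>C. combined_form w C then Some (snd (W ! Min (THE C. combined_form w C)), {}, {i})
      else if \<not> (\<exists>C. right_form w C) then None
      else Some (snd (W ! last_right_end w), {i + 1}, {})"
  show "tab_f la i T = map_option (\<lambda>d. change d T) (?act T)" for T
    by (cases "\<exists>C. combined_form (map fst (linked_word la i T)) C";
        cases "\<exists>C. right_form (map fst (linked_word la i T)) C")
      (simp_all only: tab_f_def change_def Let_def if_True if_False simp_thms option.map fst_conv snd_conv
        Un_empty_right Diff_empty)
  show "fst (snd d) \<subseteq> {i, i + 1}" "snd (snd d) \<subseteq> {i, i + 1}" if "?act T = Some d" for T d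
    using that by (auto simp: Let_def split: if_splits)
  show "?act T = ?act T'" if "\<forall>x. T x \<inter> {i, i + 1} = T' x \<inter> {i, i + 1}" for T T'
  proof -
    have "linked_word la i T = linked_word la i T'" using that by (intro linked_word_cong) blast
    then show ?thesis by (simp only:)
  qed
qed

lemma first_12_box_local:
  assumes "\<And>x. T x \<inter> {1, 2} = T' x \<inter> {1, 2}"
  shows "first_12_box la T = first_12_box la T'" "1 \<in> T x \<longleftrightarrow> 1 \<in> T' x" "2 \<in> T x \<longleftrightarrow> 2 \<in> T' x"
proof -
  have *: "1 \<in> T x \<longleftrightarrow> 1 \<in> T' x" "2 \<in> T x \<longleftrightarrow> 2 \<in> T' x" for x using assms[of x] by blast+
  then show "first_12_box la T = first_12_box la T'" by (intro first_12_box_cong) simp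
  show "1 \<in> T x \<longleftrightarrow> 1 \<in> T' x" "2 \<in> T x \<longleftrightarrow> 2 \<in> T' x" by (rule *)+
qed

lemma local_tab_ebar: "local_operator {1, 2} (tab_ebar la)"
  unfolding local_operator_def
proof (rule exI, intro conjI allI impI)
  let ?act = "\<lambda>T. case first_12_box la T of None \<Rightarrow> None
    | Some b \<Rightarrow> if 1 \<notin> T b \<and> 2 \<in> T b then Some (b, {1}, {})
        else if 1 \<in> T b \<and> 2 \<in> T b then Some (b, {}, {2}) else None"
  show "tab_ebar la T = map_option (\<lambda>d. change d T) (?act T)" for T
    by (simp add: tab_ebar_def change_def split: option.split)
  show "fst (snd d) \<subseteq> {1, 2}" "snd (snd d) \<subseteq> {1, 2}" if "?act T = Some d" for T d
    using that by (auto split: option.splits if_splits)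
  show "?act T = ?act T'" if "\<forall>x. T x \<inter> {1, 2} = T' x \<inter> {1, 2}" for T T'
  proof -
    have "first_12_box la T = first_12_box la T'" "\<And>x. 1 \<in> T x \<longleftrightarrow> 1 \<in> T' x" "\<And>x. 2 \<in> T x \<longleftrightarrow> 2 \<in> T' x"
      using first_12_box_local[of T T'] that by blast+
    then show ?thesis by (simp only:)
  qed
qed

lemma local_tab_fbar: "local_operator {1, 2} (tab_fbar la)"
  unfolding local_operator_def
proof (rule exI, intro conjI allI impI)
  let ?act = "\<lambda>T. case first_12_box la T of None \<Rightarrow> None
    | Some b \<Rightarrow> if 1 \<in> T b \<and> 2 \<notin> T b then Some (b, {2}, {})
        else if 1 \<in> T b \<and> 2 \<in> T b then Some (b, {}, {1}) else None"
  show "tab_fbar la T = map_option (\<lambda>d. change d T) (?act T)" for T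
    by (simp add: tab_fbar_def change_def split: option.split)
  show "fst (snd d) \<subseteq> {1, 2}" "snd (snd d) \<subseteq> {1, 2}" if "?act T = Some d" for T d
    using that by (auto split: option.splits if_splits)
  show "?act T = ?act T'" if "\<forall>x. T x \<inter> {1, 2} = T' x \<inter> {1, 2}" for T T'
  proof -
    have "first_12_box la T = first_12_box la T'" "\<And>x. 1 \<in> T x \<longleftrightarrow> 1 \<in> T' x" "\<And>x. 2 \<in> T x \<longleftrightarrow> 2 \<in> T' x"
      using first_12_box_local[of T T'] that by blast+
    then show ?thesis by (simp only:)
  qed
qed

lemma local_operator_other_letter:
  assumes "local_operator E g" "g T = Some T'" "a \<notin> E"
  shows "a \<in> T' x \<longleftrightarrow> a \<in> T x"
proof -
  obtain act where act: "\<And>T. g T = map_option (\<lambda>d. change d T) (act T)"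
      "\<And>T d. act T = Some d \<Longrightarrow> fst (snd d) \<subseteq> E \<and> snd (snd d) \<subseteq> E"
    using assms(1) unfolding local_operator_def by blast
  have "map_option (\<lambda>d. change d T) (act T) = Some T'" using act(1)[of T] assms(2) by simp
  then obtain d where "act T = Some d" "T' = change d T" unfolding map_option_eq_Some by blast
  then show ?thesis using act(2)[of T d] assms(3) by (auto simp: change_def)
qed

text \<open>One decomposition serves both fillings, as it depends only on which boxes contain
  \<open>i\<close> and which contain \<open>i + 1\<close>.\<close>

lemma string_length_cong:
  assumes "\<And>x. i \<in> T' x \<longleftrightarrow> i \<in> T x" "\<And>x. Suc i \<in> T' x \<longleftrightarrow> Suc i \<in> T x"
  shows "string_length (tab_e la i) T' = string_length (tab_e la i) T"
    "string_length (tab_f la i) T' = string_length (tab_f la i) T"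
proof -
  obtain bs where bs: "decomp la i T bs" using decomp_exists by blast
  have "boxes la i T' = boxes la i T" "kind T' i = kind T i"
    using assms by (auto simp: boxes_def kind_def)
  then have "decomp la i T' bs" using bs by (simp add: decomp_def)
  then show "string_length (tab_e la i) T' = string_length (tab_e la i) T"
    "string_length (tab_f la i) T' = string_length (tab_f la i) T"
    using bs by (simp_all add: string_length_e string_length_f)
qed

lemma sqrt_q_crystal_SetDecTab:
  assumes la: "strict_partition la" and n: "2 \<le> n"
  shows "sqrt_q_crystal n (SetDecTab n la) (tab_wt la) (tab_e la) (tab_f la) (tab_ebar la) (tab_fbar la)"
proof -
  interpret sqrt_gl_crystal n "SetDecTab n la" "tab_wt la" "tab_e la" "tab_f la"
    by (rule sqrt_gl_crystal_SetDecTab[OF la])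
  have wt: "vec_diff (tab_wt la T') (tab_wt la T) = (if bar_eps la T = 2 then unit_vec 1 else - unit_vec 2)"
    if e: "tab_ebar la T = Some T'" for T T'
  proof -
    obtain b where b: "first_12_box la T = Some b"
      using e by (auto simp: tab_ebar_def split: option.splits)
    note SD = first_12_box_Some(1)[OF b]
    consider "2 \<in> T b" "1 \<in> T b" "T' = T(b := T b - {2})" "bar_eps la T = 1"
      | "2 \<in> T b" "1 \<notin> T b" "T' = T(b := insert 1 (T b))" "bar_eps la T = 2"
      using e unfolding ebar_step(1)[OF b] bar_eps_def b by (auto split: if_splits)
    then show ?thesis
    proof cases
      case 1
      have "tab_wt la T k = tab_wt la T' k + (if k = 2 then 1 else 0)" for k
        unfolding 1(3) by (rule tab_wt_remove[where T = T, OF SD 1(1)])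
      then show ?thesis using 1(4) by (simp add: vec_diff_def unit_vec_def fun_eq_iff)
    next
      case 2
      have "tab_wt la T' k = tab_wt la T k + (if k = 1 then 1 else 0)" for k
        unfolding 2(3) by (rule tab_wt_insert[where T = T, OF SD 2(2)])
      then show ?thesis using 2(4) by (simp add: vec_diff_def unit_vec_def fun_eq_iff)
    qed
  qed
  show ?thesis
  proof
    fix i g h assume i: "i \<in> {3..n-1}" and g: "g \<in> {tab_ebar la, tab_fbar la}"
      and h: "h \<in> {tab_e la i, tab_f la i}"
    have "local_operator {1, 2} g" "local_operator {i, i + 1} h"
      using g h local_tab_ebar local_tab_fbar local_tab_e local_tab_f by auto
    then show "commute_on (SetDecTab n la) g h"
      unfolding commute_on_def using i by (intro ballI local_operators_commute) auto
  next
    fix i g T T' assume i: "i \<in> {3..n-1}" and g: "g \<in> {tab_ebar la, tab_fbar la}" "g T = Some T'"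
    have loc: "local_operator {1, 2} g" using g local_tab_ebar local_tab_fbar by auto
    have "i \<in> T' x \<longleftrightarrow> i \<in> T x" "Suc i \<in> T' x \<longleftrightarrow> Suc i \<in> T x" for x
      using local_operator_other_letter[OF loc g(2)] i by auto
    then show "string_length (tab_e la i) T' = string_length (tab_e la i) T \<and>
        string_length (tab_f la i) T' = string_length (tab_f la i) T"
      using string_length_cong by blast
  next
    fix T
    have "tab_wt la T 1 = 0 \<and> tab_wt la T 2 = 0 \<longleftrightarrow> first_12_box la T = None"
      unfolding first_12_box_None tab_wt_def using finite_SD[of la] by auto
    then show "string_length (tab_ebar la) T + string_length (tab_fbar la) T =
        (if tab_wt la T 1 = 0 \<and> tab_wt la T 2 = 0 then 0 else 2)"
      using first_12_box_Some(2)[of la T]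
      by (auto simp: string_length_ebar string_length_fbar bar_eps_def bar_phi_def
          zero_enat_def numeral_eq_enat split: option.split)
  next
    fix T T'
    show "tab_ebar la T = Some T' \<longleftrightarrow> tab_fbar la T' = Some T" by (rule ebar_fbar_inverse)
  next
    fix T T' assume "T \<in> SetDecTab n la" "tab_ebar la T = Some T'"
    then show "T' \<in> SetDecTab n la" by (rule tab_ebar_closed[OF la n])
  next
    fix T T' assume "T \<in> SetDecTab n la" "tab_fbar la T = Some T'"
    then show "T' \<in> SetDecTab n la" by (rule tab_fbar_closed[OF la n])
  next
    fix T T' assume e: "tab_ebar la T = Some T'" and "string_length (tab_ebar la) T = 2"
    then have "bar_eps la T = 2" by (simp add: string_length_ebar numeral_eq_enat)
    then show "vec_diff (tab_wt la T') (tab_wt la T) = unit_vec 1" using wt[OF e] by simp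
  next
    fix T T' assume e: "tab_ebar la T = Some T'" and "string_length (tab_ebar la) T = 1"
    then have "bar_eps la T = 1" by (simp add: string_length_ebar one_enat_def)
    then show "vec_diff (tab_wt la T') (tab_wt la T) = - unit_vec 2" using wt[OF e] by simp
  qed
qed

theorem theorem3p24:
  fixes n :: nat and la :: "nat list"
  assumes "n \<ge> 2"
    and "strict_partition la"
    and "length la \<le> n"
  shows "(\<forall>i\<in>{1..n-1}. \<forall>T\<in>SetDecTab n la.
            linked_word_unambiguous (linked_word la i T) \<and>
            tab_e la i T \<in> Some ` SetDecTab n la \<union> {None} \<and>
            tab_f la i T \<in> Some ` SetDecTab n la \<union> {None}) \<and>
         (\<forall>T\<in>SetDecTab n la.
            tab_ebar la T \<in> Some ` SetDecTab n la \<union> {None} \<and>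
            tab_fbar la T \<in> Some ` SetDecTab n la \<union> {None}) \<and>
         sqrt_q_crystal n (SetDecTab n la) (tab_wt la)
           (tab_e la) (tab_f la) (tab_ebar la) (tab_fbar la)"
proof -
  have opt: "x \<in> Some ` S \<union> {None}" if "\<And>y. x = Some y \<Longrightarrow> y \<in> S"
    for x :: "(box \<Rightarrow> nat set) option" and S
    using that by (cases x) auto
  have "linked_word_unambiguous (linked_word la i T)" for i T
  proof -
    obtain bs where "decomp la i T bs" using decomp_exists by blast
    then interpret decomposed la i T bs by unfold_locales
    show ?thesis by (rule unambiguous)
  qed
  then show ?thesis
    using sqrt_q_crystal_SetDecTab[OF assms(2,1)]
    by (intro conjI ballI opt)
      (auto intro: tab_e_closed[OF assms(2)] tab_f_closed[OF assms(2)]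
        tab_ebar_closed[OF assms(2,1)] tab_fbar_closed[OF assms(2,1)])
qed

end
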